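(* Let $F$ be a field of characteristic $p>0$ with $F^{p-1}=F$. \begin{enumerate} \item[(a)] Let $S_1,\ldots,S_{r+1}\subset F$ be nonempty with $\mathrm{pdeg}(S_i)=1$ for $i=1,\ldots,r$ and $\mathrm{d} S_1\wedge\cdots\wedge\mathrm{d} S_r\wedge\mathrm{d} S_{r+1}\neq\{0\}$. Write $\mathrm{pdeg}(S_1\cup\cdots\cup S_{r+1})=r+\ell$ with $\ell\in\mathbb Z$. Then $\ell\geq1$, and for any $p$-independent set $\{a_1,\ldots,a_r,e_1,\ldots,e_\ell\}\subset F$ with $F^p(S_i)=F^p(a_i)$ for $i=1,\ldots,r$ and $F^p(a_1,\ldots,a_r)(S_{r+1})=F^p(a_1,\ldots,a_r)(e_1,\ldots,e_\ell)$ we have $$\operatorname{ann}\nu^n_F(\mathrm{d} S_1\wedge\cdots\wedge\mathrm{d} S_r\wedge\mathrm{d} S_{r+1})=\Big[\tfrac{\mathrm{d} x}{x}\;\Big|\; x\in F^p(a_1,\ldots,a_r)^*\Big]\wedge\nu_{n-1}(F)+\Big[\tfrac{\mathrm{d} y_1}{y_1}\wedge\cdots\wedge\tfrac{\mathrm{d} y_\ell}{y_\ell}\;\Big|\;y_1,\ldots,y_\ell\in F^p(a_1,\ldots,a_r,e_1,\ldots,e_\ell)^*\Big]\wedge\nu_{n-\ell}(F).$$ \item[(b)] Let $S\subset F$ be nonempty with $\mathrm{pdeg}(S)=k\in\mathbb N$ and let $\{a_1,\ldots,a_k\}$ be a $p$-basis of $F^p(S)$. For $r\in\{1,\ldots,k\}$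 put $t=k-r+1$. Then $$\operatorname{ann}\nu^n_F\Big(\textstyle\bigwedge^r\mathrm{d} S\Big)=\Big[\tfrac{\mathrm{d} y_1}{y_1}\wedge\cdots\wedge\tfrac{\mathrm{d} y_t}{y_t}\;\Big|\;y_1,\ldots,y_t\in F^p(a_1,\ldots,a_k)^*\Big]\wedge\nu_{n-t}(F),$$ and for $r>k$ we have $\operatorname{ann}\nu^n_F(\bigwedge^r\mathrm{d} S)=\nu_n(F)$. \end{enumerate}
   Context: $F$ is a field of characteristic $p>0$. $\Omega^1(F)$ is the $F$-vector space generated by symbols $\mathrm{d} a$ ($a\in F$) with $\mathrm{d}(a+b)=\mathrm{d} a+\mathrm{d} b$, $\mathrm{d}(ab)=a\,\mathrm{d} b+b\,\mathrm{d} a$; $\Omega^n(F)=\bigwedge^n_F\Omega^1(F)$, $\Omega^0(F)=F$, $\Omega^n(F)=0$ for $n<0$; $\mathrm{d}:\Omega^{n-1}(F)\to\Omega^n(F)$, $x\,\mathrm{d} a_1\wedge\cdots\mapsto\mathrm{d} x\wedge\mathrm{d} a_1\wedge\cdots$. A subset $A\subset F$ is $p$-independent if $[F^p(a_1,\ldots,a_k):F^p]=p^k$ for all finite $\{a_1,\ldots,a_k\}\subset A$; for $C\subset F$, $\mathrm{pdeg}(C)=\log_p[F^p(C):F^p]$ ($\infty$ if infinite); for a field $L$ with $F^p\subseteq L\subseteq F$, a $p$-basis of $L$ is a $p$-independent $A\subset L$ with $F^p(A)=L$. $\wp:\Omega^n(F)\to\Omega^n(F)/\mathrm{d}\Omega^{n-1}(F)$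 is the additive map $x\frac{\mathrm{d} a_1}{a_1}\wedge\cdots\wedge\frac{\mathrm{d} a_n}{a_n}\mapsto(x^p-x)\frac{\mathrm{d} a_1}{a_1}\wedge\cdots\wedge\frac{\mathrm{d} a_n}{a_n}\bmod\mathrm{d}\Omega^{n-1}(F)$, $\nu_n(F)=\ker\wp$ (additively generated by logarithmic forms $\frac{\mathrm{d} a_1}{a_1}\wedge\cdots\wedge\frac{\mathrm{d} a_n}{a_n}$, $a_i\in F^*$; $\nu_0(F)=\mathbb F_p$, $\nu_m(F)=0$ for $m<0$). For nonempty $S_1,\ldots,S_k\subset F$, $\mathrm{d} S_1\wedge\cdots\wedge\mathrm{d} S_k=\{\mathrm{d} s_1\wedge\cdots\wedge\mathrm{d} s_k\mid s_i\in S_i\}$ and $\bigwedge^k\mathrm{d} S=\mathrm{d} S\wedge\cdots\wedge\mathrm{d} S$ ($k$ factors). For nonempty $U\subset\Omega^k(F)$, $\operatorname{ann}\Omega^n_F(U)=\{\omega\in\Omega^n(F)\mid\omega\wedge u=0\ \forall u\in U\}$ and $\operatorname{ann}\nu^n_F(U)=\operatorname{ann}\Omega^n_F(U)\cap\nu_n(F)$. $[\,\cdots]$ denotes the additive subgroup generated; $X\wedge Y$ denotes the additive subgroup generated by all $x\wedge y$, $x\in X$, $y\in Y$. *)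

theory Defs
  imports Main "HOL-Library.Extended_Nat" "HOL-Computational_Algebra.Primes"
begin

text \<open>A formal sum is a finitely supported function from words [a1,...,an] to F;
  the word [a1,...,an] with coefficient x stands for x da1 /\ ... /\ dan.\<close>

type_synonym 'a fsum = "'a list \<Rightarrow> 'a"

definition FS :: "'a::field fsum set" where
  "FS = {c. finite {l. c l \<noteq> 0}}"

definition dl :: "'a list \<Rightarrow> 'a::field fsum" where
  "dl as = (\<lambda>m. if m = as then 1 else 0)"

text \<open>Relations: additivity and Leibniz rule for d in every slot, and vanishing of
  wedge products with a repeated factor. Rel is the F-span of these (a two-sided ideal).\<close>

inductive_set Rel :: "'a::field fsum set" where
  zero: "(\<lambda>_. 0) \<in> Rel"
| add: "r \<in> Rel \<Longrightarrow> s \<in> Rel \<Longrightarrow> (\<lambda>m. r m + s m) \<in> Rel"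
| smult: "r \<in> Rel \<Longrightarrow> (\<lambda>m. x * r m) \<in> Rel"
| additive: "(\<lambda>m. dl (xs @ [a + b] @ ys) m - dl (xs @ [a] @ ys) m - dl (xs @ [b] @ ys) m) \<in> Rel"
| leibniz: "(\<lambda>m. dl (xs @ [a * b] @ ys) m - a * dl (xs @ [b] @ ys) m - b * dl (xs @ [a] @ ys) m) \<in> Rel"
| alt: "dl (xs @ [a] @ ys @ [a] @ zs) \<in> Rel"

text \<open>Classes modulo Rel: elements of the exterior algebra Omega(F) = (+)_n Omega^n(F).\<close>

definition cls :: "'a::field fsum \<Rightarrow> 'a fsum set" where
  "cls c = {c'. c' \<in> FS \<and> (\<lambda>m. c' m - c m) \<in> Rel}"

definition Omega :: "nat \<Rightarrow> 'a::field fsum set set" where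
  "Omega n = cls ` {c \<in> FS. \<forall>l. c l \<noteq> 0 \<longrightarrow> length l = n}"

definition zeroC :: "'a::field fsum set" where
  "zeroC = cls (\<lambda>_. 0)"

definition addC :: "'a::field fsum set \<Rightarrow> 'a fsum set \<Rightarrow> 'a fsum set" where
  "addC \<omega> \<eta> = {(\<lambda>m. a m + b m) | a b. a \<in> \<omega> \<and> b \<in> \<eta>}"

definition negC :: "'a::field fsum set \<Rightarrow> 'a fsum set" where
  "negC \<omega> = {(\<lambda>m. - a m) | a. a \<in> \<omega>}"

definition fmult :: "'a::field fsum \<Rightarrow> 'a fsum \<Rightarrow> 'a fsum" where
  "fmult a b = (\<lambda>l. \<Sum>i\<le>length l. a (take i l) * b (drop i l))"

definition wedgeC :: "'a::field fsum set \<Rightarrow> 'a fsum set \<Rightarrow> 'a fsum set" where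
  "wedgeC \<omega> \<eta> = \<Union>{cls (fmult a b) | a b. a \<in> \<omega> \<and> b \<in> \<eta>}"

inductive_set addgen :: "'a::field fsum set set \<Rightarrow> 'a fsum set set" for G where
  zero: "zeroC \<in> addgen G"
| base: "g \<in> G \<Longrightarrow> g \<in> addgen G"
| add: "x \<in> addgen G \<Longrightarrow> y \<in> addgen G \<Longrightarrow> addC x y \<in> addgen G"
| neg: "x \<in> addgen G \<Longrightarrow> negC x \<in> addgen G"

definition wedgeS :: "'a::field fsum set set \<Rightarrow> 'a fsum set set \<Rightarrow> 'a fsum set set" where
  "wedgeS X Y = addgen {wedgeC x y | x y. x \<in> X \<and> y \<in> Y}"

definition sumS :: "'a::field fsum set set \<Rightarrow> 'a fsum set set \<Rightarrow> 'a fsum set set" where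
  "sumS X Y = {addC x y | x y. x \<in> X \<and> y \<in> Y}"

definition dlogC :: "'a::field list \<Rightarrow> 'a fsum set" where
  "dlogC ys = cls (\<lambda>l. (1 / prod_list ys) * dl ys l)"

text \<open>d on formal sums: x da1/\.../\dan |-> dx /\ da1 /\ ... /\ dan.\<close>
definition dfs :: "'a::field fsum \<Rightarrow> 'a fsum" where
  "dfs c = (\<lambda>m. case m of [] \<Rightarrow> 0 | a # l \<Rightarrow> (if c l = a \<and> c l \<noteq> 0 then 1 else 0))"

text \<open>d Omega^(n-1)(F) inside Omega^n(F) (= 0 for n = 0).\<close>
definition dOmega :: "nat \<Rightarrow> 'a::field fsum set set" where
  "dOmega n = {cls (dfs c) | c. c \<in> FS \<and> (\<forall>l. c l \<noteq> 0 \<longrightarrow> Suc (length l) = n)}"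

definition lfs :: "('a::field \<times> 'a list) list \<Rightarrow> 'a fsum" where
  "lfs reps = (\<lambda>m. \<Sum>(x, as) \<leftarrow> reps. x / prod_list as * dl as m)"

text \<open>nu_n(F) = ker wp: forms with a logarithmic representation whose image
  under x |-> x^p - x lies in d Omega^(n-1)(F).\<close>
definition nu :: "nat \<Rightarrow> nat \<Rightarrow> 'a::field fsum set set" where
  "nu p n = {\<omega> \<in> Omega n. \<exists>reps. (\<forall>(x, as) \<in> set reps. length as = n \<and> 0 \<notin> set as)
       \<and> \<omega> = cls (lfs reps)
       \<and> cls (lfs (map (\<lambda>(x, as). (x ^ p - x, as)) reps)) \<in> dOmega n}"

definition nu_int :: "nat \<Rightarrow> int \<Rightarrow> 'a::field fsum set set" where
  "nu_int p m = (if m < 0 then {zeroC} else nu p (nat m))"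

definition annnu :: "nat \<Rightarrow> nat \<Rightarrow> 'a::field fsum set set \<Rightarrow> 'a fsum set set" where
  "annnu p n U = {\<omega> \<in> Omega n. \<forall>u \<in> U. wedgeC \<omega> u = zeroC} \<inter> nu p n"

definition subfield :: "'a::field set \<Rightarrow> bool" where
  "subfield L \<longleftrightarrow> 0 \<in> L \<and> 1 \<in> L \<and> (\<forall>x\<in>L. \<forall>y\<in>L. x + y \<in> L \<and> x * y \<in> L)
     \<and> (\<forall>x\<in>L. - x \<in> L \<and> inverse x \<in> L)"

definition Fpow :: "nat \<Rightarrow> 'a::field set" where
  "Fpow p = {x ^ p | x. True}"

definition Fpadj :: "nat \<Rightarrow> 'a::field set \<Rightarrow> 'a set" where
  "Fpadj p C = \<Inter>{L. subfield L \<and> Fpow p \<union> C \<subseteq> L}"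

definition lin_indep_over :: "'a::field set \<Rightarrow> 'a set \<Rightarrow> bool" where
  "lin_indep_over K B \<longleftrightarrow> (\<forall>c. (\<forall>b\<in>B. c b \<in> K) \<longrightarrow> (\<Sum>b\<in>B. c b * b) = 0 \<longrightarrow> (\<forall>b\<in>B. c b = 0))"

definition span_over :: "'a::field set \<Rightarrow> 'a set \<Rightarrow> 'a set" where
  "span_over K B = {\<Sum>b\<in>B. c b * b | c. \<forall>b\<in>B. c b \<in> K}"

definition has_degree :: "'a::field set \<Rightarrow> 'a set \<Rightarrow> nat \<Rightarrow> bool" where
  "has_degree K L d \<longleftrightarrow> (\<exists>B. finite B \<and> card B = d \<and> B \<subseteq> L \<and> lin_indep_over K B \<and> span_over K B = L)"

definition pdeg :: "nat \<Rightarrow> 'a::field set \<Rightarrow> enat" where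
  "pdeg p C = (if \<exists>k. has_degree (Fpow p) (Fpadj p C) (p ^ k)
     then enat (THE k. has_degree (Fpow p) (Fpadj p C) (p ^ k)) else \<infinity>)"

definition p_indep :: "nat \<Rightarrow> 'a::field set \<Rightarrow> bool" where
  "p_indep p A \<longleftrightarrow> (\<forall>B \<subseteq> A. finite B \<longrightarrow> has_degree (Fpow p) (Fpadj p B) (p ^ card B))"

definition p_basis :: "nat \<Rightarrow> 'a::field set \<Rightarrow> 'a set \<Rightarrow> bool" where
  "p_basis p L A \<longleftrightarrow> A \<subseteq> L \<and> p_indep p A \<and> Fpadj p A = L"

definition dwedge :: "nat \<Rightarrow> (nat \<Rightarrow> 'a::field set) \<Rightarrow> 'a fsum set set" where
  "dwedge k S = {cls (dl s) | s. length s = k \<and> (\<forall>i<k. s ! i \<in> S (Suc i))}"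

end

theory Submission
  imports Defs "HOL-Computational_Algebra.Formal_Power_Series" "HOL-Computational_Algebra.Polynomial"
    "HOL-Library.Nat_Bijection"
begin

text \<open>The argument is Kato's. Enlarge the given \<open>p\<close>-independent elements to a finite \<open>p\<close>-independent
  sequence \<open>b\<^sub>0, \<dots>, b\<^sub>N\<^sub>-\<^sub>1\<close> which generates over \<open>F\<^sup>p\<close> everything occurring in a form \<open>\<omega> \<in> \<nu>\<^sub>n(F)\<close> and in a
  primitive of \<open>\<wp>(\<omega>)\<close>. Expand \<open>\<omega>\<close> in the exterior products of the forms \<open>db\<^sub>j/b\<^sub>j\<close> and order their index
  sets by the largest element in which they differ. Exactness of \<open>\<wp>(\<omega>)\<close> imposes a chain of fixed point
  equations on the leading coefficient; by \<open>F\<^sup>p\<^sup>-\<^sup>1 = F\<close> and Jacobson's formula it is then, up to an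
  integer, a product of factors \<open>\<theta>\<^sub>i(c\<^sub>i)/c\<^sub>i\<close> with \<open>c\<^sub>i \<in> F\<^sup>p(b\<^sub>0, \<dots>, b\<^sub>i)\<close> and \<open>\<theta>\<^sub>i = b\<^sub>i \<partial>/\<partial>b\<^sub>i\<close>. So
  \<open>\<omega>\<close> has the leading term of a multiple of the logarithmic form built from the \<open>c\<^sub>i\<close>. If \<open>\<omega>\<close> is annihilated by the
  given differentials, its leading index set contains so many of the first indices that this logarithmic form
  belongs to the asserted group; subtract it and repeat.\<close>

subsection \<open>The exterior algebra as a ring\<close>

text \<open>Membership in \<open>nu\<close> means that some logarithmic representation has an exact
  image under wp, whereas leading terms live in coordinates with respect to the
  \<open>\<beta> j\<close>. Comparing the two amounts to well-definedness of the inverse Cartier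
  operator modulo exact forms (\<open>car_G\<close>, \<open>log_cartier\<close>). The dual
  derivations exist on all of \<open>F\<close> by a Zorn argument, but they are used on
  \<open>G N\<close>, where they commute. On monomials in the \<open>b j\<close> the operator
  \<open>\<theta> j\<close> has the exponent as eigenvalue. Hence
  \<open>1 - \<theta> j ^ (p - 1)\<close> removes the monomials that involve \<open>b j\<close>, and
  it kills derivatives: these projections turn closedness and exactness into equations for one
  coefficient. The order on index sets fits the tower \<open>G\<close>: the logarithmic derivative
  of an element of \<open>G (Suc i)\<close> has no component above \<open>i\<close>. The given
  elements stand in front, so that factors \<open>c i\<close> with small \<open>i\<close> lie in the
  subfields named in the theorem. The other inclusion is a pigeonhole argument: a product of more
  differentials than there are generators of the subfield vanishes.\<close>

lemma FS_zero: "(\<lambda>_. 0) \<in> FS" by (simp add: FS_def)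

lemma FS_dl: "dl l \<in> FS"
  by (simp add: FS_def dl_def)

lemma FS_add: "c \<in> FS \<Longrightarrow> c' \<in> FS \<Longrightarrow> (\<lambda>m. c m + c' m) \<in> FS"
  unfolding FS_def by (auto intro: finite_subset[of _ "{l. c l \<noteq> 0} \<union> {l. c' l \<noteq> 0}"])

lemma FS_smult: "c \<in> FS \<Longrightarrow> (\<lambda>m. x * c m) \<in> FS"
  unfolding FS_def by (auto elim!: finite_subset[rotated])

lemma FS_neg: "c \<in> FS \<Longrightarrow> (\<lambda>m. - c m) \<in> FS"
  using FS_smult[of c "-1"] by simp

lemma FS_diff: "c \<in> FS \<Longrightarrow> c' \<in> FS \<Longrightarrow> (\<lambda>m. c m - c' m) \<in> FS"
  using FS_add[OF _ FS_neg, of c c'] by simp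

lemma Rel_subset_FS: "r \<in> Rel \<Longrightarrow> r \<in> FS"
  by (induction rule: Rel.induct) (intro FS_zero FS_add FS_smult FS_diff FS_dl; assumption)+

lemma Rel_neg: "r \<in> Rel \<Longrightarrow> (\<lambda>m. - r m) \<in> Rel"
  using Rel.smult[of r "-1"] by simp

lemma Rel_diff: "r \<in> Rel \<Longrightarrow> s \<in> Rel \<Longrightarrow> (\<lambda>m. r m - s m) \<in> Rel"
  using Rel.add[OF _ Rel_neg, of r s] by simp

lemma cls_eq_iff:
  assumes "c \<in> FS" "c' \<in> FS"
  shows "cls c = cls c' \<longleftrightarrow> (\<lambda>m. c m - c' m) \<in> Rel"
proof
  assume "cls c = cls c'"
  moreover have "c \<in> cls c" using assms by (simp add: cls_def Rel.zero)
  ultimately show "(\<lambda>m. c m - c' m) \<in> Rel" by (simp add: cls_def)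
next
  assume r: "(\<lambda>m. c m - c' m) \<in> Rel"
  show "cls c = cls c'"
    unfolding cls_def using Rel.add[OF _ r] Rel_diff[OF _ r] by fastforce
qed

lemma mem_cls: "c \<in> FS \<Longrightarrow> c \<in> cls c"
  by (simp add: cls_def Rel.zero)

lemma mem_clsD:
  assumes "c \<in> FS" "c' \<in> cls c" shows "c' \<in> FS" "cls c' = cls c" "(\<lambda>m. c' m - c m) \<in> Rel"
proof -
  show "c' \<in> FS" "(\<lambda>m. c' m - c m) \<in> Rel" using assms(2) by (auto simp: cls_def)
  then show "cls c' = cls c" using assms(1) by (simp add: cls_eq_iff)
qed

lemma addC_cls:
  assumes "c \<in> FS" "c' \<in> FS"
  shows "addC (cls c) (cls c') = cls (\<lambda>m. c m + c' m)"
proof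
  show "addC (cls c) (cls c') \<subseteq> cls (\<lambda>m. c m + c' m)"
  proof
    fix z assume "z \<in> addC (cls c) (cls c')"
    then obtain a b where z: "z = (\<lambda>m. a m + b m)" "a \<in> cls c" "b \<in> cls c'"
      unfolding addC_def by blast
    have "(\<lambda>m. (a m - c m) + (b m - c' m)) \<in> Rel"
      using z assms mem_clsD(3) by (intro Rel.add) blast+
    then show "z \<in> cls (\<lambda>m. c m + c' m)"
      using z assms mem_clsD(1) by (auto simp: cls_def algebra_simps intro!: FS_add)
  qed
next
  show "cls (\<lambda>m. c m + c' m) \<subseteq> addC (cls c) (cls c')"
  proof
    fix z assume z: "z \<in> cls (\<lambda>m. c m + c' m)"
    have zF: "z \<in> FS" using z by (simp add: cls_def)
    have "(\<lambda>m. z m - c' m) \<in> cls c"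
      using z assms zF by (auto simp: cls_def algebra_simps intro!: FS_diff)
    moreover have "z = (\<lambda>m. (z m - c' m) + c' m)" by simp
    ultimately show "z \<in> addC (cls c) (cls c')"
      unfolding addC_def mem_Collect_eq using mem_cls[OF assms(2)] by metis
  qed
qed

lemma negC_cls:
  assumes "c \<in> FS"
  shows "negC (cls c) = cls (\<lambda>m. - c m)"
proof
  show "negC (cls c) \<subseteq> cls (\<lambda>m. - c m)"
  proof
    fix z assume "z \<in> negC (cls c)"
    then obtain a where z: "z = (\<lambda>m. - a m)" "a \<in> cls c" unfolding negC_def by blast
    have "(\<lambda>m. - (a m - c m)) \<in> Rel" using z assms mem_clsD(3) by (intro Rel_neg) blast
    then show "z \<in> cls (\<lambda>m. - c m)"
      using z assms mem_clsD(1) by (auto simp: cls_def algebra_simps intro!: FS_neg)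
  qed
next
  show "cls (\<lambda>m. - c m) \<subseteq> negC (cls c)"
  proof
    fix z assume z: "z \<in> cls (\<lambda>m. - c m)"
    have "(\<lambda>m. - (z m - - c m)) \<in> Rel" using z by (intro Rel_neg) (simp add: cls_def)
    then have "(\<lambda>m. - z m) \<in> cls c" using z by (auto simp: cls_def intro!: FS_neg)
    moreover have "z = (\<lambda>m. - (- z m))" by simp
    ultimately show "z \<in> negC (cls c)" unfolding negC_def mem_Collect_eq by metis
  qed
qed

lemma fmult_dl_left:
  "fmult (dl xs) b m = (if take (length xs) m = xs then b (drop (length xs) m) else 0)"
proof -
  have "fmult (dl xs) b m = (\<Sum>i\<le>length m. if i = length xs then (if take i m = xs then b (drop i m) else 0) else 0)"
    unfolding fmult_def dl_def by (intro sum.cong) (auto)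
  also have "\<dots> = (if take (length xs) m = xs then b (drop (length xs) m) else 0)"
    by (auto simp: sum.delta)
  finally show ?thesis .
qed

lemma fmult_dl_right:
  "fmult a (dl ys) m = (if length ys \<le> length m \<and> drop (length m - length ys) m = ys
     then a (take (length m - length ys) m) else 0)"
proof -
  have "fmult a (dl ys) m = (\<Sum>i\<le>length m. if i = length m - length ys then
      (if length ys \<le> length m \<and> drop (length m - length ys) m = ys
     then a (take (length m - length ys) m) else 0) else 0)"
    unfolding fmult_def dl_def by (intro sum.cong) (auto)
  then show ?thesis by simp
qed

lemma fmult_dl_dl: "fmult (dl xs) (dl ys) = dl (xs @ ys)"
proof
  fix m
  have "take (length xs) m = xs \<and> drop (length xs) m = ys \<longleftrightarrow> m = xs @ ys"
    by (metis append_eq_conv_conj)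
  then show "fmult (dl xs) (dl ys) m = dl (xs @ ys) m"
    by (auto simp: fmult_dl_left) (auto simp: dl_def)
qed

lemma fmult_add_left: "fmult (\<lambda>m. a m + a' m) b = (\<lambda>m. fmult a b m + fmult a' b m)"
  by (auto simp: fmult_def algebra_simps sum.distrib)

lemma fmult_add_right: "fmult a (\<lambda>m. b m + b' m) = (\<lambda>m. fmult a b m + fmult a b' m)"
  by (auto simp: fmult_def algebra_simps sum.distrib)

lemma fmult_diff_left: "fmult (\<lambda>m. a m - a' m) b = (\<lambda>m. fmult a b m - fmult a' b m)"
  by (auto simp: fmult_def algebra_simps sum_subtractf)

lemma fmult_diff_right: "fmult a (\<lambda>m. b m - b' m) = (\<lambda>m. fmult a b m - fmult a b' m)"
  by (auto simp: fmult_def algebra_simps sum_subtractf)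

lemma fmult_smult_left: "fmult (\<lambda>m. x * a m) b = (\<lambda>m. x * fmult a b m)"
  by (auto simp: fmult_def sum_distrib_left algebra_simps)

lemma fmult_smult_right: "fmult a (\<lambda>m. x * b m) = (\<lambda>m. x * fmult a b m)"
  by (auto simp: fmult_def sum_distrib_left algebra_simps)

lemma fmult_zero_left: "fmult (\<lambda>m. 0) b = (\<lambda>m. 0)" by (simp add: fmult_def)

lemma fmult_zero_right: "fmult a (\<lambda>m. 0) = (\<lambda>m. 0)" by (simp add: fmult_def)

lemma fmult_one_left: "fmult (dl []) b = b" by (rule ext) (simp add: fmult_dl_left)

lemma fmult_one_right: "fmult a (dl []) = a" by (rule ext) (simp add: fmult_dl_right)

lemma fmult_assoc: "fmult (fmult a b) c = fmult a (fmult b c)"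
proof
  fix l :: "'a list"
  define n where "n = length l"
  \<comment> \<open>\<open>?f i j k\<close> evaluates at the cut of \<open>l\<close> into
    consecutive pieces of lengths \<open>i\<close>, \<open>j\<close>, \<open>k\<close>. Both sides
    sum it over \<open>i + j + k = n\<close>, as in the associativity of the product of power
    series.\<close>
  let ?f = "\<lambda>i j k. a (take i l) * b (take j (drop i l)) * c (drop (n - k) l)"
  have "fmult (fmult a b) c l = (\<Sum>j=0..n. \<Sum>i=0..j. ?f i (j - i) (n - j))"
    unfolding fmult_def n_def atMost_atLeast0
    by (intro sum.cong refl)
       (auto simp: sum_distrib_right min_def drop_take intro!: sum.cong)
  also have "\<dots> = (\<Sum>j=0..n. \<Sum>i=0..n - j. ?f j i (n - j - i))"
    by (rule fps_mult_assoc_lemma)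
  also have "\<dots> = fmult a (fmult b c) l"
    unfolding fmult_def n_def atMost_atLeast0
    by (intro sum.cong refl)
       (auto simp: sum_distrib_left mult.assoc add.commute intro!: sum.cong)
  finally show "fmult (fmult a b) c l = fmult a (fmult b c) l" .
qed

lemma FS_induct [consumes 1, case_names zero add]:
  assumes "c \<in> FS"
    and "P (\<lambda>_. 0)"
    and "\<And>x l c. c \<in> FS \<Longrightarrow> c l = 0 \<Longrightarrow> P c \<Longrightarrow> P (\<lambda>m. x * dl l m + c m)"
  shows "P c"
proof -
  have "finite {l. c l \<noteq> 0}" using assms(1) by (simp add: FS_def)
  then show ?thesis
  proof (induction "{l. c l \<noteq> 0}" arbitrary: c rule: finite_induct)
    case empty
    then have "c = (\<lambda>_. 0)" by auto
    then show ?case using assms(2) by simp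
  next
    case (insert l A)
    let ?c = "c(l := 0)"
    have A: "A = {l. ?c l \<noteq> 0}" using insert(2,4) by auto
    have "P ?c" using insert(3) A by blast
    moreover have "?c \<in> FS" using A insert(1) by (simp add: FS_def)
    moreover have "c = (\<lambda>m. c l * dl l m + ?c m)" by (auto simp: dl_def)
    ultimately show ?case using assms(3)[of ?c l "c l"] by (metis fun_upd_same)
  qed
qed

lemma FS_fmult: "a \<in> FS \<Longrightarrow> b \<in> FS \<Longrightarrow> fmult a b \<in> FS"
proof (induction a rule: FS_induct)
  case zero then show ?case by (simp add: fmult_zero_left FS_zero)
next
  case (add x l c)
  have "fmult (dl l) b \<in> FS" using \<open>b \<in> FS\<close>
  proof (induction b rule: FS_induct)
    case zero then show ?case by (simp add: fmult_zero_right FS_zero)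
  next
    case (add y m d)
    then show ?case
      by (simp add: fmult_add_right fmult_smult_right fmult_dl_dl FS_add FS_smult FS_dl)
  qed
  then show ?case using add by (simp add: fmult_add_left fmult_smult_left FS_add FS_smult)
qed

text \<open>The generators of \<open>Rel\<close> carry an arbitrary prefix and suffix, so
  multiplication by a word only lengthens these.\<close>

lemma Rel_fmult_dl_left: "r \<in> Rel \<Longrightarrow> fmult (dl l) r \<in> Rel"
proof (induction rule: Rel.induct)
  case zero then show ?case by (simp add: fmult_zero_right Rel.zero)
next
  case (add r s) then show ?case by (simp add: fmult_add_right Rel.add)
next
  case (smult r x) then show ?case by (simp add: fmult_smult_right Rel.smult)
next
  case (additive xs a b ys)
  show ?case using Rel.additive[of "l @ xs" a b ys]
    by (simp add: fmult_diff_right fmult_dl_dl)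
next
  case (leibniz xs a b ys)
  show ?case using Rel.leibniz[of "l @ xs" a b ys]
    by (simp add: fmult_diff_right fmult_smult_right fmult_dl_dl)
next
  case (alt xs a ys zs)
  show ?case using Rel.alt[of "l @ xs" a ys zs] by (simp add: fmult_dl_dl)
qed

lemma Rel_fmult_dl_right: "r \<in> Rel \<Longrightarrow> fmult r (dl l) \<in> Rel"
proof (induction rule: Rel.induct)
  case zero then show ?case by (simp add: fmult_zero_left Rel.zero)
next
  case (add r s) then show ?case by (simp add: fmult_add_left Rel.add)
next
  case (smult r x) then show ?case by (simp add: fmult_smult_left Rel.smult)
next
  case (additive xs a b ys)
  show ?case using Rel.additive[of "xs" a b "ys @ l"]
    by (simp add: fmult_diff_left fmult_dl_dl)
next
  case (leibniz xs a b ys)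
  show ?case using Rel.leibniz[of "xs" a b "ys @ l"]
    by (simp add: fmult_diff_left fmult_smult_left fmult_dl_dl)
next
  case (alt xs a ys zs)
  show ?case using Rel.alt[of "xs" a ys "zs @ l"] by (simp add: fmult_dl_dl)
qed

lemma Rel_fmult_left: "a \<in> FS \<Longrightarrow> r \<in> Rel \<Longrightarrow> fmult a r \<in> Rel"
  by (induction a rule: FS_induct)
     (simp_all add: fmult_zero_left fmult_add_left fmult_smult_left Rel.zero Rel.add Rel.smult Rel_fmult_dl_left)

lemma Rel_fmult_right: "a \<in> FS \<Longrightarrow> r \<in> Rel \<Longrightarrow> fmult r a \<in> Rel"
  by (induction a rule: FS_induct)
     (simp_all add: fmult_zero_right fmult_add_right fmult_smult_right Rel.zero Rel.add Rel.smult Rel_fmult_dl_right)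

text \<open>\<open>wedgeC\<close> is a union over all pairs of representatives. Since
  \<open>Rel\<close> is an ideal, each pair contributes the same class, and the union is that
  class.\<close>

lemma wedgeC_cls:
  assumes "a \<in> FS" "b \<in> FS"
  shows "wedgeC (cls a) (cls b) = cls (fmult a b)"
proof -
  have eq: "cls (fmult a' b') = cls (fmult a b)" if "a' \<in> cls a" "b' \<in> cls b" for a' b'
  proof -
    have F: "a' \<in> FS" "b' \<in> FS" using that assms mem_clsD by blast+
    have "(\<lambda>m. fmult (\<lambda>m. a' m - a m) b' m + fmult a (\<lambda>m. b' m - b m) m) \<in> Rel"
      by (rule Rel.add[OF Rel_fmult_right[OF F(2) mem_clsD(3)[OF assms(1) that(1)]]
            Rel_fmult_left[OF assms(1) mem_clsD(3)[OF assms(2) that(2)]]])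
    then show ?thesis
      using F assms by (subst cls_eq_iff) (auto simp: FS_fmult fmult_diff_left fmult_diff_right)
  qed
  have "{cls (fmult a' b') |a' b'. a' \<in> cls a \<and> b' \<in> cls b} = {cls (fmult a b)}"
  proof (intro equalityI subsetI)
    fix z assume "z \<in> {cls (fmult a' b') |a' b'. a' \<in> cls a \<and> b' \<in> cls b}"
    then obtain a' b' where "z = cls (fmult a' b')" "a' \<in> cls a" "b' \<in> cls b" by blast
    then show "z \<in> {cls (fmult a b)}" using eq by simp
  next
    fix z assume "z \<in> {cls (fmult a b)}"
    then show "z \<in> {cls (fmult a' b') |a' b'. a' \<in> cls a \<and> b' \<in> cls b}"
      using mem_cls[OF assms(1)] mem_cls[OF assms(2)] unfolding mem_Collect_eq singleton_iff by metis
  qed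
  then show ?thesis by (simp add: wedgeC_def)
qed

text \<open>As a type of their own the classes form a \<open>ring_1\<close>, so that sums, signs and
  products can be rewritten as in any ring; \<open>Rep_ext\<close> carries the results back to
  classes.\<close>

typedef (overloaded) ('a::field) ext = "cls ` (FS :: 'a fsum set)"
  using FS_zero by blast

definition mk :: "'a::field fsum \<Rightarrow> 'a ext" where "mk c = Abs_ext (cls c)"

lemma Rep_mk: "c \<in> FS \<Longrightarrow> Rep_ext (mk c) = cls c"
  unfolding mk_def by (simp add: Abs_ext_inverse)

lemma ext_cases: obtains c where "c \<in> FS" "\<omega> = mk c"
  using Rep_ext[of \<omega>] by (metis Rep_ext_inverse image_iff mk_def)

lemma mk_eq_iff: "c \<in> FS \<Longrightarrow> c' \<in> FS \<Longrightarrow> mk c = mk c' \<longleftrightarrow> (\<lambda>m. c m - c' m) \<in> Rel"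
  by (simp add: cls_eq_iff[symmetric] Rep_mk[symmetric] Rep_ext_inject)

instantiation ext :: (field) ring_1
begin

definition "0 = mk (\<lambda>_. 0)"
definition "1 = mk (dl [])"
definition "a + b = Abs_ext (addC (Rep_ext a) (Rep_ext b))"
definition "- a = Abs_ext (negC (Rep_ext a))"
definition "a - b = a + - (b::'a ext)"
definition "a * b = Abs_ext (wedgeC (Rep_ext a) (Rep_ext b))"

lemma mk_add: "c \<in> FS \<Longrightarrow> c' \<in> FS \<Longrightarrow> mk c + mk c' = mk (\<lambda>m. c m + c' m)"
  by (simp add: plus_ext_def Rep_mk addC_cls) (simp add: mk_def)

lemma mk_uminus: "c \<in> FS \<Longrightarrow> - mk c = mk (\<lambda>m. - c m)"
  by (simp add: uminus_ext_def Rep_mk negC_cls) (simp add: mk_def)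

lemma mk_mult: "c \<in> FS \<Longrightarrow> c' \<in> FS \<Longrightarrow> mk c * mk c' = mk (fmult c c')"
  by (simp add: times_ext_def Rep_mk wedgeC_cls) (simp add: mk_def)

instance
proof
  fix a b c :: "'a ext"
  obtain a' b' c' where F: "a' \<in> FS" "b' \<in> FS" "c' \<in> FS"
    and [simp]: "a = mk a'" "b = mk b'" "c = mk c'" by (metis ext_cases)
  note [simp] = F mk_add mk_uminus mk_mult FS_add FS_neg FS_fmult FS_zero FS_dl
    zero_ext_def one_ext_def minus_ext_def
  show "a * b * c = a * (b * c)" by (simp add: fmult_assoc)
  show "1 * a = a" by (simp add: fmult_one_left)
  show "a * 1 = a" by (simp add: fmult_one_right)
  show "a + b + c = a + (b + c)" by (simp add: add.assoc)
  show "a + b = b + a" by (simp add: add.commute)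
  show "0 + a = a" by simp
  show "- a + a = 0" by simp
  show "a - b = a + - b" by simp
  show "(a + b) * c = a * c + b * c" by (simp add: fmult_add_left)
  show "a * (b + c) = a * b + a * c" by (simp add: fmult_add_right)
  \<comment> \<open>No generator of \<open>Rel\<close> involves the empty word. Its coefficient is
    therefore an invariant of the class, and it separates \<open>0\<close> from
    \<open>1\<close>.\<close>
  have nilR: "r [] = 0" if "r \<in> Rel" for r :: "'a fsum"
    using that by (induction rule: Rel.induct) (auto simp: dl_def)
  show "(0::'a ext) \<noteq> 1"
    using nilR[of "\<lambda>m. 0 - dl [] m"] unfolding zero_ext_def one_ext_def
    by (subst mk_eq_iff) (auto simp: dl_def FS_zero FS_dl[unfolded dl_def])
qed

end

section \<open>Scalars, differentials and words of differentials\<close>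

definition sc :: "'a::field \<Rightarrow> 'a ext" where "sc x = mk (\<lambda>m. x * dl [] m)"
definition D :: "'a::field \<Rightarrow> 'a ext" where "D a = mk (dl [a])"
definition W :: "'a::field list \<Rightarrow> 'a ext" where "W l = prod_list (map D l)"

lemma W_Nil [simp]: "W [] = 1" and W_Cons [simp]: "W (a # l) = D a * W l"
  and W_append: "W (l @ m) = W l * W m"
  by (simp_all add: W_def)

lemma mk_dl: "mk (dl l) = W l"
proof (induction l)
  case Nil then show ?case by (simp add: one_ext_def)
next
  case (Cons a l)
  then show ?case using mk_mult[OF FS_dl FS_dl, of "[a]" l] by (simp add: D_def fmult_dl_dl)
qed

lemma mk_smult: "c \<in> FS \<Longrightarrow> mk (\<lambda>m. x * c m) = sc x * mk c"
  unfolding sc_def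
  by (subst mk_mult) (auto intro: FS_smult FS_dl simp: fmult_smult_left fmult_one_left)

lemma mk_smult_right: "c \<in> FS \<Longrightarrow> mk (\<lambda>m. x * c m) = mk c * sc x"
  unfolding sc_def
  by (subst mk_mult) (auto intro: FS_smult FS_dl simp: fmult_smult_right fmult_one_right)

lemma sc_commute: "\<omega> * sc x = sc x * \<omega>"
  by (metis ext_cases mk_smult mk_smult_right)

lemma sc_left_commute: "\<eta> * (sc x * \<omega>) = sc x * (\<eta> * \<omega>)"
  by (metis mult.assoc sc_commute)

text \<open>Rewriting form of the two preceding rules: the guard stops the simplifier from
  exchanging two scalars forever.\<close>

lemma sc_pull:
  fixes \<eta> :: "'a::field ext"
  shows "NO_MATCH (sc y) \<eta> \<Longrightarrow> \<eta> * (sc x * \<omega>) = sc x * (\<eta> * \<omega>)"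
    and "NO_MATCH (sc y) \<eta> \<Longrightarrow> \<eta> * sc x = sc x * \<eta>"
  by (rule sc_left_commute, rule sc_commute)

lemma sc_add: "sc (x + y) = sc x + sc y"
  unfolding sc_def by (subst mk_add) (auto intro: FS_smult FS_dl simp: algebra_simps)

lemma sc_mult: "sc (x * y) = sc x * sc y"
  using mk_smult[OF FS_smult[OF FS_dl], of x y "[]"] by (simp add: sc_def mult.assoc)

lemma sc_0 [simp]: "sc 0 = 0"
  by (simp add: sc_def zero_ext_def)

lemma sc_1 [simp]: "sc 1 = 1"
  by (simp add: sc_def one_ext_def)

lemma sc_minus: "sc (- x) = - sc x"
  using sc_add[of x "-x"] by (simp add: eq_neg_iff_add_eq_0 add.commute)

lemma sc_diff: "sc (x - y) = sc x - sc y"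
  using sc_add[of x "-y"] by (simp add: sc_minus)

lemma sc_sum: "sc (sum f A) = (\<Sum>i\<in>A. sc (f i))"
  by (induction A rule: infinite_finite_induct) (simp_all add: sc_add)

lemma sc_minus_one_power: "sc ((-1) ^ n) = (-1) ^ n"
  by (induction n) (simp_all add: sc_mult sc_minus)

lemma sc_cancel:
  assumes "x \<noteq> 0" shows "sc x * \<omega> = 0 \<longleftrightarrow> \<omega> = 0"
proof
  assume "sc x * \<omega> = 0"
  then have "sc (inverse x * x) * \<omega> = 0" unfolding sc_mult by (simp add: mult.assoc)
  then show "\<omega> = 0" using assms by simp
qed simp

lemma sc_eq_0_iff [simp]: "sc x = 0 \<longleftrightarrow> x = 0"
  using sc_cancel[of x 1] by auto

lemma mk_Rel: "r \<in> Rel \<Longrightarrow> mk r = 0"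
  unfolding zero_ext_def using mk_eq_iff[OF Rel_subset_FS FS_zero] by force

lemma mk_diff: "c \<in> FS \<Longrightarrow> c' \<in> FS \<Longrightarrow> mk (\<lambda>m. c m - c' m) = mk c - mk c'"
  using mk_add[OF _ FS_neg, of c c'] by (simp add: mk_uminus[symmetric])

lemma D_add: "D (a + b) = D a + D b"
  using mk_Rel[OF Rel.additive[of "[]" a b "[]"]]
  by (simp add: mk_diff FS_diff FS_dl mk_dl diff_diff_eq del: diff_diff_add) (simp add: algebra_simps)

lemma D_mult: "D (a * b) = sc a * D b + sc b * D a"
  using mk_Rel[OF Rel.leibniz[of "[]" a b "[]"]]
  by (simp add: mk_diff FS_diff FS_dl FS_smult mk_dl mk_smult diff_diff_eq del: diff_diff_add) (simp add: algebra_simps)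

lemma ext_induct [case_names zero add]:
  assumes "P 0" "\<And>x l \<omega>. P \<omega> \<Longrightarrow> P (sc x * W l + \<omega>)"
  shows "P \<omega>"
proof -
  obtain c where c: "c \<in> FS" "\<omega> = mk c" by (rule ext_cases)
  from c(1) have "P (mk c)"
  proof (induction c rule: FS_induct)
    case zero then show ?case using assms(1) by (simp add: zero_ext_def)
  next
    case (add x l c)
    then show ?case using assms(2)[of "mk c" x l]
      by (simp add: mk_add[symmetric] FS_smult FS_dl mk_smult mk_dl)
  qed
  then show ?thesis using c by simp
qed

lemma D_alt: "D a * X * D a = 0"
proof (induction X rule: ext_induct)
  case zero then show ?case by simp
next
  case (add x l \<omega>)
  have "D a * W l * D a = 0"
    using mk_Rel[OF Rel.alt[of "[]" a l "[]"]] by (simp add: mk_dl W_append mult.assoc)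
  then have "sc x * (D a * W l * D a) = 0" by simp
  then show ?case using add by (simp add: distrib_left distrib_right mult.assoc sc_pull)
qed

lemma D_sq [simp]: "D a * D a = 0"
  using D_alt[of a 1] by simp

lemma D_anti: "D a * D b = - (D b * D a)"
  using D_sq[of "a + b"] unfolding D_add
  by (simp add: distrib_left distrib_right eq_neg_iff_add_eq_0 add.commute)

lemma neg_one_commute: "(-1) ^ n * (\<omega>::'a::ring_1) = \<omega> * (-1) ^ n"
  by (induction n) auto

lemma neg_one_pull: "\<omega> * ((-1) ^ n * \<eta>) = (-1) ^ n * (\<omega> * (\<eta>::'a::ring_1))"
  using neg_one_commute[of n \<omega>] by (simp add: mult.assoc[symmetric])

lemma W_D: "W l * D a = (-1) ^ length l * (D a * W l)"
proof (induction l)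
  case (Cons b l)
  have "W (b # l) * D a = D b * ((-1) ^ length l * (D a * W l))"
    using Cons by (simp add: mult.assoc)
  also have "\<dots> = (-1) ^ length l * (D b * D a * W l)"
    by (simp add: neg_one_pull mult.assoc)
  finally show ?case by (simp add: D_anti[of b a] mult.assoc)
qed simp

lemma W_W: "W l * W m = (-1) ^ (length l * length m) * (W m * W l)"
proof (induction m)
  case (Cons a m)
  have "W l * W (a # m) = (W l * D a) * W m" by (simp add: mult.assoc)
  also have "\<dots> = (-1) ^ length l * (D a * (W l * W m))" by (simp add: W_D mult.assoc)
  also have "\<dots> = (-1) ^ length l * (D a * ((-1) ^ (length l * length m) * (W m * W l)))"
    by (simp only: Cons)
  also have "D a * ((-1) ^ (length l * length m) * (W m * W l))
      = (-1) ^ (length l * length m) * (D a * W m * W l)"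
    by (simp add: neg_one_pull mult.assoc)
  finally show ?case by (simp add: power_add mult.assoc)
qed simp

text \<open>Words commute up to sign, so \<open>W m\<close> can be moved past \<open>W l\<close> to
  meet \<open>X\<close>.\<close>

lemma W_skip: "W m * X = 0 \<Longrightarrow> W m * (W l * X) = 0"
  by (simp add: mult.assoc[symmetric] W_W[of m l]) (simp add: mult.assoc)

lemma D_0 [simp]: "D 0 = 0"
  using D_add[of 0 0] by simp

lemma D_1 [simp]: "D 1 = 0"
  using D_mult[of 1 1] by simp

lemma D_minus: "D (- a) = - D a"
  using D_add[of a "-a"] by (simp add: eq_neg_iff_add_eq_0 add.commute)

lemma D_of_nat [simp]: "D (of_nat n) = 0"
  by (induction n) (simp_all add: D_add)

lemma D_power: "D (a ^ n) = sc (of_nat n * a ^ (n - 1)) * D a"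
proof (induction n)
  case (Suc n)
  have "D (a ^ Suc n) = sc (a * (of_nat n * a ^ (n - 1)) + a ^ n) * D a"
    by (simp add: D_mult Suc sc_add sc_mult algebra_simps)
  also have "a * (of_nat n * a ^ (n - 1)) + a ^ n = of_nat (Suc n) * a ^ n"
    by (cases n) (simp_all add: algebra_simps)
  finally show ?case by simp
qed simp

lemma D_sum: "D (sum f A) = (\<Sum>i\<in>A. D (f i))"
  by (induction A rule: infinite_finite_induct) (simp_all add: D_add)

lemma D_inverse: "a \<noteq> 0 \<Longrightarrow> D (inverse a) = - (sc (inverse a ^ 2) * D a)"
proof -
  assume a: "a \<noteq> 0"
  have "0 = sc (inverse a) * (sc a * D (inverse a) + sc (inverse a) * D a)"
    using D_mult[of a "inverse a"] a by simp
  also have "\<dots> = sc (inverse a * a) * D (inverse a) + sc (inverse a ^ 2) * D a"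
    by (simp add: distrib_left sc_mult power2_eq_square mult.assoc)
  finally show ?thesis using a by (simp add: eq_neg_iff_add_eq_0)
qed

text \<open>Maps out of the exterior algebra arise from evaluations of formal sums that are additive in the
  coefficient and vanish on the relations.\<close>

definition ev :: "('a::field \<Rightarrow> 'a list \<Rightarrow> 'b::ab_group_add) \<Rightarrow> 'a fsum \<Rightarrow> 'b" where
  "ev \<phi> c = (\<Sum>l | c l \<noteq> 0. \<phi> (c l) l)"

definition lift :: "('a::field \<Rightarrow> 'a list \<Rightarrow> 'b::ab_group_add) \<Rightarrow> 'a ext \<Rightarrow> 'b" where
  "lift \<phi> \<omega> = ev \<phi> (SOME c. c \<in> FS \<and> \<omega> = mk c)"

definition additive1 :: "('a::field \<Rightarrow> 'a list \<Rightarrow> 'b::ab_group_add) \<Rightarrow> bool" where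
  "additive1 \<phi> \<longleftrightarrow> (\<forall>x y l. \<phi> (x + y) l = \<phi> x l + \<phi> y l)"

lemma additive1_0: "additive1 \<phi> \<Longrightarrow> \<phi> 0 l = 0"
  unfolding additive1_def by (metis add_cancel_right_right add_0)

lemma ev_superset:
  assumes "additive1 \<phi>" "finite A" "{l. c l \<noteq> 0} \<subseteq> A"
  shows "ev \<phi> c = (\<Sum>l\<in>A. \<phi> (c l) l)"
  unfolding ev_def using assms additive1_0[OF assms(1)]
  by (intro sum.mono_neutral_left) auto

lemma ev_add:
  assumes "additive1 \<phi>" "c \<in> FS" "c' \<in> FS"
  shows "ev \<phi> (\<lambda>m. c m + c' m) = ev \<phi> c + ev \<phi> c'"
proof -
  let ?A = "{l. c l \<noteq> 0} \<union> {l. c' l \<noteq> 0}"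
  have f: "finite ?A" using assms by (simp add: FS_def)
  show ?thesis
    by (subst (1 2 3) ev_superset[OF assms(1) f])
       (use assms(1) in \<open>auto simp: additive1_def sum.distrib\<close>)
qed

lemma ev_zero [simp]: "ev \<phi> (\<lambda>_. 0) = 0" by (simp add: ev_def)

lemma ev_diff:
  assumes "additive1 \<phi>" "c \<in> FS" "c' \<in> FS"
  shows "ev \<phi> (\<lambda>m. c m - c' m) = ev \<phi> c - ev \<phi> c'"
  using ev_add[OF assms(1) FS_diff[OF assms(2,3)] assms(3)] by simp

lemma ev_dl: "additive1 \<phi> \<Longrightarrow> ev \<phi> (\<lambda>m. x * dl l m) = \<phi> x l"
  by (subst ev_superset[of _ "{l}"]) (auto simp: dl_def)

lemma ev_dl1: "additive1 \<phi> \<Longrightarrow> ev \<phi> (dl l) = \<phi> 1 l"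
  using ev_dl[of \<phi> 1 l] by simp

lemma lift_mk:
  assumes "additive1 \<phi>" "\<And>r. r \<in> Rel \<Longrightarrow> ev \<phi> r = 0" "c \<in> FS"
  shows "lift \<phi> (mk c) = ev \<phi> c"
proof -
  define c' where "c' = (SOME c'. c' \<in> FS \<and> mk c = mk c')"
  have c': "c' \<in> FS \<and> mk c = mk c'" unfolding c'_def by (rule someI[of _ c]) (use assms in auto)
  then have "(\<lambda>m. c' m - c m) \<in> Rel" using assms(3) mk_eq_iff[of c' c] by simp
  from assms(2)[OF this] have "ev \<phi> c' - ev \<phi> c = 0"
    using c' assms(3) by (simp add: ev_diff[OF assms(1)])
  then show ?thesis by (simp add: lift_def c'_def)
qed

lemma lift_add:
  assumes "additive1 \<phi>" "\<And>r. r \<in> Rel \<Longrightarrow> ev \<phi> r = 0"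
  shows "lift \<phi> (\<omega> + \<eta>) = lift \<phi> \<omega> + lift \<phi> \<eta>"
proof -
  obtain c c' where "c \<in> FS" "c' \<in> FS" "\<omega> = mk c" "\<eta> = mk c'" by (metis ext_cases)
  then show ?thesis using assms by (simp add: mk_add lift_mk ev_add FS_add)
qed

lemma lift_word:
  assumes "additive1 \<phi>" "\<And>r. r \<in> Rel \<Longrightarrow> ev \<phi> r = 0"
  shows "lift \<phi> (sc x * W l) = \<phi> x l"
proof -
  have "sc x * W l = mk (\<lambda>m. x * dl l m)" by (simp add: mk_smult FS_dl mk_dl)
  then show ?thesis using assms by (simp add: lift_mk ev_dl FS_smult FS_dl)
qed

subsection \<open>The exterior derivative\<close>

text \<open>\<open>Rel\<close> is closed under multiplication by scalars but \<open>d\<close> is not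
  linear. The extra term \<open>D x * mk r\<close> vanishes for \<open>r\<close> in
  \<open>Rel\<close>, which is what \<open>ev_d_Rel\<close> needs.\<close>

lemma ev_d_smult:
  assumes "r \<in> FS"
  shows "ev (\<lambda>x l. D x * W l) (\<lambda>m. x * r m)
    = D x * mk r + sc x * ev (\<lambda>x l. D x * W l) r"
proof -
  have ad: "additive1 (\<lambda>x l. D (x::'a) * W l)" by (simp add: additive1_def D_add distrib_right)
  from assms show ?thesis
  proof (induction r rule: FS_induct)
    case zero then show ?case by (simp add: zero_ext_def[symmetric])
  next
    case (add y l c)
    have "ev (\<lambda>x l. D x * W l) (\<lambda>m. (x * y) * dl l m + x * c m)
       = D (x * y) * W l + (D x * mk c + sc x * ev (\<lambda>x l. D x * W l) c)"
      using add by (subst ev_add[OF ad]) (auto intro: FS_smult FS_dl simp: ev_dl[OF ad])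
    moreover have "mk (\<lambda>m. y * dl l m + c m) = sc y * W l + mk c"
      using add by (simp add: mk_add[symmetric] FS_smult FS_dl mk_smult mk_dl)
    moreover have "ev (\<lambda>x l. D x * W l) (\<lambda>m. y * dl l m + c m)
        = D y * W l + ev (\<lambda>x l. D x * W l) c"
      using add by (subst ev_add[OF ad]) (auto intro: FS_smult FS_dl simp: ev_dl[OF ad])
    ultimately show ?case
      by (simp add: distrib_left distrib_right mult.assoc D_mult sc_pull)
  qed
qed

lemma ev_d_Rel: "r \<in> Rel \<Longrightarrow> ev (\<lambda>x l. D x * W l) r = 0"
proof (induction rule: Rel.induct)
  have ad: "additive1 (\<lambda>x l. D (x::'a) * W l)" by (simp add: additive1_def D_add distrib_right)
  note [simp] = ev_add[OF ad] ev_diff[OF ad] ev_dl1[OF ad] ev_dl[OF ad] FS_diff FS_add FS_smult FS_dl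
  { case zero then show ?case by simp
  next
    case (add r s) then show ?case by (simp add: Rel_subset_FS)
  next
    case (smult r x) then show ?case by (simp add: ev_d_smult Rel_subset_FS mk_Rel)
  next
    case (additive xs a b ys)
    show ?case by simp
  next
    case (leibniz xs a b ys)
    \<comment> \<open>Of a Leibniz relation there remain \<open>D a * W xs * D b * W ys\<close> and
      \<open>D b * W xs * D a * W ys\<close> with the same sign; brought to a common form they
      cancel by anticommutation.\<close>
    have "D a * (W xs * (D b * W ys)) = (-1) ^ length xs * (D a * D b) * (W xs * W ys)"
      by (simp add: mult.assoc[symmetric], simp add: W_D mult.assoc neg_one_pull)
    moreover have "D b * (W xs * (D a * W ys)) = (-1) ^ length xs * (D b * D a) * (W xs * W ys)"
      by (simp add: mult.assoc[symmetric], simp add: W_D mult.assoc neg_one_pull)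
    ultimately show ?case by (simp add: W_append mult.assoc D_anti[of a b])
  next
    case (alt xs a ys zs)
    then show ?case by simp
  }
qed

definition d :: "'a::field ext \<Rightarrow> 'a ext" where "d = lift (\<lambda>x l. D x * W l)"

lemma additive1_d: "additive1 (\<lambda>x l. D x * W l)"
  by (simp add: additive1_def D_add distrib_right)

lemma d_add: "d (\<omega> + \<eta>) = d \<omega> + d \<eta>"
  unfolding d_def using lift_add[OF additive1_d ev_d_Rel] .

lemma d_word: "d (sc x * W l) = D x * W l"
  unfolding d_def using lift_word[OF additive1_d ev_d_Rel] .

lemma d_0 [simp]: "d 0 = 0"
  using d_add[of 0 0] by simp

lemma d_minus: "d (- \<omega>) = - d \<omega>"
  using d_add[of \<omega> "-\<omega>"] by (simp add: eq_neg_iff_add_eq_0 add.commute)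

lemma d_sum: "d (sum f A) = (\<Sum>i\<in>A. d (f i))"
  by (induction A rule: infinite_finite_induct) (simp_all add: d_add)

lemma d_sc: "d (sc x) = D x" using d_word[of x "[]"] by simp

lemma d_D [simp]: "d (D a) = 0" using d_word[of 1 "[a]"] by simp

lemma d_d: "d (d \<omega>) = 0"
proof (induction \<omega> rule: ext_induct)
  case (add x l \<omega>)
  then show ?case using d_word[of 1 "x # l"] by (simp add: d_add d_word)
qed simp

lemma d_smult: "d (sc x * \<omega>) = D x * \<omega> + sc x * d \<omega>"
proof (induction \<omega> rule: ext_induct)
  case (add y l \<omega>)
  have "d (sc x * (sc y * W l)) = D (x * y) * W l"
    using d_word[of "x * y" l] by (simp add: sc_mult mult.assoc)
  then show ?case using add
    by (simp add: distrib_left d_add d_word D_mult distrib_right mult.assoc sc_pull add_ac)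
qed simp

text \<open>Only closed right factors are needed, so no sign has to be attached to \<open>\<omega>\<close>.\<close>
lemma d_mult_closed:
  assumes "d \<eta> = 0"
  shows "d (\<omega> * \<eta>) = d \<omega> * \<eta>"
proof -
  have W: "d (W l * \<eta>) = 0" for l
  proof (induction l)
    case (Cons a l)
    have "d (D a * (W l * \<eta>)) = 0"
    proof -
      have "d (D a * \<omega>) = - (D a * d \<omega>)" for \<omega>
      proof (induction \<omega> rule: ext_induct)
        case (add x l \<omega>)
        have "d (D a * (sc x * W l)) = D x * (D a * W l)"
          using d_word[of x "a # l"] by (simp add: sc_pull)
        then show ?case using add
          by (simp add: distrib_left d_add d_word mult.assoc[symmetric] D_anti[of x a])
      qed simp
      then show ?thesis using Cons by simp
    qed
    then show ?case by (simp add: mult.assoc)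
  qed (use assms in simp)
  show ?thesis
  proof (induction \<omega> rule: ext_induct)
    case (add x l \<omega>)
    have "d (sc x * (W l * \<eta>)) = D x * W l * \<eta>" by (simp add: d_smult W mult.assoc)
    then show ?case using add by (simp add: distrib_right d_add d_word mult.assoc)
  qed simp
qed

subsection \<open>Contraction with a derivation\<close>

definition derivation :: "('a::field \<Rightarrow> 'a) \<Rightarrow> bool" where
  "derivation \<theta> \<longleftrightarrow> (\<forall>x y. \<theta> (x + y) = \<theta> x + \<theta> y \<and> \<theta> (x * y) = x * \<theta> y + y * \<theta> x)"

text \<open>The interior product on words: the antiderivation that sends \<open>D a\<close> to
  \<open>\<theta> a\<close>.\<close>

fun iot :: "('a::field \<Rightarrow> 'a) \<Rightarrow> 'a list \<Rightarrow> 'a ext" where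
  "iot \<theta> [] = 0"
| "iot \<theta> (a # l) = sc (\<theta> a) * W l - D a * iot \<theta> l"

lemma iot_append: "iot \<theta> (l @ m) = iot \<theta> l * W m + (-1) ^ length l * W l * iot \<theta> m"
proof (induction l)
  case (Cons a l)
  have "D a * ((-1) ^ length l * W l * iot \<theta> m) = (-1) ^ length l * D a * W l * iot \<theta> m"
    by (simp add: neg_one_pull mult.assoc)
  then show ?case using Cons by (simp add: W_append algebra_simps)
qed simp

lemma ev_iot_Rel:
  assumes "derivation \<theta>"
  shows "r \<in> Rel \<Longrightarrow> ev (\<lambda>x l. sc x * iot \<theta> l) r = 0"
proof (induction rule: Rel.induct)
  have ad: "additive1 (\<lambda>x l. sc (x::'a) * iot \<theta> l)" by (simp add: additive1_def sc_add distrib_right)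
  note [simp] = ev_add[OF ad] ev_diff[OF ad] ev_dl1[OF ad] ev_dl[OF ad] FS_diff FS_add FS_smult FS_dl
  { case zero then show ?case by simp
  next
    case (add r s) then show ?case by (simp add: Rel_subset_FS)
  next
    case (smult r x)
    have "ev (\<lambda>x l. sc x * iot \<theta> l) (\<lambda>m. x * c m) = sc x * ev (\<lambda>x l. sc x * iot \<theta> l) c"
      if "c \<in> FS" for c
      using that
    proof (induction c rule: FS_induct)
      case (add y l c)
      have "ev (\<lambda>x l. sc x * iot \<theta> l) (\<lambda>m. (x * y) * dl l m + x * c m)
        = sc (x * y) * iot \<theta> l + sc x * ev (\<lambda>x l. sc x * iot \<theta> l) c"
        using add by (subst ev_add[OF ad]) (auto intro: FS_smult FS_dl)
      then show ?case using add by (simp add: algebra_simps sc_mult)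
    qed simp
    then show ?case using smult by (simp add: Rel_subset_FS)
  next
    case (additive xs a b ys)
    have "\<theta> (a + b) = \<theta> a + \<theta> b" using assms by (simp add: derivation_def)
    then show ?case
      by simp (simp add: iot_append W_append D_add sc_add algebra_simps)
  next
    case (leibniz xs a b ys)
    have "\<theta> (a * b) = a * \<theta> b + b * \<theta> a" using assms by (simp add: derivation_def)
    then show ?case
      by simp (simp add: iot_append W_append D_mult sc_add sc_mult algebra_simps sc_pull)
  next
    case (alt xs a ys zs)
    \<comment> \<open>Only the segment between the two copies of \<open>a\<close> matters. Its word
      is zero and its contraction is a difference of two equal terms; \<open>iot_append\<close>
      extends this to the whole word.\<close>
    have "iot \<theta> ([a] @ ys @ [a]) = sc (\<theta> a) * W ys * D a
       - D a * (iot \<theta> ys * D a + (-1) ^ length ys * W ys * sc (\<theta> a))"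
      by (simp add: iot_append W_append mult.assoc)
    also have "\<dots> = sc (\<theta> a) * ((-1) ^ length ys * (D a * W ys))
       - D a * ((-1) ^ length ys * W ys * sc (\<theta> a))"
      by (simp add: distrib_left mult.assoc[symmetric] D_alt) (simp add: mult.assoc W_D)
    also have "D a * ((-1) ^ length ys * W ys * sc (\<theta> a)) = sc (\<theta> a) * ((-1) ^ length ys * (D a * W ys))"
      by (simp add: mult.assoc sc_pull, simp only: neg_one_pull)
    finally have 1: "iot \<theta> ([a] @ ys @ [a]) = 0" by simp
    have 2: "W ([a] @ ys @ [a]) = 0" by (simp add: W_append D_alt mult.assoc[symmetric])
    have "iot \<theta> (xs @ ([a] @ ys @ [a]) @ zs) = 0"
      unfolding iot_append[of _ xs] iot_append[of _ "[a] @ ys @ [a]"] W_append[of "[a] @ ys @ [a]"] 1 2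
      by simp
    then show ?case by simp
  }
qed

definition contr :: "('a::field \<Rightarrow> 'a) \<Rightarrow> 'a ext \<Rightarrow> 'a ext" where
  "contr \<theta> = lift (\<lambda>x l. sc x * iot \<theta> l)"

lemma contr_word: "derivation \<theta> \<Longrightarrow> contr \<theta> (W l) = iot \<theta> l"
  using lift_word[OF _ ev_iot_Rel, of \<theta> 1 l] by (simp add: contr_def additive1_def sc_add distrib_right)

lemma contr_0: "derivation \<theta> \<Longrightarrow> contr \<theta> 0 = 0"
  using lift_word[OF _ ev_iot_Rel, of \<theta> 0 "[]"] by (simp add: contr_def additive1_def sc_add distrib_right)

lemma iot_kernel: "(\<And>a. a \<in> set l \<Longrightarrow> \<theta> a = 0) \<Longrightarrow> iot \<theta> l = 0"
  by (induction l) auto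

text \<open>Contraction with a derivation that kills \<open>l\<close> but not \<open>b\<close>
  strips off the last factor and leaves a nonzero multiple of \<open>W l\<close>.\<close>

lemma W_snoc_neq_0:
  assumes "derivation \<theta>" "\<And>a. a \<in> set l \<Longrightarrow> \<theta> a = 0" "\<theta> b \<noteq> 0" "W l \<noteq> 0"
  shows "W (l @ [b]) \<noteq> 0"
proof
  assume "W (l @ [b]) = 0"
  then have "iot \<theta> (l @ [b]) = 0" using contr_word[of \<theta> "l @ [b]"] contr_0 assms(1) by metis
  then have "(-1) ^ length l * W l * sc (\<theta> b) = 0"
    using iot_kernel[of l \<theta>] assms(2) by (simp add: iot_append)
  then have "(-1) ^ length l * W l = 0"
    using sc_cancel[OF assms(3)] by (simp add: sc_commute)
  then show False using assms(4) by (metis minus_one_power_iff mult_1 mult_minus_left neg_equal_0_iff_equal)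
qed

subsection \<open>Subfields containing the \<open>p\<close>-th powers\<close>

lemma subfieldD:
  assumes "subfield L"
  shows "0 \<in> L" "1 \<in> L" "x \<in> L \<Longrightarrow> y \<in> L \<Longrightarrow> x + y \<in> L" "x \<in> L \<Longrightarrow> y \<in> L \<Longrightarrow> x * y \<in> L"
    "x \<in> L \<Longrightarrow> - x \<in> L" "x \<in> L \<Longrightarrow> inverse x \<in> L"
  using assms by (auto simp: subfield_def)

lemma subfield_diff: "subfield L \<Longrightarrow> x \<in> L \<Longrightarrow> y \<in> L \<Longrightarrow> x - y \<in> L"
  using subfieldD(3,5) by (metis diff_conv_add_uminus)

lemma subfield_divide: "subfield L \<Longrightarrow> x \<in> L \<Longrightarrow> y \<in> L \<Longrightarrow> x / y \<in> L"
  using subfieldD(4,6) by (metis divide_inverse)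

lemma subfield_power: "subfield L \<Longrightarrow> x \<in> L \<Longrightarrow> x ^ n \<in> L"
  by (induction n) (auto simp: subfieldD)

lemma subfield_sum: "subfield L \<Longrightarrow> (\<And>i. i \<in> A \<Longrightarrow> f i \<in> L) \<Longrightarrow> sum f A \<in> L"
  by (induction A rule: infinite_finite_induct) (auto simp: subfieldD)

lemma subfield_of_nat: "subfield L \<Longrightarrow> of_nat n \<in> L"
  by (induction n) (auto simp: subfieldD)

lemma subfield_Fpadj: "subfield (Fpadj p C)"
  unfolding subfield_def Fpadj_def by (auto simp: subfieldD)

lemma Fpow_subset_Fpadj: "Fpow p \<subseteq> Fpadj p C" and subset_Fpadj: "C \<subseteq> Fpadj p C"
  unfolding Fpadj_def by auto

lemma Fpadj_least: "subfield L \<Longrightarrow> Fpow p \<subseteq> L \<Longrightarrow> C \<subseteq> L \<Longrightarrow> Fpadj p C \<subseteq> L"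
  unfolding Fpadj_def by auto

lemma Fpadj_subset: "C \<subseteq> Fpadj p C' \<Longrightarrow> Fpadj p C \<subseteq> Fpadj p C'"
  by (intro Fpadj_least subfield_Fpadj Fpow_subset_Fpadj)

lemma Fpadj_mono: "C \<subseteq> C' \<Longrightarrow> Fpadj p C \<subseteq> Fpadj p C'"
  using Fpadj_subset subset_Fpadj by blast

lemma Fpow_power [simp]: "x ^ p \<in> Fpow p" by (auto simp: Fpow_def)

lemma Fpadj_power [simp]: "x ^ p \<in> Fpadj p C" using Fpow_power Fpow_subset_Fpadj by blast

lemma derivation_simps:
  assumes "derivation \<theta>"
  shows "\<theta> (x + y) = \<theta> x + \<theta> y" "\<theta> (x * y) = x * \<theta> y + y * \<theta> x"
    "\<theta> 0 = 0" "\<theta> 1 = 0" "\<theta> (- x) = - \<theta> x" "\<theta> (x - y) = \<theta> x - \<theta> y"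
    "\<theta> (sum f A) = (\<Sum>i\<in>A. \<theta> (f i))" "\<theta> (of_nat n) = 0"
    "\<theta> (x ^ n) = of_nat n * x ^ (n - 1) * \<theta> x"
proof -
  have a: "\<theta> (x + y) = \<theta> x + \<theta> y" and m: "\<theta> (x * y) = x * \<theta> y + y * \<theta> x" for x y
    using assms by (auto simp: derivation_def)
  show "\<theta> (x + y) = \<theta> x + \<theta> y" "\<theta> (x * y) = x * \<theta> y + y * \<theta> x" by fact+
  show 0: "\<theta> 0 = 0" using a[of 0 0] by (metis add_0 add_cancel_right_right)
  show 1: "\<theta> 1 = 0" using m[of 1 1] by (metis mult_1 add_cancel_right_right)
  show n: "\<theta> (- x) = - \<theta> x" for x using a[of x "-x"] 0 by (simp add: eq_neg_iff_add_eq_0 add.commute)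
  show "\<theta> (x - y) = \<theta> x - \<theta> y" using a[of x "-y"] n by simp
  show "\<theta> (sum f A) = (\<Sum>i\<in>A. \<theta> (f i))"
    by (induction A rule: infinite_finite_induct) (simp_all add: 0 a)
  show "\<theta> (of_nat n) = 0" by (induction n) (simp_all add: 0 1 a)
  show "\<theta> (x ^ n) = of_nat n * x ^ (n - 1) * \<theta> x"
  proof (induction n)
    case (Suc n) then show ?case by (cases n) (simp_all add: m algebra_simps)
  qed (simp add: 1)
qed

text \<open>Stated for commutative rings because it is applied to polynomials over the field as well
  as to the field itself.\<close>

lemma frobenius_add:
  fixes x y :: "'b::comm_ring_1"
  assumes "prime p" "of_nat p = (0::'b)"
  shows "(x + y) ^ p = x ^ p + y ^ p"
proof -
  have "CHAR('b) dvd p" using assms(2) by (simp add: of_nat_eq_0_iff_char_dvd)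
  moreover have "CHAR('b) \<noteq> 1" by simp
  ultimately have "CHAR('b) = p" using assms(1) by (auto simp: prime_nat_iff)
  then show ?thesis using assms(1) by (intro freshmans_dream) auto
qed

locale char_p =
  fixes p :: nat and ty :: "'a::field itself"
  assumes prime_p: "prime p" and char_p: "of_nat p = (0::'a)"
begin

lemma p_gt_1: "p > 1" using prime_p prime_gt_1_nat by blast

lemma p_pos [simp]: "p > 0" using p_gt_1 by simp

lemma p_neq_0 [simp]: "p \<noteq> 0" using p_gt_1 by simp

lemma frob_add: "(x + y) ^ p = x ^ p + (y::'a) ^ p"
  using frobenius_add prime_p char_p by blast

lemma frob_sum: "(sum f A) ^ p = (\<Sum>i\<in>A. (f i::'a) ^ p)"
  by (induction A rule: infinite_finite_induct) (simp_all add: frob_add)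

lemma frob_minus: "(- x) ^ p = - ((x::'a) ^ p)"
  using frob_add[of x "-x"] by (simp add: eq_neg_iff_add_eq_0 add.commute power_0_left)

lemma frob_diff: "(x - y) ^ p = x ^ p - (y::'a) ^ p"
  using frob_add[of x "-y"] by (simp add: frob_minus)

lemma of_nat_neq_0: "0 < i \<Longrightarrow> i < p \<Longrightarrow> of_nat i \<noteq> (0::'a)"
proof
  assume i: "0 < i" "i < p" "of_nat i = (0::'a)"
  have "CHAR('a) dvd p" "CHAR('a) dvd i" using char_p i by (simp_all add: of_nat_eq_0_iff_char_dvd[symmetric])
  moreover have "CHAR('a) \<noteq> 1" by simp
  ultimately have "p dvd i" using prime_p by (auto simp: prime_nat_iff)
  then show False using i by (simp add: nat_dvd_not_less)
qed

lemma of_nat_mod: "of_nat (i mod p) = (of_nat i :: 'a)"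
proof -
  have "(of_nat i :: 'a) = of_nat (p * (i div p) + i mod p)" by simp
  also have "\<dots> = of_nat (i mod p)" by (simp only: of_nat_add of_nat_mult char_p) simp
  finally show ?thesis by simp
qed

lemma of_nat_power_p: "(of_nat i :: 'a) ^ p = of_nat i"
  by (induction i) (use frob_add in \<open>simp_all add: add.commute\<close>)

lemma power_p: "(x::'a) ^ p = x * x ^ (p - 1)"
  using p_pos by (cases p) auto

lemma of_nat_power_p1: "0 < i \<Longrightarrow> i < p \<Longrightarrow> (of_nat i :: 'a) ^ (p - 1) = 1"
  using of_nat_power_p[of i] of_nat_neq_0[of i] by (simp add: power_p)

lemma derivation_pow_p: "derivation \<theta> \<Longrightarrow> \<theta> ((x::'a) ^ p) = 0"
  by (simp add: derivation_simps char_p)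

lemma D_pow_p [simp]: "D ((x::'a) ^ p) = 0"
  by (simp add: D_power char_p)

text \<open>An inverse is \<open>(x\<inverse>)\<^sup>p * x\<^sup>p\<^sup>-\<^sup>1\<close>, so subrings containing the \<open>p\<close>-th powers are fields.\<close>

lemma inverse_eq: "inverse (x::'a) = (inverse x) ^ p * x ^ (p - 1)"
proof (cases "x = 0")
  case False
  have "(inverse x) ^ p * x ^ (p - 1) = inverse x * ((inverse x) ^ (p - 1) * x ^ (p - 1))"
    by (simp add: power_p mult.assoc)
  then show ?thesis using False by (simp add: power_mult_distrib[symmetric])
qed (use p_gt_1 in \<open>simp add: power_0_left\<close>)

lemma subfield_of_subring:
  assumes pow: "Fpow p \<subseteq> (L::'a set)" and add: "\<And>x y. x \<in> L \<Longrightarrow> y \<in> L \<Longrightarrow> x + y \<in> L"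
    and mult: "\<And>x y. x \<in> L \<Longrightarrow> y \<in> L \<Longrightarrow> x * y \<in> L"
  shows "subfield L"
proof -
  have zpow: "z ^ p \<in> L" for z using pow Fpow_power by blast
  have 0: "0 \<in> L" using zpow[of 0] by (simp add: zero_power)
  have 1: "1 \<in> L" using zpow[of 1] by simp
  have m1: "-1 \<in> L" using zpow[of "-1"] by (simp add: frob_minus)
  have neg: "- x \<in> L" if "x \<in> L" for x using mult[OF m1 that] by simp
  have power: "x ^ n \<in> L" if "x \<in> L" for x n using that by (induction n) (auto intro: 1 mult)
  have inv: "inverse x \<in> L" if "x \<in> L" for x
  proof -
    have "(inverse x) ^ p * x ^ (p - 1) \<in> L" by (intro mult zpow power that)
    then show ?thesis by (simp only: inverse_eq[symmetric])
  qed
  show ?thesis unfolding subfield_def by (intro conjI ballI 0 1 add mult neg inv)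
qed

text \<open>Negatives and inverses have no case because \<open>subfield_of_subring\<close> obtains
  them from the \<open>p\<close>-th powers. Identities for derivations and differentials thus reduce
  to generators, as both vanish on \<open>p\<close>-th powers.\<close>

lemma Fpadj_induct [consumes 1, case_names power mem add mult]:
  assumes "x \<in> Fpadj p C" and "\<And>x. P (x ^ p)" "\<And>c. c \<in> C \<Longrightarrow> P c"
    and "\<And>x y. x \<in> Fpadj p C \<Longrightarrow> y \<in> Fpadj p C \<Longrightarrow> P x \<Longrightarrow> P y \<Longrightarrow> P (x + y)"
    and "\<And>x y. x \<in> Fpadj p C \<Longrightarrow> y \<in> Fpadj p C \<Longrightarrow> P x \<Longrightarrow> P y \<Longrightarrow> P (x * y)"
  shows "P (x::'a)"
proof -
  have "Fpadj p C \<subseteq> {x \<in> Fpadj p C. P x}"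
    using assms subset_Fpadj[of C p]
    by (intro Fpadj_least subfield_of_subring) (auto simp: Fpow_def subfieldD[OF subfield_Fpadj])
  then show ?thesis using assms(1) by blast
qed

section \<open>Adjoining one element to a field that contains the \<open>p\<close>-th powers\<close>

definition adj :: "'a set \<Rightarrow> 'a \<Rightarrow> 'a set" where
  "adj E x = {\<Sum>i<p. e i * x ^ i | e. \<forall>i. e i \<in> E}"

context
  fixes E :: "'a set"
  assumes E: "subfield E" and EF: "Fpow p \<subseteq> E"
begin

lemma adj_add: "u \<in> adj E x \<Longrightarrow> v \<in> adj E x \<Longrightarrow> u + v \<in> adj E x"
proof -
  assume "u \<in> adj E x" "v \<in> adj E x"
  then obtain e f where "u = (\<Sum>i<p. e i * x ^ i)" "v = (\<Sum>i<p. f i * x ^ i)"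
    "\<forall>i. e i \<in> E" "\<forall>i. f i \<in> E" unfolding adj_def by auto
  then show ?thesis unfolding adj_def
    by (auto intro!: exI[of _ "\<lambda>i. e i + f i"] simp: algebra_simps sum.distrib subfieldD[OF E])
qed

lemma adj_smult: "c \<in> E \<Longrightarrow> u \<in> adj E x \<Longrightarrow> c * u \<in> adj E x"
proof -
  assume c: "c \<in> E" "u \<in> adj E x"
  then obtain e where "u = (\<Sum>i<p. e i * x ^ i)" "\<forall>i. e i \<in> E" unfolding adj_def by auto
  then show ?thesis unfolding adj_def using c
    by (auto intro!: exI[of _ "\<lambda>i. c * e i"] simp: sum_distrib_left mult.assoc subfieldD[OF E])
qed

text \<open>Splitting \<open>n\<close> into a multiple of \<open>p\<close> and a remainder turns the
  excess into a \<open>p\<close>-th power, which lies in \<open>E\<close>. Degrees below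
  \<open>p\<close> therefore suffice in \<open>adj\<close>.\<close>

lemma adj_power: "x ^ n \<in> adj E x"
proof -
  have "x ^ n = (x ^ (n div p)) ^ p * x ^ (n mod p)"
    by (metis mult.commute mult_div_mod_eq power_add power_mult)
  moreover have "x ^ (n mod p) = (\<Sum>i<p. (if i = n mod p then 1 else 0) * x ^ i)"
    by (simp add: if_distrib[of "\<lambda>z. z * _"] cong: if_cong)
  then have "x ^ (n mod p) \<in> adj E x" unfolding adj_def
    by (auto intro!: exI[of _ "\<lambda>i. if i = n mod p then 1 else 0"] simp: subfieldD[OF E])
  moreover have "(x ^ (n div p)) ^ p \<in> E" using EF Fpow_power by blast
  ultimately show ?thesis using adj_smult by metis
qed

lemma adj_base: "c \<in> E \<Longrightarrow> c \<in> adj E x" and adj_gen: "x \<in> adj E x"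
  using adj_smult[OF _ adj_power[of x 0]] adj_power[of x 1] by auto

lemma adj_sum: "(\<And>i. i \<in> A \<Longrightarrow> f i \<in> adj E x) \<Longrightarrow> sum f A \<in> adj E x"
  by (induction A rule: infinite_finite_induct) (auto intro: adj_add adj_base subfieldD[OF E])

lemma subfield_adj: "subfield (adj E x)"
proof (rule subfield_of_subring)
  show "Fpow p \<subseteq> adj E x" using EF adj_base by blast
  show "u \<in> adj E x \<Longrightarrow> v \<in> adj E x \<Longrightarrow> u + v \<in> adj E x" for u v by (rule adj_add)
  fix u v assume "u \<in> adj E x" "v \<in> adj E x"
  then obtain e f where uv: "u = (\<Sum>i<p. e i * x ^ i)" "v = (\<Sum>i<p. f i * x ^ i)"
    and ef: "\<forall>i. e i \<in> E" "\<forall>i. f i \<in> E" unfolding adj_def by auto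
  have "u * v = (\<Sum>i<p. \<Sum>j<p. (e i * f j) * x ^ (i + j))"
    unfolding uv sum_product by (simp add: power_add algebra_simps)
  then show "u * v \<in> adj E x"
    using ef by (auto intro!: adj_sum adj_smult adj_power subfieldD(4)[OF E])
qed

lemma adj_least: "subfield L \<Longrightarrow> E \<subseteq> L \<Longrightarrow> x \<in> L \<Longrightarrow> adj E x \<subseteq> L"
  unfolding adj_def by (auto intro!: subfield_sum subfieldD(4) subfield_power)

end

lemma Fpadj_insert: "Fpadj p (insert x C) = adj (Fpadj p C) x"
proof
  note F = subfield_Fpadj Fpow_subset_Fpadj
  show "Fpadj p (insert x C) \<subseteq> adj (Fpadj p C) x"
    using adj_base[OF F] adj_gen[OF F] Fpow_subset_Fpadj[of p C] subset_Fpadj[of C p]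
    by (intro Fpadj_least subfield_adj[OF F]) blast+
  show "adj (Fpadj p C) x \<subseteq> Fpadj p (insert x C)"
    using subset_Fpadj[of "insert x C" p] by (intro adj_least F Fpadj_mono) auto
qed

section \<open>Independence of powers, exchange, and extension of derivations\<close>

definition coeffs_in :: "'a set \<Rightarrow> 'a poly \<Rightarrow> bool" where
  "coeffs_in E f \<longleftrightarrow> (\<forall>i. coeff f i \<in> E)"

text \<open>As \<open>h\<close> does not vanish at \<open>x\<close>, each factor
  \<open>X - x\<close> of the power divides the cofactor of \<open>h\<close> and can be
  cancelled.\<close>

lemma dvd_linear_power_degree:
  fixes h :: "'a poly"
  shows "h dvd [:- x, 1:] ^ n \<Longrightarrow> poly h x \<noteq> 0 \<Longrightarrow> degree h = 0"
proof (induction n)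
  case 0 then show ?case using is_unit_iff_degree[of h] by (cases "h = 0") auto
next
  case (Suc n)
  then obtain g where g: "[:- x, 1:] ^ Suc n = h * g" by blast
  have "poly ([:- x, 1:] ^ Suc n) x = 0" by simp
  then have "poly g x = 0" using Suc(3) unfolding g by simp
  then obtain g' where "g = [:- x, 1:] * g'" by (auto simp: poly_eq_0_iff_dvd)
  then have "[:- x, 1:] * [:- x, 1:] ^ n = [:- x, 1:] * (h * g')" using g by (metis power_Suc mult.left_commute)
  then have "[:- x, 1:] ^ n = h * g'" by (metis mult_left_cancel pCons_eq_0_iff one_neq_zero)
  then show ?case using Suc by auto
qed

text \<open>The minimal polynomial \<open>f\<close> of \<open>x\<close> over \<open>E\<close> divides \<open>X\<^sup>p - x\<^sup>p = (X - x)\<^sup>p\<close>. If \<open>deg f < p\<close>,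
  then \<open>f' \<noteq> 0\<close>, so \<open>x\<close> is a simple root and \<open>f\<close> is linear.\<close>

lemma powers_independent:
  assumes E: "subfield E" and EF: "Fpow p \<subseteq> E" and x: "x \<notin> E"
    and e: "\<And>i. i < p \<Longrightarrow> e i \<in> E" and sum0: "(\<Sum>i<p. e i * x ^ i) = (0::'a)" and i: "i < p"
  shows "e i = 0"
proof (rule ccontr)
  assume ei: "e i \<noteq> 0"
  define A where "A = {f. f \<noteq> 0 \<and> coeffs_in E f \<and> poly f x = 0}"
  define g where "g = (\<Sum>j<p. monom (e j) j)"
  have cg: "coeff g j = (if j < p then e j else 0)" for j
    unfolding g_def by (simp add: coeff_sum)
  have "g \<noteq> 0" using cg[of i] ei i by auto
  moreover have "poly g x = 0" using sum0 by (simp add: g_def poly_sum poly_monom)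
  moreover have "coeffs_in E g" using e by (auto simp: coeffs_in_def cg subfieldD[OF E])
  ultimately have gA: "g \<in> A" by (simp add: A_def)
  have dg: "degree g < p"
    by (rule degree_lessI) (auto simp: cg)
  obtain f where f: "f \<in> A" and min: "\<And>h. h \<in> A \<Longrightarrow> degree f \<le> degree h"
    using ex_has_least_nat[of "\<lambda>h. h \<in> A" g degree] gA by blast
  define n where "n = degree f"
  have n: "n < p" using min[OF gA] dg by (simp add: n_def)
  have f0: "f \<noteq> 0" "coeffs_in E f" "poly f x = 0" using f by (auto simp: A_def)
  have n0: "n > 0"
  proof (rule ccontr)
    assume "\<not> n > 0"
    then obtain c where "f = [:c:]" using degree_0_id[of f] by (metis n_def not_gr_zero)
    then show False using f0 by simp
  qed
  \<comment> \<open>Division with remainder inside \<open>E\<close>: subtracting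
    \<open>m * f\<close> cancels the leading term of \<open>P\<close>, keeps the coefficients in
    \<open>E\<close> and keeps the root \<open>x\<close>. Below degree \<open>n\<close> minimality
    leaves only \<open>P = 0\<close>.\<close>
  have dvd: "f dvd P" if "coeffs_in E P" "poly P x = 0" for P
    using that
  proof (induction "degree P" arbitrary: P rule: less_induct)
    case less
    show ?case
    proof (cases "P = 0")
      case False
      then have le: "n \<le> degree P" using min[of P] less.prems by (simp add: A_def n_def)
      define c where "c = lead_coeff P / lead_coeff f"
      define m where "m = monom c (degree P - n)"
      have c: "c \<in> E" using less.prems f0 by (auto simp: c_def coeffs_in_def intro: subfield_divide[OF E])
      have cm: "coeff (m * f) j = (if j < degree P - n then 0 else c * coeff f (j - (degree P - n)))" for j
        unfolding m_def coeff_monom_mult ..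
      have cQ: "coeffs_in E (P - m * f)"
        using less.prems(1) f0(2) c unfolding coeffs_in_def coeff_diff cm
        by (auto intro!: subfield_diff[OF E] simp: subfieldD[OF E])
      have pQ: "poly (P - m * f) x = 0" using less.prems f0 by simp
      have top: "coeff (P - m * f) (degree P) = 0"
        using le f0(1) by (simp add: cm c_def n_def)
      have "degree (P - m * f) \<le> degree P"
        using degree_mult_le[of m f] degree_monom_le[of c "degree P - n"] le
        by (intro degree_diff_le) (auto simp: m_def n_def)
      then have "P - m * f = 0 \<or> degree (P - m * f) < degree P"
        using top eq_zero_or_degree_less by blast
      then have "f dvd P - m * f" using less.hyps cQ pQ by auto
      then show ?thesis by (metis dvd_add_left_iff diff_add_cancel dvd_triv_right)
    qed simp
  qed
  have "coeffs_in E ([:- x, 1:] ^ p)"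
  proof -
    have "of_nat p = (0 :: 'a poly)" by (simp add: of_nat_poly char_p)
    then have "(monom 1 1 + [:- x:]) ^ p = (monom 1 1) ^ p + [:- x:] ^ p"
      using frobenius_add prime_p by blast
    moreover have "monom 1 1 + [:- x:] = [:- x, 1:]" by (simp add: monom_altdef)
    ultimately have "[:- x, 1:] ^ p = monom 1 p + [:(- x) ^ p:]"
      by (simp add: monom_power poly_const_pow)
    then show ?thesis using EF Fpow_power[of "-x" p]
      by (auto simp: coeffs_in_def coeff_pCons subfieldD[OF E] split: nat.split intro!: subfieldD(3)[OF E])
  qed
  then have fp: "f dvd [:- x, 1:] ^ p" using p_pos by (intro dvd) (auto simp: poly_power)
  have "poly (pderiv f) x \<noteq> 0"
  proof
    assume 0: "poly (pderiv f) x = 0"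
    have "coeff (pderiv f) (n - 1) = of_nat n * coeff f n" using n0 by (simp add: coeff_pderiv)
    then have "pderiv f \<noteq> 0" using of_nat_neq_0[OF n0 n] f0(1) by (auto simp: n_def)
    moreover have "coeffs_in E (pderiv f)" using f0(2)
      by (auto simp: coeffs_in_def coeff_pderiv simp del: of_nat_Suc intro!: subfieldD(4)[OF E] subfield_of_nat[OF E])
    ultimately have "n \<le> degree (pderiv f)" using min[of "pderiv f"] 0 by (simp add: A_def n_def)
    moreover have "degree (pderiv f) \<le> n - 1"
      by (rule degree_le) (auto simp: coeff_pderiv n_def coeff_eq_0 simp del: of_nat_Suc)
    ultimately show False using n0 by simp
  qed
  moreover obtain h where h: "f = [:- x, 1:] * h" using f0(3) by (auto simp: poly_eq_0_iff_dvd)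
  ultimately have "poly h x \<noteq> 0" by (auto simp: pderiv_mult pderiv_pCons simp del: mult_pCons_left)
  moreover have "h dvd [:- x, 1:] ^ p" using fp h by (meson dvd_mult_right)
  ultimately have "degree h = 0" by (rule dvd_linear_power_degree[rotated])
  then obtain c where c: "h = [:c:]" using degree_0_id by metis
  then have "coeff f 0 = - c * x" "coeff f 1 = c" "c \<noteq> 0" using h f0(1) by auto
  then have "x = - (coeff f 0 / coeff f 1)" by simp
  then have "x \<in> E" using f0(2) subfield_divide[OF E] subfieldD(5)[OF E] by (metis coeffs_in_def)
  then show False using x by simp
qed

lemma powers_unique:
  assumes E: "subfield E" and EF: "Fpow p \<subseteq> E" and x: "x \<notin> E"
    and "\<And>i. i < p \<Longrightarrow> e i \<in> E" "\<And>i. i < p \<Longrightarrow> f i \<in> E"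
    and "(\<Sum>i<p. e i * x ^ i) = (\<Sum>i<p. f i * x ^ i::'a)" and i: "i < p"
  shows "e i = f i"
proof -
  have "(\<Sum>i<p. (e i - f i) * x ^ i) = 0" using assms(6) by (simp add: algebra_simps sum_subtractf)
  from powers_independent[OF E EF x _ this i] show ?thesis using assms(4,5) subfield_diff[OF E] by auto
qed

text \<open>If \<open>x\<close> were outside \<open>M(b)\<close>, its powers would be independent
  over \<open>M(b)\<close>. Comparing constant coefficients in
  \<open>b = m 0 + m 1 * x + ...\<close> then gives \<open>b = m 0\<close>, an element of
  \<open>M\<close>.\<close>

lemma exchange:
  assumes M: "subfield M" "Fpow p \<subseteq> M" and b: "b \<notin> M" "b \<in> adj M x"
  shows "x \<in> adj M b"
proof (rule ccontr)
  assume x: "x \<notin> adj M b"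
  obtain m where m: "b = (\<Sum>i<p. m i * x ^ i)" "\<forall>i. m i \<in> M" using b(2) unfolding adj_def by auto
  note N = subfield_adj[OF M, of b]
  have NF: "Fpow p \<subseteq> adj M b" using M(2) adj_base[OF M] by blast
  have "(\<Sum>i<p. m i * x ^ i) = (\<Sum>i<p. (if i = 0 then b else 0) * x ^ i)"
    unfolding m(1)[symmetric] by (simp add: if_distrib[of "\<lambda>z. z * _"] cong: if_cong)
  then have "m 0 = (if (0::nat) = 0 then b else 0)"
    by (rule powers_unique[OF N NF x, rotated 2])
       (use m(2) adj_base[OF M] adj_gen[OF M] subfieldD[OF N] in auto)
  then show False using b(1) m(2) by metis
qed

text \<open>Zorn gives \<open>M\<close> maximal among the subfields over \<open>E\<close> without
  \<open>b\<close>. For \<open>x\<close> outside \<open>M\<close> maximality puts \<open>b\<close>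
  into \<open>M(x)\<close>, and \<open>exchange\<close> puts \<open>x\<close> into
  \<open>M(b)\<close>; so \<open>b\<close> alone generates everything over \<open>M\<close>.\<close>

lemma maximal_avoiding_subfield:
  assumes E: "subfield E" "Fpow p \<subseteq> E" and b: "b \<notin> E"
  obtains M where "subfield M" "E \<subseteq> M" "b \<notin> M" "\<And>x. x \<in> adj M b"
proof -
  define \<S> where "\<S> = {M. subfield M \<and> E \<subseteq> M \<and> b \<notin> M}"
  have "\<exists>M\<in>\<S>. \<forall>X\<in>\<S>. M \<subseteq> X \<longrightarrow> X = M"
  proof (rule subset_Zorn_nonempty)
    show "\<S> \<noteq> {}" using E b unfolding \<S>_def by blast
    fix \<C> assume ne: "\<C> \<noteq> {}" and ch: "subset.chain \<S> \<C>"
    have sub: "\<C> \<subseteq> \<S>" using ch by (simp add: subset.chain_def)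
    have sf: "subfield L" if "L \<in> \<C>" for L using that sub unfolding \<S>_def by blast
    have two: "\<exists>L\<in>\<C>. x \<in> L \<and> y \<in> L" if xy: "x \<in> \<Union>\<C>" "y \<in> \<Union>\<C>" for x y
    proof -
      obtain L K where LK: "L \<in> \<C>" "x \<in> L" "K \<in> \<C>" "y \<in> K" using xy by blast
      then have "L \<subseteq> K \<or> K \<subseteq> L" using ch unfolding subset.chain_def by blast
      then show ?thesis using LK by blast
    qed
    obtain K where K: "K \<in> \<C>" using ne by blast
    have "subfield (\<Union>\<C>)"
      unfolding subfield_def
    proof (intro conjI ballI)
      show "0 \<in> \<Union>\<C>" "1 \<in> \<Union>\<C>" using K subfieldD(1,2)[OF sf[OF K]] by blast+
      fix x assume x: "x \<in> \<Union>\<C>"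
      then obtain L where L: "L \<in> \<C>" "x \<in> L" by blast
      show "- x \<in> \<Union>\<C>" "inverse x \<in> \<Union>\<C>" using L subfieldD(5,6)[OF sf[OF L(1)] L(2)] by blast+
      fix y assume "y \<in> \<Union>\<C>"
      then obtain L where L: "L \<in> \<C>" "x \<in> L" "y \<in> L" using two x by blast
      show "x + y \<in> \<Union>\<C>" "x * y \<in> \<Union>\<C>"
        using L subfieldD(3,4)[OF sf[OF L(1)] L(2,3)] by blast+
    qed
    then show "\<Union>\<C> \<in> \<S>" using ne sub unfolding \<S>_def by blast
  qed
  then obtain M where MS: "M \<in> \<S>" and mx: "\<And>X. X \<in> \<S> \<Longrightarrow> M \<subseteq> X \<Longrightarrow> X = M" by blast
  have M: "subfield M" "E \<subseteq> M" "b \<notin> M" using MS by (auto simp: \<S>_def)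
  have max: "X = M" if "subfield X" "E \<subseteq> X" "b \<notin> X" "M \<subseteq> X" for X
    using mx[of X] that by (simp add: \<S>_def)
  have MF: "Fpow p \<subseteq> M" using E M by blast
  have "x \<in> adj M b" for x
  proof (cases "x \<in> M")
    case True then show ?thesis by (rule adj_base[OF M(1) MF])
  next
    case False
    have "b \<in> adj M x"
    proof (rule ccontr)
      assume "b \<notin> adj M x"
      then have "adj M x = M"
        using max[OF subfield_adj[OF M(1) MF, of x]] adj_base[OF M(1) MF] M(2) by blast
      then show False using adj_gen[OF M(1) MF] False by blast
    qed
    then show ?thesis using exchange[OF M(1) MF M(3)] by blast
  qed
  then show ?thesis using that M by blast
qed

text \<open>The whole field is \<open>M(b)\<close>, with unique coordinates in the powers
  \<open>b ^ i\<close>, \<open>i < p\<close>. Multiplying the coordinate at \<open>b ^ i\<close> by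
  \<open>i\<close> is the Euler operator of \<open>b\<close>, which is zero on \<open>M\<close> and
  so on \<open>E\<close>.\<close>

lemma exists_derivation:
  assumes E: "subfield E" "Fpow p \<subseteq> E" and b: "b \<notin> E"
  obtains \<theta> where "derivation \<theta>" "\<And>x. x \<in> E \<Longrightarrow> \<theta> x = 0" "\<theta> b = (b::'a)"
proof -
  obtain M where M: "subfield M" "E \<subseteq> M" "b \<notin> M" and all: "\<And>x. x \<in> adj M b"
    using maximal_avoiding_subfield[OF E b] by blast
  have MF: "Fpow p \<subseteq> M" using E M by blast
  have "\<exists>e. (\<forall>i. e i \<in> M) \<and> x = (\<Sum>i<p. e i * b ^ i)" for x
    using all[of x] unfolding adj_def by blast
  then obtain r where r: "\<And>x i. r x i \<in> M" "\<And>x. x = (\<Sum>i<p. r x i * b ^ i)" by metis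
  define \<theta> where "\<theta> x = (\<Sum>i<p. of_nat i * r x i * b ^ i)" for x
  have \<theta>: "\<theta> (\<Sum>i<p. e i * b ^ i) = (\<Sum>i<p. of_nat i * e i * b ^ i)" if "\<And>i. i < p \<Longrightarrow> e i \<in> M" for e
    unfolding \<theta>_def
    using powers_unique[OF M(1) MF M(3) r(1) that r(2)[symmetric]] by (intro sum.cong) auto
  have add: "\<theta> (x + y) = \<theta> x + \<theta> y" for x y
  proof -
    have "x + y = (\<Sum>i<p. (r x i + r y i) * b ^ i)"
      using r(2)[of x] r(2)[of y] by (simp add: algebra_simps sum.distrib)
    then have "\<theta> (x + y) = (\<Sum>i<p. of_nat i * (r x i + r y i) * b ^ i)"
      using \<theta> r(1) subfieldD(3)[OF M(1)] by simp
    then show ?thesis by (simp add: \<theta>_def algebra_simps sum.distrib)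
  qed
  \<comment> \<open>Products of two expansions contain exponents up to \<open>2 * p - 2\<close>. The
    eigenvalue survives the reduction modulo \<open>p\<close> because \<open>n\<close> and
    \<open>n mod p\<close> agree in the field.\<close>
  have mono: "\<theta> (m * b ^ n) = of_nat n * (m * b ^ n)" if "m \<in> M" for m n
  proof -
    let ?c = "m * (b ^ (n div p)) ^ p"
    have eq: "m * b ^ n = ?c * b ^ (n mod p)"
      by (metis mult.assoc mult.commute mult_div_mod_eq power_add power_mult)
    let ?e = "\<lambda>i. if i = n mod p then ?c else 0"
    have sum_e: "(\<Sum>i<p. f i * ?e i * b ^ i) = f (n mod p) * ?c * b ^ (n mod p)" for f
      by (simp add: if_distrib[of "\<lambda>z. z * _"] if_distrib[of "\<lambda>z. _ * z"] cong: if_cong)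
    have c: "?c \<in> M" using that MF by (intro subfieldD(4)[OF M(1)]) auto
    have "m * b ^ n = (\<Sum>i<p. ?e i * b ^ i)" using sum_e[of "\<lambda>_. 1"] eq by simp
    then have "\<theta> (m * b ^ n) = (\<Sum>i<p. of_nat i * ?e i * b ^ i)"
      using c subfieldD(1)[OF M(1)] by (simp only:) (rule \<theta>, auto)
    also have "\<dots> = of_nat (n mod p) * ?c * b ^ (n mod p)" by (rule sum_e)
    also have "\<dots> = of_nat n * (m * b ^ n)" by (simp only: eq of_nat_mod mult.assoc)
    finally show ?thesis .
  qed
  have zero: "\<theta> 0 = 0" using add[of 0 0] by (metis add_0 add_cancel_right_right)
  have sum: "\<theta> (sum f A) = (\<Sum>i\<in>A. \<theta> (f i))" for f :: "nat \<Rightarrow> 'a" and A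
    by (induction A rule: infinite_finite_induct) (simp_all add: zero add)
  have mult: "\<theta> (x * y) = x * \<theta> y + y * \<theta> x" for x y
  proof -
    have "x * y = (\<Sum>i<p. \<Sum>j<p. (r x i * r y j) * b ^ (i + j))"
      by (subst r(2)[of x], subst r(2)[of y]) (simp add: sum_product power_add algebra_simps)
    then have "\<theta> (x * y) = (\<Sum>i<p. \<Sum>j<p. of_nat (i + j) * ((r x i * r y j) * b ^ (i + j)))"
      using r(1) by (simp add: sum mono subfieldD(4)[OF M(1)] del: of_nat_add)
    also have "\<dots> = (\<Sum>i<p. \<Sum>j<p. (r x i * b ^ i) * (of_nat j * r y j * b ^ j))
        + (\<Sum>i<p. \<Sum>j<p. (of_nat i * r x i * b ^ i) * (r y j * b ^ j))"
      by (simp add: sum.distrib[symmetric] power_add algebra_simps)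
    also have "\<dots> = x * \<theta> y + \<theta> x * y"
      unfolding sum_product[symmetric] r(2)[symmetric] \<theta>_def ..
    finally show ?thesis by (simp add: mult.commute)
  qed
  have "\<theta> x = 0" if "x \<in> E" for x using mono[of x 0] that M(2) by auto
  moreover have "\<theta> b = b" using mono[of 1 1] subfieldD(2)[OF M(1)] by simp
  moreover have "derivation \<theta>" using add mult unfolding derivation_def by blast
  ultimately show ?thesis using that by blast
qed

end

subsection \<open>Degrees and \<open>p\<close>-independence\<close>

context char_p
begin

text \<open>Via Frobenius, degrees over \<open>F\<^sup>p\<close> are dimensions of a vector space over the type \<open>'a\<close>.\<close>

lemma Frobenius_vector_space: "vector_space (\<lambda>(a::'a) (x::'a). a ^ p * x)"
  by unfold_locales
    (simp_all only: distrib_left distrib_right frob_add power_mult_distrib mult.assoc power_one mult_1_left)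

sublocale Fp: vector_space "\<lambda>(a::'a) (x::'a). a ^ p * x"
  by (rule Frobenius_vector_space)

lemma Fp_independentD:
  assumes "finite B" "Fp.independent B" "(\<Sum>v\<in>B. u v ^ p * v) = 0" "v \<in> B"
  shows "u v = (0::'a)"
  using assms(2-4) unfolding Fp.dependent_finite[OF assms(1)] by blast

lemma lin_indep_over_iff:
  assumes "finite (B::'a set)"
  shows "lin_indep_over (Fpow p) B \<longleftrightarrow> Fp.independent B"
proof
  assume L: "lin_indep_over (Fpow p) B"
  have "u v = 0" if "(\<Sum>v\<in>B. u v ^ p * v) = 0" "v \<in> B" for u :: "'a \<Rightarrow> 'a" and v
  proof -
    have "\<forall>b\<in>B. u b ^ p = 0"
      using L[unfolded lin_indep_over_def, THEN spec[of _ "\<lambda>v. u v ^ p"]] that(1) by simp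
    then show ?thesis using that(2) by simp
  qed
  then show "Fp.independent B" unfolding Fp.dependent_finite[OF assms] by blast
next
  assume I: "Fp.independent B"
  show "lin_indep_over (Fpow p) B"
    unfolding lin_indep_over_def
  proof (intro allI impI)
    fix c assume c: "\<forall>b\<in>B. c b \<in> Fpow p" and s: "(\<Sum>b\<in>B. c b * b) = 0"
    from c have "\<forall>b\<in>B. \<exists>x. c b = x ^ p" by (auto simp: Fpow_def)
    then obtain u where u: "\<And>b. b \<in> B \<Longrightarrow> c b = u b ^ p" by metis
    then have "(\<Sum>b\<in>B. u b ^ p * b) = (\<Sum>b\<in>B. c b * b)" by (intro sum.cong) auto
    then have "(\<Sum>b\<in>B. u b ^ p * b) = 0" using s by simp
    then have "\<forall>b\<in>B. u b = 0" using I unfolding Fp.dependent_finite[OF assms] by blast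
    then show "\<forall>b\<in>B. c b = 0" using u by (simp add: zero_power)
  qed
qed

lemma span_over_eq:
  assumes "finite (B::'a set)"
  shows "span_over (Fpow p) B = Fp.span B"
proof
  show "span_over (Fpow p) B \<subseteq> Fp.span B"
  proof
    fix z assume "z \<in> span_over (Fpow p) B"
    then obtain c where c: "z = (\<Sum>b\<in>B. c b * b)" "\<forall>b\<in>B. c b \<in> Fpow p"
      by (auto simp: span_over_def)
    from c(2) have "\<forall>b\<in>B. \<exists>x. c b = x ^ p" by (auto simp: Fpow_def)
    then obtain u where u: "\<And>b. b \<in> B \<Longrightarrow> c b = u b ^ p" by metis
    then have "z = (\<Sum>b\<in>B. u b ^ p * b)" unfolding c(1) by (intro sum.cong) auto
    then show "z \<in> Fp.span B" unfolding Fp.span_finite[OF assms] by blast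
  qed
  show "Fp.span B \<subseteq> span_over (Fpow p) B"
    unfolding Fp.span_finite[OF assms] span_over_def by auto
qed

lemma has_degree_dim: "has_degree (Fpow p) (L::'a set) n \<Longrightarrow> Fp.dim L = n"
  unfolding has_degree_def
  using Fp.dim_span_eq_card_independent lin_indep_over_iff span_over_eq by auto

lemma pdeg_enatD:
  assumes "pdeg p (C::'a set) = enat k"
  shows "has_degree (Fpow p) (Fpadj p C) (p ^ k)"
proof -
  have ex: "\<exists>k. has_degree (Fpow p) (Fpadj p C) (p ^ k)"
    using assms by (auto simp: pdeg_def split: if_splits)
  then have k: "(THE k. has_degree (Fpow p) (Fpadj p C) (p ^ k)) = k"
    using assms by (simp add: pdeg_def)
  obtain j where j: "has_degree (Fpow p) (Fpadj p C) (p ^ j)" using ex by blast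
  have "i = j" if "has_degree (Fpow p) (Fpadj p C) (p ^ i)" for i
    using has_degree_dim[OF that] has_degree_dim[OF j] p_gt_1 by simp
  then have "(THE k. has_degree (Fpow p) (Fpadj p C) (p ^ k)) = j" using j by blast
  then show ?thesis using j k by simp
qed

lemma p_indep_degree:
  "p_indep p (A::'a set) \<Longrightarrow> finite A \<Longrightarrow> has_degree (Fpow p) (Fpadj p A) (p ^ card A)"
  by (simp add: p_indep_def)

text \<open>Otherwise dropping \<open>b\<close> would keep the field, although the degree prescribed
  by \<open>p\<close>-independence falls from \<open>p ^ card A\<close> to
  \<open>p ^ card (A - {b})\<close>.\<close>

lemma p_indep_notin:
  assumes "p_indep p (A::'a set)" "finite A" "b \<in> A"
  shows "b \<notin> Fpadj p (A - {b})"
proof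
  assume b: "b \<in> Fpadj p (A - {b})"
  have "Fpadj p A = Fpadj p (A - {b})"
    using b subset_Fpadj[of "A - {b}" p] by (intro equalityI Fpadj_subset Fpadj_mono) auto
  moreover have "p_indep p (A - {b})" using assms(1) by (auto simp: p_indep_def)
  ultimately have "p ^ card A = p ^ card (A - {b})"
    using has_degree_dim p_indep_degree assms(1,2) by (metis finite_Diff)
  then have "card A = card (A - {b})" using p_gt_1 by simp
  then show False using assms(2,3) by (metis card_Diff1_less less_irrefl)
qed

text \<open>In one slot, vanishing passes to sums and, by the Leibniz rule, to products, and
  \<open>p\<close>-th powers have zero differential. This moves annihilation from a set to the field
  it generates.\<close>

lemma D_slot:
  assumes "\<And>c. c \<in> C \<Longrightarrow> U * D c * V = 0" "a \<in> Fpadj p C"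
  shows "U * D (a::'a) * V = 0"
  using assms(2)
proof (induction rule: Fpadj_induct)
  case (mult x y)
  have "U * D (x * y) * V = sc x * (U * D y * V) + sc y * (U * D x * V)"
    by (simp add: D_mult distrib_left distrib_right mult.assoc sc_pull)
  then show ?case using mult by simp
qed (simp_all add: assms(1) D_add distrib_left distrib_right)

text \<open>Applies \<open>D_slot\<close> to one slot after the other; the free prefix
  \<open>U\<close> absorbs the slot that has been passed.\<close>

lemma W_slots:
  assumes "\<And>s. length s = length l \<Longrightarrow> (\<forall>i<length l. s ! i \<in> S i) \<Longrightarrow> U * W s = 0"
    and "\<And>i. i < length l \<Longrightarrow> l ! i \<in> Fpadj p (S i)"
  shows "U * W (l::'a list) = 0"
  using assms
proof (induction l arbitrary: U S)
  case Nil then show ?case by simp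
next
  case (Cons a l)
  have "U * D c * W l = 0" if c: "c \<in> S 0" for c
  proof (rule Cons.IH[of "\<lambda>i. S (Suc i)"])
    fix s assume s: "length s = length l" "\<forall>i<length l. s ! i \<in> S (Suc i)"
    have "U * W (c # s) = 0"
      using s c by (intro Cons.prems(1)) (auto simp: nth_Cons split: nat.splits)
    then show "U * D c * W s = 0" by (simp add: mult.assoc)
  qed (use Cons.prems(2)[of "Suc _"] in auto)
  moreover have "a \<in> Fpadj p (S 0)" using Cons.prems(2)[of 0] by simp
  ultimately have "U * D a * W l = 0" by (rule D_slot)
  then show ?case by (simp add: mult.assoc)
qed

lemma W_mem_D:
  assumes "c \<in> set l" shows "W l * D (c::'a) = 0"
proof -
  obtain us vs where "l = us @ c # vs" using assms by (meson split_list)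
  then have "W l * D c = W us * (D c * W vs * D c)" by (simp add: W_append mult.assoc)
  then show ?thesis by (simp add: D_alt)
qed

lemma W_not_distinct: "\<not> distinct l \<Longrightarrow> W (l::'a list) = 0"
proof (induction l)
  case (Cons a l)
  show ?case
  proof (cases "a \<in> set l")
    case True
    then obtain us vs where "l = us @ a # vs" by (meson split_list)
    then show ?thesis using D_alt[of a "W us"] by (simp add: W_append mult.assoc[symmetric])
  qed (use Cons in auto)
qed simp

text \<open>By \<open>W_slots\<close> it suffices to fill the slots with elements of
  \<open>B\<close>, and then one of them occurs twice. The easy inclusions of the theorem rest on
  this count.\<close>

lemma W_too_long:
  assumes "finite B" "card B < length l" "set l \<subseteq> Fpadj p B"
  shows "W (l::'a list) = 0"
proof -
  have "1 * W l = 0"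
  proof (rule W_slots)
    fix s assume s: "length s = length l" "\<forall>i<length l. s ! i \<in> B"
    then have "set s \<subseteq> B" by (auto simp: in_set_conv_nth)
    then have "card (set s) < length s" using s assms card_mono[of B "set s"] by simp
    then show "1 * W s = 0" using W_not_distinct[of s] distinct_card[of s] by auto
  qed (use assms in auto)
  then show ?thesis by simp
qed

lemma W_nonzero_notin: "W (l @ [x]) \<noteq> 0 \<Longrightarrow> (x::'a) \<notin> Fpadj p (set l)"
  using D_slot[of "set l" "W l" 1 x] W_mem_D[of _ l] by (auto simp: W_append)

text \<open>If the word is nonzero, each entry lies outside the field generated by the earlier ones.
  Multiplying an independent family by the powers \<open>x ^ i\<close>, \<open>i < p\<close>, then
  keeps it independent and makes it \<open>p\<close> times as large.\<close>

lemma independent_of_W: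
  "W (l::'a list) \<noteq> 0 \<Longrightarrow> \<exists>B. finite B \<and> card B = p ^ length l \<and> B \<subseteq> Fpadj p (set l) \<and> Fp.independent B"
proof (induction l rule: rev_induct)
  case Nil
  have "Fp.independent {1::'a}" by simp
  then show ?case using subfieldD(2)[OF subfield_Fpadj] by (intro exI[of _ "{1}"]) auto
next
  case (snoc x l)
  have "W l \<noteq> 0" using snoc.prems by (auto simp: W_append)
  then obtain B where B: "finite B" "card B = p ^ length l" "B \<subseteq> Fpadj p (set l)" "Fp.independent B"
    using snoc.IH by blast
  let ?E = "Fpadj p (set l)"
  have x: "x \<notin> ?E" using W_nonzero_notin snoc.prems by blast
  note E = subfield_Fpadj[of p "set l"] Fpow_subset_Fpadj[of p "set l"]
  let ?f = "\<lambda>(e, i). e * x ^ i"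
  let ?P = "B \<times> {..<p}"
  have dep: "c e i = 0" if "(\<Sum>(e, i)\<in>?P. c e i ^ p * (e * x ^ i)) = 0" "e \<in> B" "i < p" for c :: "'a \<Rightarrow> nat \<Rightarrow> 'a" and e i
  proof -
    have "(\<Sum>i<p. (\<Sum>e\<in>B. c e i ^ p * e) * x ^ i) = 0"
      using that(1) by (subst (asm) sum.cartesian_product[symmetric], subst (asm) sum.swap)
        (simp add: sum_distrib_right mult.assoc)
    moreover have "(\<Sum>e\<in>B. c e i ^ p * e) \<in> ?E" for i
      using B(3) by (intro subfield_sum[OF E(1)] subfieldD(4)[OF E(1)]) auto
    ultimately have "(\<Sum>e\<in>B. c e i ^ p * e) = 0"
      using powers_independent[OF E x _ _ that(3), of "\<lambda>i. \<Sum>e\<in>B. c e i ^ p * e"] by blast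
    then show ?thesis using Fp_independentD[OF B(1,4), of "\<lambda>e. c e i"] that(2) by blast
  qed
  have inj: "inj_on ?f ?P"
  proof (rule inj_onI)
    fix z z' assume z: "z \<in> ?P" "z' \<in> ?P" "?f z = ?f z'"
    obtain e i e' i' where zz: "z = (e, i)" "z' = (e', i')" by (metis surj_pair)
    then have a: "e \<in> B" "i \<in> {..<p}" "e' \<in> B" "i' \<in> {..<p}" "e * x ^ i = e' * x ^ i'" using z by auto
    \<comment> \<open>Two different pairs with the same product would give a relation with
      coefficients \<open>1\<close> and \<open>-1\<close>, contrary to \<open>dep\<close>.\<close>
    define c :: "'a \<Rightarrow> nat \<Rightarrow> 'a" where
      "c u j = (if (u, j) = (e, i) then 1 else 0) - (if (u, j) = (e', i') then 1 else 0)" for u j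
    show "z = z'"
    proof (rule ccontr)
      assume "z \<noteq> z'"
      then have ne: "\<not> (e = e' \<and> i = i')" using zz by simp
      have cp: "c u j ^ p * (u * x ^ j) = (if (u, j) = (e, i) then ?f (u, j) else 0)
          - (if (u, j) = (e', i') then ?f (u, j) else 0)" for u j
        using ne by (auto simp: c_def frob_minus zero_power)
      have "(\<Sum>(u, j)\<in>?P. c u j ^ p * (u * x ^ j)) = (\<Sum>z\<in>?P. if z = (e, i) then ?f z else 0)
          - (\<Sum>z\<in>?P. if z = (e', i') then ?f z else 0)"
        unfolding sum_subtractf[symmetric] using cp by (intro sum.cong) (auto simp: case_prod_beta)
      also have "\<dots> = 0" using a B(1) by simp
      finally have s0: "(\<Sum>(u, j)\<in>?P. c u j ^ p * (u * x ^ j)) = 0" .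
      have "c e i = 0" by (rule dep[OF s0 a(1)]) (use a(2) in simp)
      then show False using ne by (simp add: c_def)
    qed
  qed
  have fin: "finite (?f ` ?P)" using B(1) by simp
  have "Fp.independent (?f ` ?P)"
    unfolding Fp.dependent_finite[OF fin]
  proof (rule notI, elim exE conjE bexE)
    fix u v assume v: "v \<in> ?f ` ?P" "u v \<noteq> 0" and s: "(\<Sum>v\<in>?f ` ?P. u v ^ p * v) = 0"
    have s0: "(\<Sum>(e, i)\<in>?P. u (e * x ^ i) ^ p * (e * x ^ i)) = 0"
      using s by (subst (asm) sum.reindex[OF inj]) (simp add: case_prod_beta o_def)
    obtain e i where ei: "v = e * x ^ i" "e \<in> B" "i < p" using v(1) by auto
    have "u (e * x ^ i) = 0" by (rule dep[OF s0 ei(2,3)])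
    then show False using v(2) ei(1) by simp
  qed
  moreover have "card (?f ` ?P) = p ^ length (l @ [x])" using B(2) by (simp add: card_image[OF inj] card_cartesian_product)
  moreover have "?f ` ?P \<subseteq> Fpadj p (set (l @ [x]))"
  proof -
    have "B \<subseteq> Fpadj p (set (l @ [x]))" using B(3) Fpadj_mono[of "set l" "set (l @ [x])" p] by auto
    moreover have "x \<in> Fpadj p (set (l @ [x]))" using subset_Fpadj[of "set (l @ [x])" p] by auto
    ultimately show ?thesis by (auto intro!: subfieldD(4)[OF subfield_Fpadj] subfield_power[OF subfield_Fpadj])
  qed
  ultimately show ?case using fin by blast
qed

lemma length_le_degree:
  assumes "W (l::'a list) \<noteq> 0" "set l \<subseteq> Fpadj p C" "has_degree (Fpow p) (Fpadj p C) (p ^ m)"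
  shows "length l \<le> m"
proof -
  obtain B where B: "finite B" "card B = p ^ length l" "B \<subseteq> Fpadj p (set l)" "Fp.independent B"
    using independent_of_W[OF assms(1)] by blast
  obtain T where T: "finite T" "card T = p ^ m" "span_over (Fpow p) T = Fpadj p C"
    using assms(3) unfolding has_degree_def by blast
  have "B \<subseteq> Fp.span T" using B(3) Fpadj_subset[OF assms(2)] T span_over_eq by blast
  then have "card B \<le> card T" using Fp.independent_span_bound[OF T(1) B(4)] by blast
  then show ?thesis using B(2) T(2) p_gt_1 by simp
qed

end

subsection \<open>Logarithmic derivatives in an extension of degree \<open>p\<close>\<close>

text \<open>Pascal's rule in the form of the induction step of the Leibniz formula.\<close>

lemma pascal_sum:
  fixes f :: "nat \<Rightarrow> nat \<Rightarrow> 'b::comm_semiring_1"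
  shows "(\<Sum>k\<le>Suc n. of_nat (Suc n choose k) * f k (Suc n - k))
    = (\<Sum>k\<le>n. of_nat (n choose k) * (f (Suc k) (n - k) + f k (Suc n - k)))"
proof -
  have "(\<Sum>k\<le>Suc n. of_nat (Suc n choose k) * f k (Suc n - k))
    = f 0 (Suc n) + (\<Sum>k\<le>n. of_nat (Suc n choose Suc k) * f (Suc k) (n - k))"
    by (subst sum.atMost_Suc_shift) simp
  also have "\<dots> = (\<Sum>k\<le>n. of_nat (n choose k) * f (Suc k) (n - k))
     + (f 0 (Suc n) + (\<Sum>k\<le>n. of_nat (n choose Suc k) * f (Suc k) (n - k)))"
    by (simp add: distrib_right sum.distrib add_ac)
  also have "f 0 (Suc n) + (\<Sum>k\<le>n. of_nat (n choose Suc k) * f (Suc k) (n - k))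
    = (\<Sum>k\<le>Suc n. of_nat (n choose k) * f k (Suc n - k))"
    by (subst sum.atMost_Suc_shift) simp
  also have "\<dots> = (\<Sum>k\<le>n. of_nat (n choose k) * f k (Suc n - k))" by (simp add: binomial_eq_0)
  finally show ?thesis by (simp add: distrib_left sum.distrib)
qed

text \<open>Three operators are kept apart because the product rule \<open>twist_mult\<close> mixes
  the twists by \<open>g\<close>, \<open>h\<close> and \<open>g + h\<close>.\<close>

lemma leibniz_power:
  fixes A B C :: "'b::comm_ring_1 \<Rightarrow> 'b"
  assumes add: "\<And>x y. C (x + y) = C x + C y"
    and mult: "\<And>x y. C (x * y) = A x * y + x * B y"
  shows "(C ^^ n) (x * y) = (\<Sum>k\<le>n. of_nat (n choose k) * ((A ^^ k) x * (B ^^ (n - k)) y))"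
proof (induction n)
  case (Suc n)
  have C0: "C 0 = 0" using add[of 0 0] by (metis add_0 add_cancel_right_right)
  have Cn: "C (of_nat m * z) = of_nat m * C z" for m z
    by (induction m) (simp_all add: C0 add distrib_right)
  have Cuv: "C (of_nat m * (u * v)) = of_nat m * (A u * v + u * B v)" for m u v
    by (subst Cn, subst mult) (rule refl)
  have Cs: "C (sum g I) = (\<Sum>i\<in>I. C (g i))" for g and I :: "nat set"
    by (induction I rule: infinite_finite_induct) (simp_all add: C0 add)
  have "(C ^^ Suc n) (x * y) = (\<Sum>k\<le>n. of_nat (n choose k) *
      ((A ^^ Suc k) x * (B ^^ (n - k)) y + (A ^^ k) x * (B ^^ (Suc n - k)) y))"
    unfolding funpow.simps o_def Suc Cs Cuv by (intro sum.cong refl) (simp add: Suc_diff_le)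
  also have "\<dots> = (\<Sum>k\<le>Suc n. of_nat (Suc n choose k) * ((A ^^ k) x * (B ^^ (Suc n - k)) y))"
    by (rule pascal_sum[symmetric])
  finally show ?case .
qed simp

context char_p
begin

lemma leibniz_power_p:
  fixes A B C :: "'a \<Rightarrow> 'a"
  assumes "\<And>x y. C (x + y) = C x + C y" "\<And>x y. C (x * y) = A x * y + x * B y"
  shows "(C ^^ p) (x * y) = (A ^^ p) x * y + x * (B ^^ p) y"
proof -
  have "(C ^^ p) (x * y) = (\<Sum>k\<le>p. of_nat (p choose k) * ((A ^^ k) x * (B ^^ (p - k)) y))"
    by (rule leibniz_power[OF assms])
  also have "\<dots> = (\<Sum>k\<in>{0, p}. of_nat (p choose k) * ((A ^^ k) x * (B ^^ (p - k)) y))"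
  proof (intro sum.mono_neutral_right ballI)
    fix k assume "k \<in> {..p} - {0, p}"
    then have "p dvd (p choose k)" using prime_p by (intro dvd_choose_prime) auto
    then have "of_nat (p choose k) = (0::'a)"
      by (metis char_p dvd_def mult_zero_left of_nat_mult)
    then show "of_nat (p choose k) * ((A ^^ k) x * (B ^^ (p - k)) y) = 0" by simp
  qed auto
  finally show ?thesis by simp
qed

text \<open>Its nonzero kernel elements are the \<open>c\<close> whose logarithmic derivative
  \<open>\<theta> c / c\<close> is \<open>g\<close>.\<close>

definition twist :: "('a \<Rightarrow> 'a) \<Rightarrow> 'a \<Rightarrow> 'a \<Rightarrow> 'a" where
  "twist \<theta> g x = \<theta> x - g * x"

text \<open>The falling factorial with step \<open>i\<close>, that is the product of the operators
  \<open>T - i * j\<close> over \<open>j < n\<close>, applied to \<open>1\<close>. The step is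
  variable because \<open>curv_monomial\<close> needs it to match the eigenvalue of a
  monomial.\<close>

fun fall :: "('a \<Rightarrow> 'a) \<Rightarrow> nat \<Rightarrow> nat \<Rightarrow> 'a" where
  "fall T i 0 = 1"
| "fall T i (Suc n) = T (fall T i n) - of_nat (i * n) * fall T i n"

definition opev :: "('a \<Rightarrow> 'a) \<Rightarrow> 'a poly \<Rightarrow> 'a" where
  "opev T q = (\<Sum>k\<le>degree q. coeff q k * (T ^^ k) 1)"

lemma opev_superset: "degree q \<le> n \<Longrightarrow> opev T q = (\<Sum>k\<le>n. coeff q k * (T ^^ k) 1)"
  unfolding opev_def by (intro sum.mono_neutral_left) (auto simp: coeff_eq_0)

definition roots_poly :: "nat \<Rightarrow> nat \<Rightarrow> 'a poly" where
  "roots_poly i n = (\<Prod>j<n. [:- of_nat (i * j), 1:])"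

text \<open>The multiples \<open>i * j\<close> with \<open>j < p\<close> are \<open>p\<close>
  different elements of the prime field, hence roots of \<open>X ^ p - X\<close>; both polynomials
  are monic of degree \<open>p\<close>.\<close>

lemma roots_poly_p:
  assumes "0 < i" "i < p" shows "roots_poly i p = monom 1 p - monom 1 1"
proof -
  let ?A = "(\<lambda>j. of_nat (i * j) :: 'a) ` {..<p}"
  have inj: "inj_on (\<lambda>j. of_nat (i * j) :: 'a) {..<p}"
  proof (rule inj_onI)
    fix j k assume jk: "j \<in> {..<p}" "k \<in> {..<p}" "of_nat (i * j) = (of_nat (i * k) :: 'a)"
    then have e: "of_nat j = (of_nat k :: 'a)" using of_nat_neq_0[OF assms] by simp
    have "j = k" if "j \<le> k" "k < p" "of_nat j = (of_nat k :: 'a)" for j k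
    proof (rule ccontr)
      assume "j \<noteq> k"
      then have "of_nat (k - j) \<noteq> (0::'a)" using that by (intro of_nat_neq_0) auto
      then show False using that by (simp add: of_nat_diff)
    qed
    then show "j = k" using jk e by (metis lessThan_iff nat_le_linear)
  qed
  have deg: "degree (roots_poly i p) = p" unfolding roots_poly_def
    by (subst degree_prod_eq_sum_degree) auto
  show ?thesis
  proof (rule poly_eqI_degree_lead_coeff[where n = p and A = ?A])
    have "lead_coeff (roots_poly i p) = 1" unfolding roots_poly_def by (simp add: lead_coeff_prod)
    then show "coeff (roots_poly i p) p = coeff (monom 1 p - monom 1 1) p"
      using deg p_gt_1 by simp
    show "p \<le> card ?A" unfolding card_image[OF inj] by simp
    show "degree (roots_poly i p) \<le> p" by (simp add: deg)
    show "degree (monom 1 p - monom (1::'a) 1) \<le> p"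
      using p_gt_1 by (intro degree_diff_le) (auto intro: order.trans[OF degree_monom_le])
    fix z assume "z \<in> ?A"
    then obtain j where j: "j < p" "z = of_nat (i * j)" by auto
    then have "poly (roots_poly i p) z = 0" by (auto simp: roots_poly_def poly_prod)
    moreover have "z ^ p = z" using j of_nat_power_p by metis
    ultimately show "poly (roots_poly i p) z = poly (monom 1 p - monom 1 1) z"
      by (simp add: poly_monom)
  qed
qed

context
  fixes \<theta> :: "'a \<Rightarrow> 'a"
  assumes \<theta>: "derivation \<theta>"
begin

lemma twist_add: "twist \<theta> g (x + y) = twist \<theta> g x + twist \<theta> g y"
  by (simp add: twist_def derivation_simps[OF \<theta>] algebra_simps)

lemma twist_mult: "twist \<theta> (g + h) (x * y) = twist \<theta> g x * y + x * twist \<theta> h y"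
  by (simp add: twist_def derivation_simps[OF \<theta>] algebra_simps)

lemma twist_const: "\<theta> c = 0 \<Longrightarrow> twist \<theta> g (c * y) = c * twist \<theta> g y"
  by (simp add: twist_def derivation_simps[OF \<theta>] algebra_simps)

lemma twist_sum: "twist \<theta> g (sum f A) = (\<Sum>i\<in>A. twist \<theta> g (f i))"
  by (induction A rule: infinite_finite_induct)
     (simp_all add: twist_add, simp_all add: twist_def derivation_simps[OF \<theta>])

text \<open>The coefficients of \<open>roots_poly\<close> are killed by \<open>\<theta>\<close>, so
  they commute with the twist and the product of operators can be expanded like a
  polynomial.\<close>

lemma fall_eq_opev:
  "fall (twist \<theta> g) i n = opev (twist \<theta> g) (roots_poly i n)
    \<and> (\<forall>k. \<theta> (coeff (roots_poly i n) k) = 0) \<and> degree (roots_poly i n) \<le> n"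
proof (induction n)
  case 0
  have "roots_poly i 0 = 1" by (simp add: roots_poly_def)
  then show ?case by (auto simp: opev_def coeff_1 derivation_simps[OF \<theta>])
next
  case (Suc n)
  let ?T = "twist \<theta> g" and ?q = "roots_poly i n" and ?c = "of_nat (i * n) :: 'a"
  have q: "roots_poly i (Suc n) = pCons 0 ?q - smult ?c ?q"
    by (simp add: roots_poly_def mult.commute)
  have d: "degree (roots_poly i (Suc n)) \<le> Suc n"
    unfolding q using Suc by (intro degree_diff_le) (auto intro: order.trans[OF degree_smult_le] simp: degree_pCons_eq_if)
  have "opev ?T (roots_poly i (Suc n)) = (\<Sum>k\<le>Suc n. coeff (pCons 0 ?q) k * (?T ^^ k) 1)
      - ?c * (\<Sum>k\<le>Suc n. coeff ?q k * (?T ^^ k) 1)"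
    unfolding opev_superset[OF d] unfolding q
    by (simp add: sum_subtractf[symmetric] sum_distrib_left algebra_simps del: sum.atMost_Suc)
  also have "(\<Sum>k\<le>Suc n. coeff ?q k * (?T ^^ k) 1) = opev ?T ?q"
    using Suc by (intro opev_superset[symmetric]) simp
  also have "(\<Sum>k\<le>Suc n. coeff (pCons 0 ?q) k * (?T ^^ k) 1) = (\<Sum>k\<le>n. coeff ?q k * (?T ^^ Suc k) 1)"
    by (subst sum.atMost_Suc_shift) simp
  also have "\<dots> = ?T (\<Sum>k\<le>n. coeff ?q k * (?T ^^ k) 1)"
    using Suc by (simp add: twist_sum twist_const)
  also have "(\<Sum>k\<le>n. coeff ?q k * (?T ^^ k) 1) = opev ?T ?q"
    using Suc by (intro opev_superset[symmetric]) simp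
  finally have "fall ?T i (Suc n) = opev ?T (roots_poly i (Suc n))" using Suc by simp
  moreover have "\<theta> (coeff (roots_poly i (Suc n)) k) = 0" for k
    unfolding q using Suc
    by (auto simp: derivation_simps[OF \<theta>] coeff_pCons simp del: of_nat_mult split: nat.splits)
  ultimately show ?case using d by blast
qed

text \<open>The full product is the operator \<open>T ^ p - T\<close>, and \<open>T\<close> sends
  \<open>1\<close> to \<open>- g\<close>.\<close>

lemma fall_p:
  assumes "0 < i" "i < p"
  shows "fall (twist \<theta> g) i p = (twist \<theta> g ^^ p) 1 + g"
proof -
  let ?T = "twist \<theta> g"
  have "fall ?T i p = (\<Sum>k\<le>p. coeff (monom 1 p - monom 1 1) k * (?T ^^ k) 1)"
    using fall_eq_opev[of g i p] opev_superset unfolding roots_poly_p[OF assms] by metis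
  also have "\<dots> = (\<Sum>k\<le>p. (if k = p then (?T ^^ k) 1 else 0)) - (\<Sum>k\<le>p. (if k = 1 then (?T ^^ k) 1 else 0))"
    unfolding sum_subtractf[symmetric] by (intro sum.cong) auto
  also have "\<dots> = (?T ^^ p) 1 - ?T 1" using p_gt_1 by simp
  finally show ?thesis by (simp add: twist_def derivation_simps[OF \<theta>])
qed

text \<open>Related to the \<open>p\<close>-curvature of the connection \<open>\<theta> - g\<close>.
  Evaluated at \<open>1\<close> it is additive in \<open>g\<close>, because the middle binomial
  coefficients in the Leibniz formula vanish.\<close>

definition curv :: "'a \<Rightarrow> 'a" where "curv g = (twist \<theta> g ^^ p) 1"

lemma curv_add: "curv (g + h) = curv g + curv h"
  using leibniz_power_p[OF twist_add twist_mult, of g h 1 1] by (simp add: curv_def)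

context
  fixes E :: "'a set" and b :: 'a
  assumes E: "subfield E" "Fpow p \<subseteq> E" and E0: "\<And>e. e \<in> E \<Longrightarrow> \<theta> e = 0" and b: "\<theta> b = b" "b \<notin> E"
begin

lemma theta_monomial:
  assumes "e \<in> E" shows "\<theta> (e * b ^ i) = of_nat i * (e * b ^ i)"
proof -
  have "\<theta> (b ^ i) = of_nat i * b ^ i"
    by (induction i) (simp_all add: derivation_simps(2,4)[OF \<theta>] b(1) algebra_simps)
  then show ?thesis using E0[OF assms] by (simp add: derivation_simps(2)[OF \<theta>] algebra_simps)
qed

lemma theta_pow_sum: "(\<theta> ^^ k) (sum f A) = (\<Sum>i\<in>A. (\<theta> ^^ k) (f i))"
  by (induction k) (simp_all add: derivation_simps[OF \<theta>])

lemma theta_pow_monomial: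
  assumes "e \<in> E" shows "(\<theta> ^^ k) (e * b ^ i) = of_nat i ^ k * (e * b ^ i)"
proof (induction k)
  case (Suc k)
  have "\<theta> (of_nat i ^ k * (e * b ^ i)) = of_nat i ^ k * (of_nat i * (e * b ^ i))"
    using theta_monomial[OF assms] by (simp add: derivation_simps[OF \<theta>] del: of_nat_power add: of_nat_power[symmetric])
  then show ?case using Suc by (simp add: mult_ac)
qed simp

lemma adj_cases:
  assumes "x \<in> adj E b" obtains e where "\<And>i. e i \<in> E" "x = (\<Sum>i<p. e i * b ^ i)"
  using assms unfolding adj_def by blast

lemma theta_adj: "x \<in> adj E b \<Longrightarrow> \<theta> x \<in> adj E b"
  by (erule adj_cases)
     (auto simp: derivation_simps(7)[OF \<theta>] theta_monomial
       intro!: adj_sum[OF E] adj_smult[OF E] adj_power[OF E] subfield_of_nat[OF E(1)])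

lemma theta_pow_p: "x \<in> adj E b \<Longrightarrow> (\<theta> ^^ p) x = \<theta> x"
  by (erule adj_cases) (simp add: theta_pow_sum theta_pow_monomial of_nat_power_p
       derivation_simps(7)[OF \<theta>] theta_monomial)

text \<open>On \<open>e * b ^ i\<close> the operator acts as \<open>i ^ (p - 1)\<close>, which is
  \<open>1\<close> for \<open>0 < i < p\<close> by Fermat and \<open>0\<close> for
  \<open>i = 0\<close>.\<close>

lemma theta_pow_p1:
  assumes "\<And>i. e i \<in> E"
  shows "(\<Sum>i<p. e i * b ^ i) - (\<theta> ^^ (p - 1)) (\<Sum>i<p. e i * b ^ i) = e 0"
proof -
  have "(\<theta> ^^ (p - 1)) (\<Sum>i<p. e i * b ^ i) = (\<Sum>i<p. if i = 0 then 0 else e i * b ^ i)"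
    unfolding theta_pow_sum theta_pow_monomial[OF assms]
    using p_gt_1 by (intro sum.cong) (auto simp: of_nat_power_p1 zero_power simp del: One_nat_def)
  then have "(\<Sum>i<p. e i * b ^ i) - (\<theta> ^^ (p - 1)) (\<Sum>i<p. e i * b ^ i)
    = (\<Sum>i<p. if i = 0 then e 0 else 0)"
    by (simp only: sum_subtractf[symmetric]) (intro sum.cong, auto)
  then show ?thesis by simp
qed

lemma proj_adj: "x \<in> adj E b \<Longrightarrow> x - (\<theta> ^^ (p - 1)) x \<in> E"
  by (erule adj_cases) (simp add: theta_pow_p1 del: One_nat_def)

text \<open>Jacobson's formula for one monomial \<open>g\<close> with
  \<open>\<theta> g = i * g\<close>. For \<open>i > 0\<close> the operator \<open>T - i * n\<close>
  sends \<open>(- g) ^ n\<close> to \<open>(- g) ^ Suc n\<close>, so the falling factorial with step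
  \<open>i\<close> collapses to \<open>(- g) ^ p\<close> and can be compared with
  \<open>fall_p\<close>.\<close>

lemma curv_monomial:
  assumes e: "e \<in> E" and i: "i < p"
  shows "curv (e * b ^ i) = - ((e * b ^ i) ^ p) - (\<theta> ^^ (p - 1)) (e * b ^ i)"
proof (cases "i = 0")
  case True
  have "(twist \<theta> e ^^ n) 1 = (- e) ^ n" for n
  proof (induction n)
    case (Suc n)
    have "\<theta> ((- e) ^ n) = 0" using E0[OF e] by (simp add: derivation_simps[OF \<theta>])
    then show ?case using Suc by (simp add: twist_def)
  qed simp
  moreover have "(\<theta> ^^ (p - 1)) e = 0"
    using theta_pow_monomial[OF e, of "p - 1" 0] p_gt_1 by (simp add: zero_power)
  ultimately show ?thesis using True by (simp add: curv_def frob_minus)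
next
  case False
  define g where "g = e * b ^ i"
  have \<theta>g: "\<theta> g = of_nat i * g" unfolding g_def by (rule theta_monomial[OF e])
  have "fall (twist \<theta> g) i n = (- g) ^ n" for n
  proof (induction n)
    case (Suc n)
    have "\<theta> ((- g) ^ n) = of_nat (i * n) * (- g) ^ n"
      by (induction n) (simp_all add: derivation_simps(2,4,5)[OF \<theta>] \<theta>g algebra_simps)
    then show ?case using Suc by (simp add: twist_def)
  qed simp
  then have "(- g) ^ p = curv g + g" using fall_p[of i g] False i by (simp add: curv_def)
  moreover have "(\<theta> ^^ (p - 1)) g = g"
    using theta_pow_monomial[OF e, of "p - 1" i] of_nat_power_p1[of i] False i by (simp add: g_def)
  ultimately show ?thesis by (simp add: g_def[symmetric] frob_minus algebra_simps)
qed

text \<open>Both sides are additive in \<open>g\<close>, so monomials suffice.\<close>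

lemma curv_eq:
  assumes "g \<in> adj E b"
  shows "curv g = - (g ^ p) - (\<theta> ^^ (p - 1)) g"
proof -
  obtain e where e: "\<And>i. e i \<in> E" "g = (\<Sum>i<p. e i * b ^ i)" using adj_cases[OF assms] by blast
  have "curv 0 = 0" using curv_add[of 0 0] by (metis add_0 add_cancel_right_right)
  then have "curv (sum f A) = (\<Sum>i\<in>A. curv (f i))" for f and A :: "nat set"
    by (induction A rule: infinite_finite_induct) (simp_all add: curv_add)
  then have "curv g = (\<Sum>i<p. - ((e i * b ^ i) ^ p) - (\<theta> ^^ (p - 1)) (e i * b ^ i))"
    unfolding e(2) using curv_monomial[OF e(1)] by simp
  then show ?thesis unfolding e(2) frob_sum theta_pow_sum by (simp add: sum_subtractf sum_negf)
qed

text \<open>Jacobson's formula gives \<open>(\<theta> - g)\<^sup>p 1 = (\<theta> - g) 1\<close>, so the product of the operators \<open>\<theta> - g - j\<close>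
  over the prime field kills \<open>1\<close>, and one of them has a nonzero kernel.\<close>

lemma exists_log:
  assumes g: "g \<in> adj E b" and fix_g: "g - (\<theta> ^^ (p - 1)) g = g ^ p"
  obtains c where "c \<in> adj E b" "c \<noteq> 0" "\<theta> c = g * c"
proof -
  define Q where "Q = fall (twist \<theta> g) 1"
  note L = subfield_adj[OF E, of b]
  have QL: "Q n \<in> adj E b" for n
    unfolding Q_def by (induction n)
      (auto simp: twist_def intro!: subfield_diff[OF L] subfieldD[OF L] theta_adj g subfield_of_nat[OF L])
  have "Q p = curv g + g" using fall_p[of 1 g] p_gt_1 by (simp add: Q_def curv_def)
  also have "\<dots> = 0" unfolding curv_eq[OF g] fix_g[symmetric] by simp
  finally have Qp: "Q p = 0" .
  \<comment> \<open>The partial products start with \<open>Q 0 = 1\<close> and end with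
    \<open>Q p = 0\<close>; at the place where they become zero, \<open>Q j\<close> is an
    eigenvector.\<close>
  have ex: "\<exists>j<n. Q j \<noteq> 0 \<and> Q (Suc j) = 0" if "Q n = 0" for n
    using that
  proof (induction n)
    case 0 then show ?case by (simp add: Q_def)
  next
    case (Suc n) then show ?case by (cases "Q n = 0") (auto intro: less_SucI)
  qed
  then obtain j where j: "j < p" "Q j \<noteq> 0" "Q (Suc j) = 0" using ex[OF Qp] by blast
  have \<theta>Q: "\<theta> (Q j) = (g + of_nat j) * Q j" using j(3) by (simp add: Q_def twist_def algebra_simps)
  have \<theta>b: "\<theta> (b ^ (p - j)) = of_nat (p - j) * b ^ (p - j)"
    using theta_monomial[of 1 "p - j"] subfieldD(2)[OF E(1)] by simp
  have pj: "of_nat j + of_nat (p - j) = (0::'a)"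
    using j(1) char_p by (metis le_add_diff_inverse less_imp_le of_nat_add)
  have "b \<noteq> 0" using b(2) subfieldD(1)[OF E(1)] by blast
  \<comment> \<open>\<open>Q j\<close> has logarithmic derivative \<open>g + j\<close>. The factor
    \<open>b ^ (p - j)\<close> has \<open>p - j\<close>, which is \<open>- j\<close> in the field,
    and removes the shift.\<close>
  define c where "c = Q j * b ^ (p - j)"
  have "\<theta> c = (g + (of_nat j + of_nat (p - j))) * c"
    unfolding c_def by (simp add: derivation_simps(2)[OF \<theta>] \<theta>Q \<theta>b algebra_simps)
  then have "\<theta> c = g * c" by (simp add: pj)
  moreover have "c \<noteq> 0" using j \<open>b \<noteq> 0\<close> by (simp add: c_def)
  moreover have "c \<in> adj E b" unfolding c_def by (intro subfieldD(4)[OF L] QL adj_power[OF E])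
  ultimately show ?thesis using that by blast
qed

end
end
end

subsection \<open>Coordinates with respect to a \<open>p\<close>-independent sequence\<close>

definition dlog :: "'a::field \<Rightarrow> 'a ext" where "dlog a = sc (inverse a) * D a"

lemma d_dlog [simp]: "d (dlog a) = 0"
proof (cases "a = 0")
  case False then show ?thesis by (simp add: dlog_def d_smult D_inverse mult.assoc)
qed (simp add: dlog_def)

definition L :: "'a::field list \<Rightarrow> 'a ext" where "L l = prod_list (map dlog l)"

lemma L_simps [simp]: "L [] = 1" "L (a # l) = dlog a * L l" "L (l @ m) = L l * L m"
  by (simp_all add: L_def)

text \<open>\<open>\<theta> j\<close> extends the derivation \<open>b\<^sub>j \<partial>/\<partial>b\<^sub>j\<close> of \<open>F\<^sup>p(b\<^sub>0, \<dots>, b\<^sub>N\<^sub>-\<^sub>1)\<close> to all of \<open>F\<close>; outside that subfield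
  the \<open>\<theta> j\<close> need not commute.\<close>

locale pframe = char_p p ty for p :: nat and ty :: "'a::field itself" +
  fixes N :: nat and b :: "nat \<Rightarrow> 'a" and \<theta> :: "nat \<Rightarrow> 'a \<Rightarrow> 'a"
  assumes notin: "j < N \<Longrightarrow> b j \<notin> Fpadj p (b ` ({..<N} - {j}))"
    and der: "j < N \<Longrightarrow> derivation (\<theta> j)"
    and kill: "j < N \<Longrightarrow> x \<in> Fpadj p (b ` ({..<N} - {j})) \<Longrightarrow> \<theta> j x = 0"
    and dual: "j < N \<Longrightarrow> \<theta> j (b j) = b j"
begin

text \<open>The tower along which a leading coefficient descends from \<open>G N\<close> to
  \<open>G 0\<close>, the field of \<open>p\<close>-th powers.\<close>

definition G :: "nat \<Rightarrow> 'a set" where "G q = Fpadj p (b ` {..<q})"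

lemma subfield_G: "subfield (G q)" and Fpow_G: "Fpow p \<subseteq> G q"
  unfolding G_def by (rule subfield_Fpadj, rule Fpow_subset_Fpadj)

lemmas G_closed = subfieldD[OF subfield_G] subfield_diff[OF subfield_G] subfield_divide[OF subfield_G]
  subfield_power[OF subfield_G] subfield_sum[OF subfield_G] subfield_of_nat[OF subfield_G]

lemma G_pow_p: "x ^ p \<in> G q" using Fpow_G Fpow_power by blast

lemma G_mono: "q \<le> r \<Longrightarrow> G q \<subseteq> G r"
  unfolding G_def by (intro Fpadj_mono image_mono) auto

lemma G_Suc: "G (Suc q) = adj (G q) (b q)"
  unfolding G_def lessThan_Suc image_insert Fpadj_insert ..

lemma b_neq_0: "j < N \<Longrightarrow> b j \<noteq> 0"
  using notin[of j] subfieldD(1)[OF subfield_Fpadj, of p "b ` ({..<N} - {j})"] by auto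

lemma theta_b: "j < N \<Longrightarrow> i < N \<Longrightarrow> \<theta> j (b i) = (if i = j then b j else 0)"
  using dual kill[of j "b i"] subset_Fpadj[of "b ` ({..<N} - {j})" p] by auto

lemma G_sub_others: "q < N \<Longrightarrow> G q \<subseteq> Fpadj p (b ` ({..<N} - {q}))"
  unfolding G_def by (intro Fpadj_mono image_mono) auto

lemma b_notin_G: "q < N \<Longrightarrow> b q \<notin> G q"
  using notin[of q] G_sub_others[of q] by auto

lemma theta_kill_G: "q < N \<Longrightarrow> x \<in> G q \<Longrightarrow> \<theta> q x = 0"
  using kill[of q x] G_sub_others[of q] by auto

lemma theta_pow0: "j < N \<Longrightarrow> \<theta> j (x ^ p) = 0"
  by (rule derivation_pow_p[OF der])

lemmas theta_simps = derivation_simps[OF der]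

lemma theta_G: "x \<in> G q \<Longrightarrow> j < N \<Longrightarrow> q \<le> N \<Longrightarrow> \<theta> j x \<in> G q"
  unfolding G_def
proof (induction rule: Fpadj_induct)
  case (mem c)
  then obtain i where i: "c = b i" "i < q" by auto
  then have "\<theta> j c = 0 \<or> \<theta> j c = c" using theta_b[of j i] mem by auto
  then show ?case using mem subset_Fpadj[of "b ` {..<q}" p] subfieldD(1)[OF subfield_Fpadj] by auto
next
  case (power x) then show ?case using theta_pow0 subfieldD(1)[OF subfield_Fpadj] by simp
next
  case (add x y) then show ?case by (simp add: theta_simps subfieldD[OF subfield_Fpadj])
next
  case (mult x y) then show ?case by (simp add: theta_simps subfieldD[OF subfield_Fpadj])
qed

lemma theta_commute:
  assumes "i < N" "j < N" and "x \<in> G N"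
  shows "\<theta> i (\<theta> j x) = \<theta> j (\<theta> i x)"
  using assms(3) unfolding G_def
proof (induction rule: Fpadj_induct)
  case (mem c)
  then obtain k where "c = b k" "k < N" by auto
  then show ?case using assms(1,2) by (simp add: theta_b theta_simps)
next
  case (power x) then show ?case using assms(1,2) by (simp add: theta_pow0 theta_simps(3))
next
  case (add x y) then show ?case using assms(1,2) by (simp add: theta_simps)
next
  case (mult x y) then show ?case using assms(1,2) by (simp add: theta_simps algebra_simps)
qed

lemma theta_pow_p_G:
  assumes "j < N" "x \<in> G N" shows "(\<theta> j ^^ p) x = \<theta> j x"
proof (rule theta_pow_p[of "\<theta> j" "Fpadj p (b ` ({..<N} - {j}))" "b j"])
  have "b ` {..<N} = insert (b j) (b ` ({..<N} - {j}))" using assms(1) by auto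
  then show "x \<in> adj (Fpadj p (b ` ({..<N} - {j}))) (b j)"
    using assms(2) unfolding G_def by (simp add: Fpadj_insert)
qed (use assms der kill dual notin subfield_Fpadj Fpow_subset_Fpadj[THEN subsetD] in auto)

definition \<beta> :: "nat \<Rightarrow> 'a ext" where "\<beta> j = sc (inverse (b j)) * D (b j)"

text \<open>Both sides are additive, obey the Leibniz rule and vanish on \<open>p\<close>-th powers,
  so the generators \<open>b k\<close> decide.\<close>

lemma D_expand:
  assumes "a \<in> G N" shows "D a = (\<Sum>j<N. sc (\<theta> j a) * \<beta> j)"
  using assms unfolding G_def
proof (induction rule: Fpadj_induct)
  case (power x) then show ?case by (simp add: theta_pow0)
next
  case (mem c)
  then obtain k where k: "c = b k" "k < N" by auto
  have "(\<Sum>j<N. sc (\<theta> j c) * \<beta> j) = (\<Sum>j<N. if j = k then sc (b k) * \<beta> k else 0)"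
    using k by (intro sum.cong) (auto simp: theta_b)
  also have "\<dots> = sc (b k * inverse (b k)) * D (b k)" using k by (simp add: \<beta>_def sc_mult mult.assoc)
  finally show ?case using k b_neq_0 by simp
next
  case (add x y) then show ?case
    by (simp add: D_add theta_simps sc_add distrib_right sum.distrib)
next
  case (mult x y) then show ?case
    by (simp add: D_mult theta_simps sc_add sc_mult distrib_right sum.distrib sum_distrib_left mult.assoc)
qed

lemma beta_anti: "\<beta> i * \<beta> j = - (\<beta> j * \<beta> i)"
proof -
  have "\<beta> i * \<beta> j = sc (inverse (b i) * inverse (b j)) * (D (b i) * D (b j))"
    by (simp add: \<beta>_def sc_mult mult.assoc sc_pull)
  moreover have "\<beta> j * \<beta> i = sc (inverse (b i) * inverse (b j)) * (D (b j) * D (b i))"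
    by (subst mult.commute[of "inverse (b i)"]) (simp add: \<beta>_def sc_mult mult.assoc sc_pull)
  ultimately show ?thesis by (simp add: D_anti[of "b i"])
qed

lemma beta_sq: "\<beta> i * \<beta> i = 0"
  by (simp add: \<beta>_def mult.assoc sc_pull)

lemma d_beta [simp]: "d (\<beta> j) = 0"
proof (cases "b j = 0")
  case False then show ?thesis by (simp add: \<beta>_def d_smult D_inverse mult.assoc)
qed (simp add: \<beta>_def)

section \<open>Exterior monomials in the \<open>\<beta> j\<close> and coordinates of forms\<close>

definition wl :: "nat list \<Rightarrow> 'a ext" where "wl l = prod_list (map \<beta> l)"
definition w :: "nat set \<Rightarrow> 'a ext" where "w A = wl (sorted_list_of_set A)"

lemma wl_simps [simp]: "wl [] = 1" "wl (j # l) = \<beta> j * wl l" "wl (l @ m) = wl l * wl m"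
  by (simp_all add: wl_def)

lemma w_empty [simp]: "w {} = 1" by (simp add: w_def)

lemma w_single: "w {j} = \<beta> j" by (simp add: w_def)

lemma d_wl [simp]: "d (wl l) = 0"
proof (induction l)
  case Nil then show ?case using d_sc[of 1] by simp
next
  case (Cons j l) then show ?case by (simp add: d_mult_closed)
qed

lemma d_w [simp]: "d (w A) = 0" by (simp add: w_def)

lemma beta_swap: "\<beta> i * (\<beta> j * X) = - (\<beta> j * (\<beta> i * X))"
  by (simp add: mult.assoc[symmetric] beta_anti[of i j])

lemma beta_mem: "j \<in> set l \<Longrightarrow> \<beta> j * wl l = 0"
proof (induction l)
  case (Cons i l)
  show ?case
  proof (cases "j = i")
    case True then show ?thesis by (simp add: mult.assoc[symmetric] beta_sq)
  next
    case False then show ?thesis using Cons by (simp add: beta_swap[of j i])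
  qed
qed simp

lemma beta_insort:
  "j \<notin> set l \<Longrightarrow> \<exists>s. (s = 1 \<or> s = -1) \<and> \<beta> j * wl l = sc s * wl (insort j l)"
proof (induction l)
  case Nil then show ?case by (auto intro: exI[of _ 1])
next
  case (Cons i l)
  show ?case
  proof (cases "j \<le> i")
    case True then show ?thesis by (auto intro: exI[of _ 1])
  next
    case False
    obtain s where s: "s = 1 \<or> s = -1" "\<beta> j * wl l = sc s * wl (insort j l)" using Cons by auto
    then have "\<beta> j * wl (i # l) = sc (- s) * wl (insort j (i # l))"
      using False by (simp add: beta_swap[of j i] sc_minus sc_pull)
    then show ?thesis using s(1) by (intro exI[of _ "- s"]) auto
  qed
qed

lemma beta_w:
  assumes "finite A"
  shows "j \<notin> A \<Longrightarrow> \<exists>s. (s = 1 \<or> s = -1) \<and> \<beta> j * w A = sc s * w (insert j A)"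
    and "j \<in> A \<Longrightarrow> \<beta> j * w A = 0"
  using beta_insort[of j "sorted_list_of_set A"] beta_mem[of j "sorted_list_of_set A"] assms
  by (auto simp: w_def)

lemma wl_w:
  assumes "finite B"
  shows "distinct l \<Longrightarrow> \<exists>s. (if set l \<inter> B = {} then s = 1 \<or> s = -1 else s = 0)
     \<and> wl l * w B = sc s * w (set l \<union> B)"
proof (induction l)
  case Nil then show ?case by (auto intro: exI[of _ 1])
next
  case (Cons i l)
  then obtain s where s: "if set l \<inter> B = {} then s = 1 \<or> s = -1 else s = 0"
    "wl l * w B = sc s * w (set l \<union> B)" by auto
  have e: "wl (i # l) * w B = sc s * (\<beta> i * w (set l \<union> B))" using s(2) by (simp add: mult.assoc sc_pull)
  show ?case
  proof (cases "i \<in> B")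
    case True
    then have "wl (i # l) * w B = 0" using e beta_w(2)[of "set l \<union> B" i] assms by simp
    then show ?thesis using True by (intro exI[of _ 0]) auto
  next
    case False
    then obtain t where t: "t = 1 \<or> t = -1" "\<beta> i * w (set l \<union> B) = sc t * w (insert i (set l \<union> B))"
      using beta_w(1)[of "set l \<union> B" i] assms Cons.prems by auto
    then have "wl (i # l) * w B = sc (s * t) * w (set (i # l) \<union> B)"
      using e by (simp add: sc_mult mult.assoc)
    then show ?thesis using False t(1) s(1) by (intro exI[of _ "s * t"]) (auto split: if_splits)
  qed
qed

text \<open>Only \<open>sg A B = \<plusminus>1\<close> for disjoint index sets matters, never the actual sign.\<close>

definition sg :: "nat set \<Rightarrow> nat set \<Rightarrow> 'a" where
  "sg A B = (SOME s. (if A \<inter> B = {} then s = 1 \<or> s = -1 else s = 0) \<and> w A * w B = sc s * w (A \<union> B))"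

lemma sg:
  assumes "finite A" "finite B"
  shows "A \<inter> B = {} \<Longrightarrow> sg A B = 1 \<or> sg A B = -1" "A \<inter> B \<noteq> {} \<Longrightarrow> sg A B = 0"
    and w_w: "w A * w B = sc (sg A B) * w (A \<union> B)"
proof -
  have "\<exists>s. (if A \<inter> B = {} then s = 1 \<or> s = -1 else s = 0) \<and> w A * w B = sc s * w (A \<union> B)"
    using wl_w[OF assms(2), of "sorted_list_of_set A"] assms by (simp add: w_def)
  from someI_ex[OF this] have *: "(if A \<inter> B = {} then sg A B = 1 \<or> sg A B = -1 else sg A B = 0)
    \<and> w A * w B = sc (sg A B) * w (A \<union> B)" unfolding sg_def .
  show "A \<inter> B = {} \<Longrightarrow> sg A B = 1 \<or> sg A B = -1" "A \<inter> B \<noteq> {} \<Longrightarrow> sg A B = 0"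
    using * by auto
  show "w A * w B = sc (sg A B) * w (A \<union> B)" using * by blast
qed

lemma sg_nz: "finite A \<Longrightarrow> finite B \<Longrightarrow> A \<inter> B = {} \<Longrightarrow> sg A B \<noteq> 0"
  using sg(1)[of A B] by auto

lemma sg_G: "finite A \<Longrightarrow> finite B \<Longrightarrow> sg A B \<in> G q"
  using sg(1,2)[of A B] G_closed(1)[of q] G_closed(2)[of q] G_closed(5)[OF G_closed(2)[of q]] by (cases "A \<inter> B = {}") auto

lemma sg_pow_p: "finite A \<Longrightarrow> finite B \<Longrightarrow> sg A B ^ p = sg A B"
  using sg(1,2)[of A B] by (cases "A \<inter> B = {}") (auto simp: frob_minus zero_power)

lemma theta_sg: "finite A \<Longrightarrow> finite B \<Longrightarrow> j < N \<Longrightarrow> \<theta> j (sg A B) = 0"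
  using theta_pow0[of j "sg A B"] by (simp add: sg_pow_p)

lemma wl_W: "\<exists>c. (0 \<notin> b ` set l \<longrightarrow> c \<noteq> 0) \<and> wl l = sc c * W (map b l)"
proof (induction l)
  case Nil then show ?case by (auto intro: exI[of _ 1])
next
  case (Cons j l)
  then obtain c where c: "0 \<notin> b ` set l \<longrightarrow> c \<noteq> 0" "wl l = sc c * W (map b l)" by blast
  have "wl (j # l) = sc (inverse (b j) * c) * W (map b (j # l))"
    using c(2) by (simp add: \<beta>_def sc_mult mult.assoc sc_pull)
  then show ?case using c(1) by (intro exI[of _ "inverse (b j) * c"]) auto
qed

lemma W_b_neq_0: "n \<le> N \<Longrightarrow> W (map b [0..<n]) \<noteq> 0"
proof (induction n)
  case (Suc n)
  have "W (map b [0..<n] @ [b n]) \<noteq> 0"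
    using Suc by (intro W_snoc_neq_0[of "\<theta> n"] der) (auto simp: theta_b b_neq_0)
  then show ?case by simp
qed simp

lemma w_top_neq_0: "w {..<N} \<noteq> 0"
proof -
  obtain c where "0 \<notin> b ` set [0..<N] \<longrightarrow> c \<noteq> 0" "wl [0..<N] = sc c * W (map b [0..<N])"
    using wl_W by blast
  then have "wl [0..<N] \<noteq> 0" using W_b_neq_0[of N] b_neq_0 sc_cancel by auto
  then show ?thesis by (simp add: w_def lessThan_atLeast0)
qed

lemma w_D: "w A * D h = sc ((-1) ^ card A) * (D h * w A)"
proof -
  obtain c where c: "w A = sc c * W (map b (sorted_list_of_set A))" using wl_W unfolding w_def by blast
  then have "w A * D h = sc c * ((-1) ^ card A * (D h * W (map b (sorted_list_of_set A))))"
    by (simp add: mult.assoc W_D)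
  then show ?thesis unfolding c
    by (simp add: sc_minus_one_power[symmetric] sc_left_commute[of "D h"] sc_left_commute[of "sc ((-1) ^ card A)"])
qed

definition Sub :: "nat \<Rightarrow> nat set set" where "Sub n = {A. A \<subseteq> {..<N} \<and> card A = n}"

lemma finite_Sub [simp]: "finite (Sub n)"
  unfolding Sub_def by (rule finite_subset[of _ "Pow {..<N}"]) auto

lemma SubD: "A \<in> Sub n \<Longrightarrow> finite A" "A \<in> Sub n \<Longrightarrow> A \<subseteq> {..<N}" "A \<in> Sub n \<Longrightarrow> card A = n"
  unfolding Sub_def using finite_subset by auto

definition frm :: "(nat set \<Rightarrow> 'a) \<Rightarrow> nat \<Rightarrow> 'a ext" where
  "frm x n = (\<Sum>A\<in>Sub n. sc (x A) * w A)"

lemma frm_add: "frm (\<lambda>A. x A + y A) n = frm x n + frm y n"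
  by (simp add: frm_def sc_add distrib_right sum.distrib)

lemma frm_diff: "frm (\<lambda>A. x A - y A) n = frm x n - frm y n"
  by (simp add: frm_def sc_diff left_diff_distrib sum_subtractf)

lemma frm_sc: "frm (\<lambda>A. c * x A) n = sc c * frm x n"
  by (simp add: frm_def sc_mult mult.assoc sum_distrib_left)

lemma frm_0 [simp]: "frm (\<lambda>_. 0) n = 0" by (simp add: frm_def)

lemma frm_cong: "(\<And>A. A \<in> Sub n \<Longrightarrow> x A = y A) \<Longrightarrow> frm x n = frm y n"
  unfolding frm_def by (intro sum.cong) auto

lemma frm_single: "A \<in> Sub n \<Longrightarrow> frm (\<lambda>B. if B = A then c else 0) n = sc c * w A"
  unfolding frm_def by (simp add: if_distrib[of sc] if_distrib[of "\<lambda>z. z * _"] cong: if_cong)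

lemma frm_mult_w:
  assumes "finite C"
  shows "frm x n * w C = (\<Sum>A\<in>Sub n. sc (x A * sg A C) * w (A \<union> C))"
  unfolding frm_def sum_distrib_right
  using assms SubD(1) by (intro sum.cong) (auto simp: mult.assoc w_w sc_mult)

text \<open>Multiplication by the complementary monomial isolates the coefficient at
  \<open>A\<close>: every other index set of the same size meets the complement.\<close>

lemma frm_mult_compl:
  assumes "A \<in> Sub n" "frm x n * w ({..<N} - A) = 0" shows "x A = 0"
proof -
  let ?C = "{..<N} - A"
  have "0 = frm x n * w ?C" using assms(2) by simp
  also have "\<dots> = (\<Sum>B\<in>Sub n. sc (x B * sg B ?C) * w (B \<union> ?C))" by (rule frm_mult_w) simp
  also have "\<dots> = (\<Sum>B\<in>Sub n. if B = A then sc (x A * sg A ?C) * w {..<N} else 0)"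
  proof (intro sum.cong refl)
    fix B assume B: "B \<in> Sub n"
    show "sc (x B * sg B ?C) * w (B \<union> ?C) = (if B = A then sc (x A * sg A ?C) * w {..<N} else 0)"
    proof (cases "B = A")
      case True
      have "A \<union> ?C = {..<N}" using SubD(2)[OF assms(1)] by auto
      then show ?thesis unfolding True by simp
    next
      case False
      have "\<not> B \<subseteq> A"
        using False card_subset_eq[OF SubD(1)[OF assms(1)], of B] SubD(3)[OF B] SubD(3)[OF assms(1)] by auto
      then have "B \<inter> ?C \<noteq> {}" using SubD(2)[OF B] by blast
      then show ?thesis using False SubD(1)[OF B] by (simp add: sg(2))
    qed
  qed
  also have "\<dots> = sc (x A * sg A ?C) * w {..<N}" using assms(1) by simp
  finally have "x A * sg A ?C = 0" using w_top_neq_0 sc_cancel[of "x A * sg A ?C" "w {..<N}"] by auto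
  then show ?thesis using sg_nz[of A ?C] SubD(1)[OF assms(1)] by simp
qed

lemma frm_indep: "frm x n = 0 \<Longrightarrow> A \<in> Sub n \<Longrightarrow> x A = 0"
  using frm_mult_compl[of A n x] by simp

text \<open>The indices outside \<open>A \<union> C\<close> complete \<open>C\<close> to the
  complement of \<open>A\<close>. In this form an annihilator condition forces every index set with
  nonzero coefficient to meet \<open>C\<close>.\<close>

lemma frm_mult_w_0:
  assumes C: "frm x n * w C = 0" "C \<subseteq> {..<N}" and A: "A \<in> Sub n" "A \<inter> C = {}"
  shows "x A = 0"
proof (rule frm_mult_compl[OF A(1)])
  let ?D = "{..<N} - (A \<union> C)"
  have fin: "finite C" "finite ?D" using C(2) finite_subset by auto
  have "C \<union> ?D = {..<N} - A" using C(2) A(2) by auto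
  then have "w C * w ?D = sc (sg C ?D) * w ({..<N} - A)" using w_w[OF fin] by simp
  then have "frm x n * w C * w ?D = sc (sg C ?D) * (frm x n * w ({..<N} - A))"
    by (simp only: mult.assoc sc_left_commute[of "frm x n"])
  moreover have "sg C ?D \<noteq> 0" using fin by (intro sg_nz) auto
  ultimately show "frm x n * w ({..<N} - A) = 0" using C(1) by (simp add: sc_cancel)
qed

lemma frm_unique: "frm x n = frm y n \<Longrightarrow> A \<in> Sub n \<Longrightarrow> x A = y A"
  using frm_indep[of "\<lambda>A. x A - y A" n A] by (simp add: frm_diff)

section \<open>Forms and exact forms with coefficients in \<open>G N\<close>\<close>

definition FG :: "nat \<Rightarrow> 'a ext set" where
  "FG n = {frm x n | x. \<forall>A. x A \<in> G N}"

lemma FG_I: "(\<And>A. x A \<in> G N) \<Longrightarrow> frm x n \<in> FG n" unfolding FG_def by blast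

lemma FG_add: "\<omega> \<in> FG n \<Longrightarrow> \<eta> \<in> FG n \<Longrightarrow> \<omega> + \<eta> \<in> FG n"
  unfolding FG_def using frm_add[symmetric] G_closed(3) by blast

lemma FG_0 [simp]: "0 \<in> FG n"
  using FG_I[of "\<lambda>_. 0" n] G_closed(1) by simp

lemma FG_sum: "(\<And>i. i \<in> I \<Longrightarrow> f i \<in> FG n) \<Longrightarrow> sum f I \<in> FG n"
  by (induction I rule: infinite_finite_induct) (auto intro: FG_add)

lemma FG_single: "A \<in> Sub n \<Longrightarrow> c \<in> G N \<Longrightarrow> sc c * w A \<in> FG n"
  using FG_I[of "\<lambda>B. if B = A then c else 0" n] G_closed(1) by (simp add: frm_single)

lemma FG_sc: "c \<in> G N \<Longrightarrow> \<omega> \<in> FG n \<Longrightarrow> sc c * \<omega> \<in> FG n"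
  unfolding FG_def using frm_sc[symmetric] G_closed(4) by blast

lemma w_beta: "finite A \<Longrightarrow> w A * \<beta> j = sc (sg A {j}) * w (insert j A)"
  using w_w[of A "{j}"] by (simp add: w_single)

lemma insert_Sub:
  assumes "A \<in> Sub n" "j < N" "j \<notin> A" shows "insert j A \<in> Sub (Suc n)"
  using SubD(1)[OF assms(1)] SubD(2)[OF assms(1)] SubD(3)[OF assms(1)] assms(2,3) by (simp add: Sub_def)

lemma FG_beta:
  assumes "\<omega> \<in> FG n" "j < N" shows "\<omega> * \<beta> j \<in> FG (Suc n)"
proof -
  obtain x where x: "\<omega> = frm x n" "\<And>A. x A \<in> G N" using assms(1) unfolding FG_def by blast
  have "sc (x A) * w A * \<beta> j \<in> FG (Suc n)" if A: "A \<in> Sub n" for A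
  proof (cases "j \<in> A")
    case True
    then show ?thesis using SubD(1)[OF A] by (simp add: mult.assoc w_beta sg(2))
  next
    case False
    have "sc (x A * sg A {j}) * w (insert j A) \<in> FG (Suc n)"
      using SubD(1)[OF A] x(2) by (intro FG_single insert_Sub A assms(2) False G_closed(4) sg_G) auto
    then show ?thesis using SubD(1)[OF A] by (simp add: mult.assoc w_beta sc_mult)
  qed
  then show ?thesis unfolding x(1) frm_def sum_distrib_right by (intro FG_sum) auto
qed

lemma FG_D: "\<omega> \<in> FG n \<Longrightarrow> a \<in> G N \<Longrightarrow> \<omega> * D a \<in> FG (Suc n)"
  by (simp add: D_expand sum_distrib_left sc_left_commute)
     (intro FG_sum FG_sc FG_beta theta_G, auto)

lemma FG_1: "1 \<in> FG 0"
  using FG_single[of "{}" 0 1] G_closed(2) by (simp add: Sub_def)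

lemma FG_W: "set l \<subseteq> G N \<Longrightarrow> W l \<in> FG (length l)"
proof (induction l rule: rev_induct)
  case (snoc a l) then show ?case using FG_D[of "W l" "length l" a] by (simp add: W_append)
qed (simp add: FG_1)

lemma FG_minus: "\<omega> \<in> FG n \<Longrightarrow> - \<omega> \<in> FG n"
  using FG_sc[of "-1" \<omega> n] G_closed(2,5) by (simp add: sc_minus)

lemma d_single: "d (sc y * w A) = D y * w A" by (simp add: d_smult)

text \<open>The primitive has coefficients in \<open>G N\<close>, where \<open>d\<close> can be
  computed in coordinates. The case \<open>n = 0\<close> is separate since \<open>n - 1\<close>
  would again be \<open>0\<close>.\<close>

definition Exf :: "nat \<Rightarrow> 'a ext set" where
  "Exf n = (if n = 0 then {0} else d ` FG (n - 1))"

lemma Exf_0 [simp]: "0 \<in> Exf n"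
  unfolding Exf_def by (auto intro!: image_eqI[of _ _ 0])

lemma Exf_add: "\<omega> \<in> Exf n \<Longrightarrow> \<eta> \<in> Exf n \<Longrightarrow> \<omega> + \<eta> \<in> Exf n"
  unfolding Exf_def by (auto split: if_splits simp: d_add[symmetric] intro!: imageI FG_add)

lemma Exf_minus: "\<omega> \<in> Exf n \<Longrightarrow> - \<omega> \<in> Exf n"
  unfolding Exf_def by (auto split: if_splits simp: d_minus[symmetric] intro!: imageI FG_minus)

lemma Exf_diff: "\<omega> \<in> Exf n \<Longrightarrow> \<eta> \<in> Exf n \<Longrightarrow> \<omega> - \<eta> \<in> Exf n"
  using Exf_add[OF _ Exf_minus] by fastforce

lemma Exf_sum: "(\<And>i. i \<in> I \<Longrightarrow> f i \<in> Exf n) \<Longrightarrow> sum f I \<in> Exf n"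
  by (induction I rule: infinite_finite_induct) (auto intro: Exf_add)

lemma Exf_D_W: "y \<in> G N \<Longrightarrow> set l \<subseteq> G N \<Longrightarrow> D y * W l \<in> Exf (Suc (length l))"
  unfolding Exf_def by (auto simp: d_word[symmetric] intro!: imageI FG_sc FG_W)

lemma Exf_closed: "\<omega> \<in> Exf n \<Longrightarrow> d \<omega> = 0"
  unfolding Exf_def by (auto split: if_splits simp: d_d)

text \<open>Pairs of a form and its image under the inverse Cartier operator in the chosen coordinates.\<close>

definition CP :: "nat \<Rightarrow> ('a ext \<times> 'a ext) set" where
  "CP n = {(frm x n, frm (\<lambda>A. x A ^ p) n) | x. \<forall>A. x A \<in> G N}"

lemma CP_I: "(\<And>A. x A \<in> G N) \<Longrightarrow> \<omega> = frm x n \<Longrightarrow> \<omega>' = frm (\<lambda>A. x A ^ p) n \<Longrightarrow> (\<omega>, \<omega>') \<in> CP n"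
  unfolding CP_def by auto

lemma CP_E:
  assumes "(\<omega>, \<omega>') \<in> CP n"
  obtains x where "\<And>A. x A \<in> G N" "\<omega> = frm x n" "\<omega>' = frm (\<lambda>A. x A ^ p) n"
  using assms unfolding CP_def by auto

lemma CP_add:
  assumes "(\<omega>, \<omega>') \<in> CP n" "(\<eta>, \<eta>') \<in> CP n" shows "(\<omega> + \<eta>, \<omega>' + \<eta>') \<in> CP n"
proof -
  obtain x where x: "\<And>A. x A \<in> G N" "\<omega> = frm x n" "\<omega>' = frm (\<lambda>A. x A ^ p) n" using CP_E[OF assms(1)] by blast
  obtain y where y: "\<And>A. y A \<in> G N" "\<eta> = frm y n" "\<eta>' = frm (\<lambda>A. y A ^ p) n" using CP_E[OF assms(2)] by blast
  show ?thesis
    by (rule CP_I[of "\<lambda>A. x A + y A"]) (simp_all add: x y G_closed(3) frm_add frob_add)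
qed

lemma CP_single:
  assumes A: "A \<in> Sub n" and c: "c \<in> G N" shows "(sc c * w A, sc (c ^ p) * w A) \<in> CP n"
proof (rule CP_I[of "\<lambda>B. if B = A then c else 0"])
  have "frm (\<lambda>B. (if B = A then c else 0) ^ p) n = frm (\<lambda>B. if B = A then c ^ p else 0) n"
    by (rule frm_cong) (simp add: zero_power)
  then show "sc (c ^ p) * w A = frm (\<lambda>B. (if B = A then c else 0) ^ p) n" using frm_single[OF A] by simp
qed (use c G_closed(1) frm_single[OF A] in auto)

lemma CP_0: "(0, 0) \<in> CP n"
  by (rule CP_I[of "\<lambda>_. 0"]) (simp_all add: G_closed(1) zero_power)

lemma CP_sum: "(\<And>i. i \<in> I \<Longrightarrow> (f i, g i) \<in> CP n) \<Longrightarrow> (sum f I, sum g I) \<in> CP n"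
  by (induction I rule: infinite_finite_induct) (auto intro: CP_add CP_0)

lemma CP_sc:
  assumes "c \<in> G N" "(\<omega>, \<omega>') \<in> CP n" shows "(sc c * \<omega>, sc (c ^ p) * \<omega>') \<in> CP n"
proof -
  obtain x where x: "\<And>A. x A \<in> G N" "\<omega> = frm x n" "\<omega>' = frm (\<lambda>A. x A ^ p) n" using CP_E[OF assms(2)] by blast
  show ?thesis
    by (rule CP_I[of "\<lambda>A. c * x A"]) (simp_all add: x assms(1) G_closed(4) frm_sc power_mult_distrib)
qed

lemma CP_beta:
  assumes "(\<omega>, \<omega>') \<in> CP n" "j < N" shows "(\<omega> * \<beta> j, \<omega>' * \<beta> j) \<in> CP (Suc n)"
proof -
  obtain x where x: "\<omega> = frm x n" "\<omega>' = frm (\<lambda>A. x A ^ p) n" "\<And>A. x A \<in> G N"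
    using assms(1) unfolding CP_def by blast
  have "(sc (x A) * w A * \<beta> j, sc (x A ^ p) * w A * \<beta> j) \<in> CP (Suc n)" if A: "A \<in> Sub n" for A
  proof (cases "j \<in> A")
    case True
    then show ?thesis using SubD(1)[OF A] by (simp add: mult.assoc w_beta sg(2) CP_0)
  next
    case False
    have "(sc (x A * sg A {j}) * w (insert j A), sc ((x A * sg A {j}) ^ p) * w (insert j A)) \<in> CP (Suc n)"
      using SubD(1)[OF A] x(3) by (intro CP_single insert_Sub A assms(2) False G_closed(4) sg_G) auto
    then show ?thesis using SubD(1)[OF A] by (simp add: mult.assoc w_beta sc_mult power_mult_distrib sg_pow_p)
  qed
  then show ?thesis unfolding x(1,2) frm_def sum_distrib_right by (intro CP_sum) auto
qed

text \<open>Well-definedness of the inverse Cartier operator on \<open>1\<close>-forms, which sends \<open>da\<close> to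
  \<open>a\<^sup>p\<^sup>-\<^sup>1 da\<close> modulo exact forms; additivity follows from the case of \<open>1 + u\<close>.\<close>

definition car :: "'a \<Rightarrow> bool" where
  "car a \<longleftrightarrow> (\<exists>h\<in>G N. sc (a ^ (p - 1)) * D a = (\<Sum>j<N. sc (\<theta> j a ^ p) * \<beta> j) + D h)"

lemma car_pow_p: "car (x ^ p)"
  unfolding car_def using G_closed(1) by (intro bexI[of _ 0]) (simp_all add: theta_pow0 zero_power)

lemma car_mult:
  assumes "car x" "car y" shows "car (x * y)"
proof -
  obtain h where h: "h \<in> G N" "sc (x ^ (p - 1)) * D x = (\<Sum>j<N. sc (\<theta> j x ^ p) * \<beta> j) + D h"
    using assms(1) unfolding car_def by blast
  obtain k where k: "k \<in> G N" "sc (y ^ (p - 1)) * D y = (\<Sum>j<N. sc (\<theta> j y ^ p) * \<beta> j) + D k"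
    using assms(2) unfolding car_def by blast
  have "sc ((x * y) ^ (p - 1)) * D (x * y) = sc (x ^ p) * (sc (y ^ (p - 1)) * D y) + sc (y ^ p) * (sc (x ^ (p - 1)) * D x)"
  proof -
    have c: "(x * y) ^ (p - 1) * x = x ^ p * y ^ (p - 1)" "(x * y) ^ (p - 1) * y = y ^ p * x ^ (p - 1)"
      by (simp_all add: power_mult_distrib power_p mult_ac)
    show ?thesis by (simp only: D_mult distrib_left mult.assoc[symmetric] sc_mult[symmetric] c)
  qed
  also have "\<dots> = (\<Sum>j<N. sc (\<theta> j (x * y) ^ p) * \<beta> j) + D (x ^ p * k + y ^ p * h)"
  proof -
    have "(\<Sum>j<N. sc (\<theta> j (x * y) ^ p) * \<beta> j)
      = sc (x ^ p) * (\<Sum>j<N. sc (\<theta> j y ^ p) * \<beta> j) + sc (y ^ p) * (\<Sum>j<N. sc (\<theta> j x ^ p) * \<beta> j)"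
      unfolding sum_distrib_left sum.distrib[symmetric]
      by (intro sum.cong refl)
        (simp add: theta_simps(2) frob_add power_mult_distrib sc_add sc_mult distrib_right mult.assoc)
    then show ?thesis unfolding h(2) k(2) by (simp add: distrib_left D_add D_mult add_ac)
  qed
  finally show ?thesis unfolding car_def using h(1) k(1)
    by (intro bexI[of _ "x ^ p * k + y ^ p * h"]) (auto intro!: G_closed(3,4) G_pow_p)
qed

lemma car_power: "car x \<Longrightarrow> car (x ^ n)"
proof (induction n)
  case 0 then show ?case using car_pow_p[of 1] by simp
qed (simp add: car_mult)

lemma car_inverse: "car x \<Longrightarrow> car (inverse x)"
  by (subst inverse_eq) (intro car_mult car_pow_p car_power)

text \<open>In the binomial expansion of \<open>(1 + u) ^ (p - 1)\<close> times \<open>D u\<close>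
  the top term is covered by \<open>car u\<close>. The term with \<open>u ^ i\<close>,
  \<open>i < p - 1\<close>, is exact with primitive \<open>?k i\<close>, since \<open>Suc i\<close>
  is invertible in the field.\<close>

lemma car_one_plus:
  assumes "u \<in> G N" "car u" shows "car (1 + u)"
proof -
  obtain h where h: "h \<in> G N" "sc (u ^ (p - 1)) * D u = (\<Sum>j<N. sc (\<theta> j u ^ p) * \<beta> j) + D h"
    using assms(2) unfolding car_def by blast
  let ?k = "\<lambda>i. of_nat (p - 1 choose i) * u ^ Suc i / of_nat (Suc i)"
  have k: "D (?k i) = sc (of_nat (p - 1 choose i) * u ^ i) * D u" if "i < p - 1" for i
  proof -
    have i: "of_nat (Suc i) \<noteq> (0::'a)" using that by (intro of_nat_neq_0) auto
    have c: "D (c * z) = sc c * D z" if "D c = 0" for c z :: 'a using that by (simp add: D_mult)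
    have "D (inverse (of_nat (Suc i))) = (0::'a ext)" using D_inverse[OF i] D_of_nat[of "Suc i"] by (simp del: of_nat_Suc)
    then have c0: "D (of_nat (p - 1 choose i) * inverse (of_nat (Suc i))) = (0::'a ext)" by (simp add: D_mult)
    have "?k i = (of_nat (p - 1 choose i) * inverse (of_nat (Suc i))) * u ^ Suc i" by (simp add: divide_inverse)
    then have "D (?k i) = sc (of_nat (p - 1 choose i) * inverse (of_nat (Suc i))) * (sc (of_nat (Suc i) * u ^ i) * D u)"
      using c[OF c0] D_power[of u "Suc i"] by simp
    also have "\<dots> = sc (of_nat (p - 1 choose i) * inverse (of_nat (Suc i)) * (of_nat (Suc i) * u ^ i)) * D u"
      by (simp only: sc_mult mult.assoc)
    also have "of_nat (p - 1 choose i) * inverse (of_nat (Suc i)) * (of_nat (Suc i) * u ^ i) = of_nat (p - 1 choose i) * u ^ i"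
      using i by (simp del: of_nat_Suc)
    finally show ?thesis .
  qed
  have "(1 + u) ^ (p - 1) = (\<Sum>i\<le>p - 1. of_nat (p - 1 choose i) * u ^ i)"
    unfolding add.commute[of 1 u] binomial_ring by simp
  also have "{..p - 1} = insert (p - 1) {..<p - 1}" by auto
  finally have e: "(1 + u) ^ (p - 1) = u ^ (p - 1) + (\<Sum>i<p - 1. of_nat (p - 1 choose i) * u ^ i)" by simp
  have "sc ((1 + u) ^ (p - 1)) * D (1 + u) = sc (u ^ (p - 1)) * D u + (\<Sum>i<p - 1. D (?k i))"
    unfolding e using k by (simp add: D_add sc_add distrib_right sc_sum sum_distrib_right)
  then have "sc ((1 + u) ^ (p - 1)) * D (1 + u)
      = (\<Sum>j<N. sc (\<theta> j (1 + u) ^ p) * \<beta> j) + D (h + (\<Sum>i<p - 1. ?k i))"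
    unfolding h(2) by (simp add: theta_simps D_add D_sum add.assoc)
  moreover have "h + (\<Sum>i<p - 1. ?k i) \<in> G N"
    using h(1) assms(1) by (intro G_closed) auto
  ultimately show ?thesis unfolding car_def by blast
qed

lemma car_G: "a \<in> G N \<Longrightarrow> car a"
  unfolding G_def
proof (induction rule: Fpadj_induct)
  case (power x) show ?case by (rule car_pow_p)
next
  case (mem c)
  then obtain k where k: "c = b k" "k < N" by auto
  have "(\<Sum>j<N. sc (\<theta> j c ^ p) * \<beta> j) = (\<Sum>j<N. if j = k then sc (b k ^ p) * \<beta> k else 0)"
    using k by (intro sum.cong) (auto simp: theta_b zero_power)
  also have "\<dots> = sc (b k ^ p * inverse (b k)) * D (b k)" using k by (simp add: \<beta>_def sc_mult mult.assoc)
  also have "b k ^ p * inverse (b k) = b k ^ (p - 1)" using b_neq_0[OF k(2)] by (simp add: power_p)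
  finally show ?case unfolding car_def using k(1) G_closed(1) by (intro bexI[of _ 0]) auto
next
  case (mult x y) then show ?case by (simp add: car_mult)
next
  case (add x y)
  show ?case
  proof (cases "x = 0")
    case False
    have "y * inverse x \<in> G N"
      using add unfolding G_def by (intro subfieldD(4,6)[OF subfield_Fpadj])
    then have "car (x * (1 + y * inverse x))"
      using add by (intro car_mult car_one_plus car_inverse)
    moreover have "x * (1 + y * inverse x) = x + y" using False by (simp add: field_simps)
    ultimately show ?thesis by simp
  qed (use add in simp)
qed

lemma dlog_expand: "a \<in> G N \<Longrightarrow> dlog a = (\<Sum>j<N. sc (inverse a * \<theta> j a) * \<beta> j)"
  unfolding dlog_def by (simp add: D_expand sum_distrib_left sc_mult mult.assoc)

text \<open>Multiplying the relation in \<open>car\<close> by the \<open>p\<close>-th power of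
  \<open>inverse a\<close> turns its left side into \<open>dlog a\<close>; as a \<open>p\<close>-th
  power the factor also moves inside the exact term.\<close>

lemma dlog_cartier:
  assumes "a \<in> G N" "a \<noteq> 0"
  obtains h where "h \<in> G N" "dlog a = (\<Sum>j<N. sc ((inverse a * \<theta> j a) ^ p) * \<beta> j) + D h"
proof -
  obtain h where h: "h \<in> G N" "sc (a ^ (p - 1)) * D a = (\<Sum>j<N. sc (\<theta> j a ^ p) * \<beta> j) + D h"
    using car_G[OF assms(1)] unfolding car_def by blast
  have "dlog a = sc ((inverse a) ^ p * a ^ (p - 1)) * D a"
    unfolding dlog_def inverse_eq[symmetric] ..
  also have "\<dots> = sc ((inverse a) ^ p) * (sc (a ^ (p - 1)) * D a)" by (simp only: sc_mult mult.assoc)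
  also have "\<dots> = (\<Sum>j<N. sc ((inverse a * \<theta> j a) ^ p) * \<beta> j) + D ((inverse a) ^ p * h)"
    unfolding h(2) by (simp add: distrib_left sum_distrib_left D_mult power_mult_distrib sc_mult mult.assoc
        del: power_inverse)
  finally show ?thesis by (intro that[of "inverse a ^ p * h"] G_closed(4) G_pow_p h(1))
qed

text \<open>Compares the recipe of \<open>nu\<close>, which raises the coefficient of a logarithmic
  symbol to the \<open>p\<close>-th power, with the one in coordinates; they differ by an exact
  form. One factor \<open>dlog a\<close> is added at a time.\<close>

lemma log_cartier:
  assumes "x \<in> G N" "set l \<subseteq> G N" "0 \<notin> set l"
  shows "\<exists>\<omega>'. (sc x * L l, \<omega>') \<in> CP (length l) \<and> sc (x ^ p) * L l - \<omega>' \<in> Exf (length l)"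
  using assms(2,3)
proof (induction l rule: rev_induct)
  case Nil
  have "(sc x * w {}, sc (x ^ p) * w {}) \<in> CP 0" using assms(1) by (intro CP_single) (auto simp: Sub_def)
  then show ?case by (intro exI[of _ "sc (x ^ p)"]) simp
next
  case (snoc a l)
  let ?n = "length l"
  have a: "a \<in> G N" "a \<noteq> 0" using snoc.prems by auto
  obtain \<omega>' where IH: "(sc x * L l, \<omega>') \<in> CP ?n" "sc (x ^ p) * L l - \<omega>' \<in> Exf ?n" using snoc by auto
  obtain h where h: "h \<in> G N" "dlog a = (\<Sum>j<N. sc ((inverse a * \<theta> j a) ^ p) * \<beta> j) + D h"
    using dlog_cartier[OF a] by blast
  let ?\<eta> = "\<Sum>j<N. sc ((inverse a * \<theta> j a) ^ p) * (\<omega>' * \<beta> j)"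
  have "sc x * L (l @ [a]) = sc x * L l * dlog a" by (simp add: mult.assoc)
  also have "\<dots> = (\<Sum>j<N. sc (inverse a * \<theta> j a) * (sc x * L l * \<beta> j))"
    unfolding dlog_expand[OF a(1)] sum_distrib_left by (simp only: sc_left_commute[of "sc x * L l"])
  finally have "(sc x * L (l @ [a]), ?\<eta>) \<in> CP (Suc ?n)"
    by (simp only:) (intro CP_sum CP_sc CP_beta IH(1) G_closed theta_G a, auto)
  moreover have "sc (x ^ p) * L (l @ [a]) - ?\<eta> \<in> Exf (Suc ?n)"
  proof -
    \<comment> \<open>The old error times \<open>dlog a\<close> stays exact because
      \<open>dlog a\<close> is closed. The new error \<open>\<omega>' * D h\<close> is exact because
      the coefficients of \<open>\<omega>'\<close> are \<open>p\<close>-th powers and the monomials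
      \<open>w A\<close> are closed.\<close>
    have e: "sc (x ^ p) * L (l @ [a]) - ?\<eta> = (sc (x ^ p) * L l - \<omega>') * dlog a + \<omega>' * D h"
    proof -
      have "?\<eta> = \<omega>' * (dlog a - D h)" unfolding h(2) by (simp add: sum_distrib_left sc_left_commute[of \<omega>'])
      then show ?thesis by (simp add: algebra_simps)
    qed
    have "(sc (x ^ p) * L l - \<omega>') * dlog a \<in> Exf (Suc ?n)"
    proof (cases "?n = 0")
      case True then show ?thesis using IH(2) by (simp add: Exf_def image_iff bexI[of _ 0])
    next
      case False
      then obtain \<eta> where \<eta>: "\<eta> \<in> FG (?n - 1)" "sc (x ^ p) * L l - \<omega>' = d \<eta>"
        using IH(2) by (auto simp: Exf_def)
      have "\<eta> * dlog a \<in> FG (Suc (?n - 1))"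
        unfolding dlog_def sc_left_commute[of \<eta>] by (intro FG_sc FG_D \<eta> a G_closed)
      then show ?thesis using False by (auto simp: Exf_def \<eta>(2) d_mult_closed[symmetric] intro!: imageI)
    qed
    moreover have "\<omega>' * D h \<in> Exf (Suc ?n)"
    proof -
      obtain y where y: "\<omega>' = frm (\<lambda>A. y A ^ p) ?n" "\<And>A. y A \<in> G N" using IH(1) unfolding CP_def by blast
      have "sc (y A ^ p) * w A * D h \<in> Exf (Suc ?n)" if A: "A \<in> Sub ?n" for A
      proof -
        have m: "(-1) ^ card A \<in> G N" by (intro subfield_power[OF subfield_G] G_closed(5) G_closed(2))
        have "D ((-1::'a) ^ card A) = 0" by (simp add: D_power D_minus)
        then have "d (sc (y A ^ p * (-1) ^ card A * h) * w A) = sc (y A ^ p) * w A * D h"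
          unfolding d_single by (simp add: D_mult mult.assoc w_D sc_mult)
        moreover have "sc (y A ^ p * (-1) ^ card A * h) * w A \<in> FG ?n"
          by (intro FG_single A G_closed(4) G_pow_p m h)
        ultimately show ?thesis unfolding Exf_def by (auto intro!: image_eqI)
      qed
      then show ?thesis unfolding y(1) frm_def sum_distrib_right by (intro Exf_sum)
    qed
    ultimately show ?thesis unfolding e by (rule Exf_add)
  qed
  ultimately show ?case by auto
qed

end

subsection \<open>Leading terms\<close>

text \<open>\<open>set_encode\<close> reads a set as binary digits, so codes compare two sets at the
  largest element in which they differ.\<close>

lemma set_encode_less:
  assumes "A \<subseteq> {..<q}" shows "set_encode A < 2 ^ q"
proof -
  have "set_encode A \<le> (\<Sum>i<q. 2 ^ i)"
    unfolding set_encode_def using assms by (intro sum_mono2) auto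
  also have "\<dots> = 2 ^ q - 1" using sum_power2[of q] by (simp add: lessThan_atLeast0)
  also have "\<dots> < 2 ^ q" by simp
  finally show ?thesis .
qed

lemma set_encode_lessD:
  assumes "finite A" "set_encode A < 2 ^ q" shows "A \<subseteq> {..<q}"
proof
  fix j assume "j \<in> A"
  then have "2 ^ j \<le> set_encode A"
    unfolding set_encode_def using assms(1) by (intro member_le_sum) auto
  then have "(2::nat) ^ j < 2 ^ q" using assms(2) by linarith
  then show "j \<in> {..<q}" by simp
qed

lemma sorted_list_of_set_insert_greater:
  assumes "finite A" "\<forall>a\<in>A. a < (q::nat)"
  shows "sorted_list_of_set (insert q A) = sorted_list_of_set A @ [q]"
proof (rule sorted_distinct_set_unique)
  show "sorted (sorted_list_of_set A @ [q])" using assms by (auto simp: sorted_append)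
  show "distinct (sorted_list_of_set A @ [q])" using assms by auto
  show "set (sorted_list_of_set (insert q A)) = set (sorted_list_of_set A @ [q])"
    using assms(1) by (simp del: sorted_list_of_set_insert_remove)
qed (simp_all del: sorted_list_of_set_insert_remove)

context pframe
begin

section \<open>Projections along the tower\<close>

definition pj :: "nat \<Rightarrow> 'a \<Rightarrow> 'a" where "pj j x = x - (\<theta> j ^^ (p - 1)) x"

definition prl :: "nat list \<Rightarrow> 'a \<Rightarrow> 'a" where "prl l x = foldr pj l x"

lemma prl_simps [simp]: "prl [] x = x" "prl (j # l) x = pj j (prl l x)" "prl (l @ m) x = prl l (prl m x)"
  by (simp_all add: prl_def)

lemma thn_add: "j < N \<Longrightarrow> (\<theta> j ^^ n) (x + y) = (\<theta> j ^^ n) x + (\<theta> j ^^ n) y"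
  by (induction n) (simp_all add: theta_simps)

lemma thn_0: "j < N \<Longrightarrow> (\<theta> j ^^ n) 0 = 0"
  by (induction n) (simp_all add: theta_simps)

lemma thn_const: "j < N \<Longrightarrow> \<theta> j c = 0 \<Longrightarrow> (\<theta> j ^^ n) (c * x) = c * (\<theta> j ^^ n) x"
  by (induction n) (simp_all add: theta_simps)

lemma thn_G: "x \<in> G q \<Longrightarrow> j < N \<Longrightarrow> q \<le> N \<Longrightarrow> (\<theta> j ^^ n) x \<in> G q"
  by (induction n) (simp_all add: theta_G)

lemma thn_commute: "i < N \<Longrightarrow> j < N \<Longrightarrow> x \<in> G N \<Longrightarrow> (\<theta> j ^^ n) (\<theta> i x) = \<theta> i ((\<theta> j ^^ n) x)"
  by (induction n) (simp_all add: theta_commute thn_G)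

lemma pj_add: "j < N \<Longrightarrow> pj j (x + y) = pj j x + pj j y"
  by (simp add: pj_def thn_add)

lemma pj_0: "j < N \<Longrightarrow> pj j 0 = 0"
  by (simp add: pj_def thn_0)

lemma pj_const: "j < N \<Longrightarrow> \<theta> j c = 0 \<Longrightarrow> pj j (c * x) = c * pj j x"
  by (simp add: pj_def thn_const algebra_simps)

lemma pj_G: "x \<in> G q \<Longrightarrow> j < N \<Longrightarrow> q \<le> N \<Longrightarrow> pj j x \<in> G q"
  unfolding pj_def by (intro subfield_diff[OF subfield_G] thn_G)

lemma pj_theta: "i < N \<Longrightarrow> j < N \<Longrightarrow> x \<in> G N \<Longrightarrow> pj j (\<theta> i x) = \<theta> i (pj j x)"
  by (simp add: pj_def thn_commute theta_simps)

lemma pj_kill: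
  assumes "j < N" "x \<in> G N" shows "pj j (\<theta> j x) = 0"
proof -
  have "(\<theta> j ^^ (p - 1)) (\<theta> j x) = (\<theta> j ^^ Suc (p - 1)) x"
    by (simp only: funpow_Suc_right comp_apply)
  also have "Suc (p - 1) = p" using p_gt_1 by simp
  finally show ?thesis using theta_pow_p_G[OF assms] by (simp add: pj_def)
qed

lemma pj_fixed:
  assumes "j < N" "\<theta> j x = 0" shows "pj j x = x"
proof -
  have "(\<theta> j ^^ Suc m) x = 0" for m
    unfolding funpow_Suc_right comp_apply assms(2) by (rule thn_0[OF assms(1)])
  from this[of "p - 2"] have "(\<theta> j ^^ (p - 1)) x = 0" using p_gt_1 by (simp add: Suc_diff_Suc numeral_2_eq_2 del: funpow.simps)
  then show ?thesis by (simp add: pj_def)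
qed

lemma prl_add: "set l \<subseteq> {..<N} \<Longrightarrow> prl l (x + y) = prl l x + prl l y"
  by (induction l) (simp_all add: pj_add)

lemma prl_0: "set l \<subseteq> {..<N} \<Longrightarrow> prl l 0 = 0"
  by (induction l) (simp_all add: pj_0)

lemma prl_const: "set l \<subseteq> {..<N} \<Longrightarrow> (\<And>j. j \<in> set l \<Longrightarrow> \<theta> j c = 0) \<Longrightarrow> prl l (c * x) = c * prl l x"
  by (induction l) (simp_all add: pj_const)

lemma prl_sum: "set l \<subseteq> {..<N} \<Longrightarrow> prl l (sum f I) = (\<Sum>i\<in>I. prl l (f i))"
  by (induction I rule: infinite_finite_induct) (simp_all add: prl_0 prl_add)

lemma prl_G: "set l \<subseteq> {..<N} \<Longrightarrow> x \<in> G q \<Longrightarrow> q \<le> N \<Longrightarrow> prl l x \<in> G q"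
  by (induction l) (simp_all add: pj_G)

lemma prl_theta: "set l \<subseteq> {..<N} \<Longrightarrow> i < N \<Longrightarrow> x \<in> G N \<Longrightarrow> prl l (\<theta> i x) = \<theta> i (prl l x)"
  by (induction l) (simp_all add: pj_theta prl_G)

text \<open>On \<open>G N\<close> the operators commute, so \<open>\<theta> i\<close> can be brought
  next to \<open>pj i\<close>, where \<open>\<theta> i ^ p = \<theta> i\<close> makes the
  composition zero. Exactness thereby becomes an equation.\<close>

lemma prl_kill:
  assumes "set l \<subseteq> {..<N}" "i \<in> set l" "x \<in> G N" shows "prl l (\<theta> i x) = 0"
proof -
  obtain l1 l2 where l: "l = l1 @ i # l2" using assms(2) by (meson split_list)
  then have s: "set l1 \<subseteq> {..<N}" "set l2 \<subseteq> {..<N}" "i < N" using assms(1) by auto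
  have "pj i (\<theta> i (prl l2 x)) = 0" using s assms(3) by (intro pj_kill prl_G) auto
  then show ?thesis unfolding l using s assms(3) by (simp add: prl_theta prl_0)
qed

text \<open>For \<open>k \<le> q \<le> N\<close> this projects \<open>G q\<close> onto
  \<open>G k\<close>: with exponents taken below \<open>p\<close>, it deletes the monomials that
  involve one of \<open>b k, ..., b (q - 1)\<close>.\<close>

abbreviation pr :: "nat \<Rightarrow> nat \<Rightarrow> 'a \<Rightarrow> 'a" where "pr k q \<equiv> prl [k..<q]"

lemma pj_down:
  assumes "q < N" "x \<in> G (Suc q)" shows "pj q x \<in> G q"
  unfolding pj_def
  by (rule proj_adj[of "\<theta> q" "G q" "b q"])
     (use assms der subfield_G Fpow_G[THEN subsetD] theta_kill_G dual b_notin_G G_Suc in auto)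

lemma prime_field:
  assumes "x ^ p = (x::'a)" obtains u where "x = of_nat u"
proof -
  have "poly (roots_poly 1 p) x = 0"
    using assms p_gt_1 by (simp add: roots_poly_p poly_monom del: One_nat_def)
  then obtain j where "x - of_nat j = 0" by (auto simp: roots_poly_def poly_prod)
  then show ?thesis using that by simp
qed

text \<open>The factor \<open>\<mu> = t\<^sup>p\<close> with \<open>t\<^sup>p\<^sup>-\<^sup>1 = v / z\<close> rescales the projection \<open>z\<close> of \<open>v\<close> so that the fixed point
  equation descends; this is the only use of \<open>F\<^sup>p\<^sup>-\<^sup>1 = F\<close>.\<close>

lemma chain_factor:
  assumes pm1: "\<forall>y::'a. \<exists>x. y = x ^ (p - 1)"
  shows "Q \<le> N \<Longrightarrow> v \<in> G Q \<Longrightarrow> v \<noteq> 0 \<Longrightarrow> (\<forall>k<Q. k \<notin> \<alpha> \<longrightarrow> pr k Q v = pr (Suc k) Q v) \<Longrightarrow> pr 0 Q v = v ^ p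
    \<Longrightarrow> \<exists>u c. (\<forall>i\<in>\<alpha>. i < Q \<longrightarrow> c i \<in> G (Suc i) \<and> c i \<noteq> 0)
        \<and> v = of_nat u * (\<Prod>i\<in>\<alpha> \<inter> {..<Q}. inverse (c i) * \<theta> i (c i))"
proof (induction Q arbitrary: v)
  case 0
  \<comment> \<open>At the bottom of the tower the fixed point equation leaves an element of the
    prime field, the integer factor \<open>u\<close>.\<close>
  then have "v ^ p = v" by simp
  then obtain u where "v = of_nat u" by (rule prime_field)
  then show ?case by auto
next
  case (Suc q)
  define z where "z = pj q v"
  have q: "q < N" and qN: "q \<le> N" using Suc.prems(1) by auto
  have zG: "z \<in> G q" unfolding z_def by (rule pj_down[OF q Suc.prems(2)])
  have pr_Suc: "pr k (Suc q) v = pr k q z" if "k \<le> q" for k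
    using that by (simp add: z_def)
  show ?case
  proof (cases "q \<in> \<alpha>")
    case False
    \<comment> \<open>For \<open>q \<notin> \<alpha>\<close> the link of the chain says that
      \<open>v\<close> already lies in \<open>G q\<close>; no factor is split off.\<close>
    have "pr q (Suc q) v = pr (Suc q) (Suc q) v" using Suc.prems(4) False by blast
    then have zv: "z = v" by (simp add: z_def)
    have "\<forall>k<q. k \<notin> \<alpha> \<longrightarrow> pr k q v = pr (Suc k) q v"
      using Suc.prems(4) pr_Suc unfolding zv by (metis Suc_leI less_SucI less_imp_le)
    moreover have "pr 0 q v = v ^ p" using Suc.prems(5) pr_Suc[of 0] zv by simp
    ultimately obtain u c where uc: "\<forall>i\<in>\<alpha>. i < q \<longrightarrow> c i \<in> G (Suc i) \<and> c i \<noteq> 0"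
      "v = of_nat u * (\<Prod>i\<in>\<alpha> \<inter> {..<q}. inverse (c i) * \<theta> i (c i))"
      using Suc.IH[OF qN _ Suc.prems(3)] zG zv by blast
    moreover have "\<alpha> \<inter> {..<Suc q} = \<alpha> \<inter> {..<q}" using False by (auto simp: less_Suc_eq)
    ultimately show ?thesis using False by (intro exI[of _ u] exI[of _ c]) (auto simp: less_Suc_eq)
  next
    case True
    have sub: "set [k..<q] \<subseteq> {..<N}" for k using q by auto
    have z0: "z \<noteq> 0"
    proof
      assume "z = 0"
      then have "pr 0 (Suc q) v = 0" using pr_Suc[of 0] prl_0[OF sub] by simp
      then show False using Suc.prems(3,5) by simp
    qed
    obtain t where t: "v / z = t ^ (p - 1)" using pm1 by blast
    define \<mu> where "\<mu> = t ^ p"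
    have l0: "\<mu> \<noteq> 0" using t Suc.prems(3) z0 p_gt_1 by (auto simp: \<mu>_def zero_power)
    have lz: "(\<mu> * z) ^ p = \<mu> * v ^ p"
    proof -
      have "\<mu> ^ p = \<mu> * (t ^ (p - 1)) ^ p" unfolding \<mu>_def
        by (subst power_p[of "t ^ p"]) (simp add: power_mult[symmetric] mult.commute)
      also have "\<dots> = \<mu> * (v ^ p / z ^ p)" unfolding t[symmetric] by (simp add: power_divide)
      finally show ?thesis using z0 by (simp add: power_mult_distrib)
    qed
    have lk: "\<theta> j \<mu> = 0" if "j < N" for j unfolding \<mu>_def by (rule theta_pow0[OF that])
    have prl_l: "pr k q (\<mu> * z) = \<mu> * pr k q z" for k
      using sub[of k] by (intro prl_const) (auto intro!: lk)
    have "\<forall>k<q. k \<notin> \<alpha> \<longrightarrow> pr k q (\<mu> * z) = pr (Suc k) q (\<mu> * z)"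
    proof (intro allI impI)
      fix k assume k: "k < q" "k \<notin> \<alpha>"
      have "pr k (Suc q) v = pr (Suc k) (Suc q) v" using Suc.prems(4) k by simp
      then have "pr k q z = pr (Suc k) q z" using pr_Suc[of k] pr_Suc[of "Suc k"] k by simp
      then show "pr k q (\<mu> * z) = pr (Suc k) q (\<mu> * z)" by (simp only: prl_l)
    qed
    moreover have "pr 0 q (\<mu> * z) = (\<mu> * z) ^ p"
      using Suc.prems(5) pr_Suc[of 0] by (simp add: prl_l lz)
    moreover have lzG: "\<mu> * z \<in> G q" unfolding \<mu>_def by (intro G_closed(4) G_pow_p zG)
    ultimately obtain u c where uc: "\<forall>i\<in>\<alpha>. i < q \<longrightarrow> c i \<in> G (Suc i) \<and> c i \<noteq> 0"
      "\<mu> * z = of_nat u * (\<Prod>i\<in>\<alpha> \<inter> {..<q}. inverse (c i) * \<theta> i (c i))"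
      using Suc.IH[of "\<mu> * z"] qN l0 z0 by auto
    \<comment> \<open>In \<open>v = g * (\<mu> * z)\<close> the second factor is treated by
      induction. For \<open>g\<close> both its projection and its \<open>p\<close>-th power are
      \<open>inverse \<mu>\<close>, which is the hypothesis of \<open>exists_log\<close>.\<close>
    define g where "g = inverse (\<mu> * z) * v"
    have iG: "inverse (\<mu> * z) \<in> G q" by (intro G_closed(6) lzG)
    have g_adj: "g \<in> adj (G q) (b q)"
      unfolding G_Suc[symmetric] g_def
      using iG G_mono[of q "Suc q"] Suc.prems(2) by (intro G_closed(4)) auto
    have "pj q g = inverse (\<mu> * z) * z"
      unfolding g_def using pj_const[OF q theta_kill_G[OF q iG]] by (simp add: z_def)
    moreover have "g ^ p = inverse \<mu>"
    proof -
      have "g = v / (\<mu> * z)" by (simp add: g_def divide_inverse)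
      then have "g ^ p = v ^ p / (\<mu> * v ^ p)" by (simp only: power_divide lz)
      then show ?thesis using l0 Suc.prems(3) by (simp add: divide_inverse)
    qed
    ultimately have fix_g: "g - (\<theta> q ^^ (p - 1)) g = g ^ p" using z0 by (simp add: pj_def)
    obtain cq where cq: "cq \<in> adj (G q) (b q)" "cq \<noteq> 0" "\<theta> q cq = g * cq"
      using exists_log[of "\<theta> q" "G q" "b q" g] der[OF q] subfield_G Fpow_G theta_kill_G[OF q] dual[OF q]
        b_notin_G[OF q] g_adj fix_g by blast
    define c' where "c' = c(q := cq)"
    have c': "c' q = cq" "\<And>i. i \<noteq> q \<Longrightarrow> c' i = c i" by (simp_all add: c'_def)
    have pe: "(\<Prod>i\<in>\<alpha> \<inter> {..<q}. inverse (c' i) * \<theta> i (c' i)) = (\<Prod>i\<in>\<alpha> \<inter> {..<q}. inverse (c i) * \<theta> i (c i))"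
      by (intro prod.cong refl) (simp add: c'(2))
    have ins: "finite (\<alpha> \<inter> {..<q})" "q \<notin> \<alpha> \<inter> {..<q}" by auto
    have gq: "inverse (c' q) * \<theta> q (c' q) = g" unfolding c'(1) cq(3) using cq(2) by simp
    have e: "\<alpha> \<inter> {..<Suc q} = insert q (\<alpha> \<inter> {..<q})" using True by auto
    have "v = g * (\<mu> * z)" using l0 z0 by (simp add: g_def field_simps)
    also have "\<dots> = of_nat u * (g * (\<Prod>i\<in>\<alpha> \<inter> {..<q}. inverse (c i) * \<theta> i (c i)))"
      unfolding uc(2) by (rule mult.left_commute)
    also have "g * (\<Prod>i\<in>\<alpha> \<inter> {..<q}. inverse (c i) * \<theta> i (c i))
      = (\<Prod>i\<in>\<alpha> \<inter> {..<Suc q}. inverse (c' i) * \<theta> i (c' i))"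
      unfolding e prod.insert[OF ins] gq pe ..
    finally have "v = of_nat u * (\<Prod>i\<in>\<alpha> \<inter> {..<Suc q}. inverse (c' i) * \<theta> i (c' i))" .
    moreover have "\<forall>i\<in>\<alpha>. i < Suc q \<longrightarrow> c' i \<in> G (Suc i) \<and> c' i \<noteq> 0"
      using uc(1) cq(1,2) by (auto simp: c'_def less_Suc_eq G_Suc)
    ultimately show ?thesis by blast
  qed
qed

section \<open>The leading coefficient of a form in the kernel of wp\<close>

definition dco :: "(nat set \<Rightarrow> 'a) \<Rightarrow> nat set \<Rightarrow> 'a" where
  "dco y B = (\<Sum>j\<in>B. \<theta> j (y (B - {j})) * sg {j} (B - {j}))"

lemma beta_w_sg: "finite A \<Longrightarrow> \<beta> j * w A = sc (sg {j} A) * w (insert j A)"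
  using w_w[of "{j}" A] by (simp add: w_single)

lemma d_frm:
  assumes "\<And>A. y A \<in> G N"
  shows "d (frm y n) = frm (dco y) (Suc n)"
proof -
  let ?t = "\<lambda>(A, j). sc (\<theta> j (y A) * sg {j} A) * w (insert j A)"
  have "d (frm y n) = (\<Sum>A\<in>Sub n. \<Sum>j<N. ?t (A, j))"
    unfolding frm_def d_sum
  proof (intro sum.cong refl)
    fix A assume A: "A \<in> Sub n"
    show "d (sc (y A) * w A) = (\<Sum>j<N. ?t (A, j))"
      using SubD(1)[OF A] by (simp add: d_single D_expand[OF assms] sum_distrib_right mult.assoc beta_w_sg sc_mult)
  qed
  also have "\<dots> = (\<Sum>z\<in>Sub n \<times> {..<N}. ?t z)" by (simp add: sum.cartesian_product)
  also have "\<dots> = (\<Sum>z\<in>{(A, j). A \<in> Sub n \<and> j < N \<and> j \<notin> A}. ?t z)"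
    using SubD(1) by (intro sum.mono_neutral_right) (auto simp: sg(2))
  \<comment> \<open>Adding \<open>j\<close> to \<open>A\<close> matches the pairs with
    \<open>j \<notin> A\<close> with the pairs of a larger set \<open>B\<close> and an element
    \<open>j\<close> of it.\<close>
  also have "\<dots> = (\<Sum>z\<in>Sigma (Sub (Suc n)) (\<lambda>B. B). ?t (fst z - {snd z}, snd z))"
  proof (rule sum.reindex_bij_witness[of _ "\<lambda>(B, j). (B - {j}, j)" "\<lambda>(A, j). (insert j A, j)"])
    fix z assume "z \<in> {(A, j). A \<in> Sub n \<and> j < N \<and> j \<notin> A}"
    then obtain A j where z: "z = (A, j)" "A \<in> Sub n" "j < N" "j \<notin> A" by auto
    then show "(case case z of (A, j) \<Rightarrow> (insert j A, j) of (B, j) \<Rightarrow> (B - {j}, j)) = z"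
      "(case z of (A, j) \<Rightarrow> (insert j A, j)) \<in> Sigma (Sub (Suc n)) (\<lambda>B. B)"
      using insert_Sub[OF z(2-4)] by auto
    show "?t (fst (case z of (A, j) \<Rightarrow> (insert j A, j)) - {snd (case z of (A, j) \<Rightarrow> (insert j A, j))},
      snd (case z of (A, j) \<Rightarrow> (insert j A, j))) = ?t z" using z by simp
  next
    fix z assume "z \<in> Sigma (Sub (Suc n)) (\<lambda>B. B)"
    then obtain B j where z: "z = (B, j)" "B \<in> Sub (Suc n)" "j \<in> B" by auto
    note B = SubD(1)[OF z(2)] SubD(2)[OF z(2)] SubD(3)[OF z(2)]
    have "j < N" "B - {j} \<subseteq> {..<N}" using B(2) z(3) by auto
    moreover have "card (B - {j}) = n" using B(1,3) z(3) by (simp add: card_Diff_singleton)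
    ultimately have "B - {j} \<in> Sub n" "j < N" by (simp_all add: Sub_def)
    then show "(case case z of (B, j) \<Rightarrow> (B - {j}, j) of (A, j) \<Rightarrow> (insert j A, j)) = z"
      "(case z of (B, j) \<Rightarrow> (B - {j}, j)) \<in> {(A, j). A \<in> Sub n \<and> j < N \<and> j \<notin> A}" using z(1,3) by auto
  qed
  also have "\<dots> = (\<Sum>B\<in>Sub (Suc n). \<Sum>j\<in>B. sc (\<theta> j (y (B - {j})) * sg {j} (B - {j})) * w B)"
  proof -
    have "(\<Sum>B\<in>Sub (Suc n). \<Sum>j\<in>B. ?t (B - {j}, j)) = (\<Sum>z\<in>Sigma (Sub (Suc n)) (\<lambda>B. B). ?t (fst z - {snd z}, snd z))"
      using SubD(1)[of _ "Suc n"] by (subst sum.Sigma) (simp_all add: case_prod_beta)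
    moreover have "(\<Sum>B\<in>Sub (Suc n). \<Sum>j\<in>B. ?t (B - {j}, j))
      = (\<Sum>B\<in>Sub (Suc n). \<Sum>j\<in>B. sc (\<theta> j (y (B - {j})) * sg {j} (B - {j})) * w B)"
      by (intro sum.cong refl) (simp add: insert_absorb)
    ultimately show ?thesis by simp
  qed
  also have "\<dots> = frm (dco y) (Suc n)"
    unfolding frm_def dco_def by (simp add: sc_sum sum_distrib_right)
  finally show ?thesis .
qed

lemma prl_sg: "set l \<subseteq> {..<N} \<Longrightarrow> finite A \<Longrightarrow> finite B \<Longrightarrow> prl l (x * sg A B) = prl l x * sg A B"
  using prl_const[of l "sg A B" x] theta_sg[of A B] by (simp add: mult.commute subset_iff)

definition NU :: "nat \<Rightarrow> 'a ext \<Rightarrow> bool" where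
  "NU n \<omega> \<longleftrightarrow> (\<exists>x. (\<forall>A. x A \<in> G N) \<and> \<omega> = frm x n \<and> frm (\<lambda>A. x A ^ p - x A) n \<in> Exf n)"

text \<open>Closedness of \<open>\<wp>(\<omega>)\<close> gives the links of the chain below the indices outside \<open>\<alpha>\<close>, and exactness
  gives its end point. Index sets are ordered by \<open>set_encode\<close>.\<close>

lemma kato_leading:
  assumes pm1: "\<forall>y::'a. \<exists>x. y = x ^ (p - 1)"
    and xG: "\<And>A. x A \<in> G N" and ex: "frm (\<lambda>A. x A ^ p - x A) n \<in> Exf n"
    and \<alpha>: "\<alpha> \<in> Sub n" "x \<alpha> \<noteq> 0"
    and top: "\<And>A. A \<in> Sub n \<Longrightarrow> set_encode \<alpha> < set_encode A \<Longrightarrow> x A = 0"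
  obtains u c where "\<And>i. i \<in> \<alpha> \<Longrightarrow> c i \<in> G (Suc i) \<and> c i \<noteq> 0"
    "x \<alpha> = of_nat u * (\<Prod>i\<in>\<alpha>. inverse (c i) * \<theta> i (c i))"
proof -
  let ?y = "\<lambda>A. x A ^ p - x A"
  have yG: "?y A \<in> G N" for A by (intro subfield_diff[OF subfield_G] G_pow_p xG)
  have sub: "set [k..<N] \<subseteq> {..<N}" for k by auto
  have \<alpha>N: "\<alpha> \<subseteq> {..<N}" and fin: "finite \<alpha>" using SubD[OF \<alpha>(1)] by auto
  have chain: "pr q N (x \<alpha>) = pr (Suc q) N (x \<alpha>)" if q: "q < N" "q \<notin> \<alpha>" for q
  proof -
    let ?l = "[Suc q..<N]" and ?B = "insert q \<alpha>"
    \<comment> \<open>Closedness is read off at \<open>insert q \<alpha>\<close>, where the term at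
      \<open>\<alpha>\<close> itself contributes the derivative \<open>\<theta> q\<close>.\<close>
    have "frm (dco ?y) (Suc n) = 0" using d_frm[of ?y n] yG Exf_closed[OF ex] by simp
    then have "dco ?y ?B = 0" by (rule frm_indep) (rule insert_Sub[OF \<alpha>(1) q])
    then have "0 = prl ?l (dco ?y ?B)" using prl_0 sub by simp
    also have "\<dots> = (\<Sum>j\<in>?B. prl ?l (\<theta> j (?y (?B - {j}))) * sg {j} (?B - {j}))"
      unfolding dco_def prl_sum[OF sub] using fin by (intro sum.cong refl prl_sg sub) auto
    also have "\<dots> = prl ?l (\<theta> q (?y \<alpha>)) * sg {q} \<alpha> + (\<Sum>j\<in>\<alpha>. prl ?l (\<theta> j (?y (?B - {j}))) * sg {j} (?B - {j}))"
      using fin q(2) by (simp add: insert_Diff_if)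
    \<comment> \<open>For \<open>j > q\<close> the projections include \<open>pj j\<close>, which
      kills \<open>\<theta> j\<close>. For \<open>j < q\<close> exchanging \<open>j\<close> for
      \<open>q\<close> raises the code, so the coefficient is zero by maximality of
      \<open>\<alpha>\<close>.\<close>
    also have "(\<Sum>j\<in>\<alpha>. prl ?l (\<theta> j (?y (?B - {j}))) * sg {j} (?B - {j})) = 0"
    proof (intro sum.neutral ballI)
      fix j assume j: "j \<in> \<alpha>"
      show "prl ?l (\<theta> j (?y (?B - {j}))) * sg {j} (?B - {j}) = 0"
      proof (cases "q < j")
        case True
        then show ?thesis using prl_kill[OF sub, of j "Suc q" "?y (?B - {j})"] yG j \<alpha>N by auto
      next
        case False
        then have jq: "j < q" using j q(2) by (metis linorder_neqE_nat)
        have "?B - {j} = insert q (\<alpha> - {j})" using jq by auto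
        then have e: "set_encode (?B - {j}) = 2 ^ q + set_encode (\<alpha> - {j})" using fin q(2) by simp
        have "set_encode \<alpha> = 2 ^ j + set_encode (\<alpha> - {j})"
          using fin j set_encode_insert[of "\<alpha> - {j}" j] by (simp add: insert_absorb)
        then have "set_encode \<alpha> < set_encode (?B - {j})" using e jq by simp
        moreover have "?B - {j} \<in> Sub n"
          using insert_Sub[OF \<alpha>(1) q] j SubD[OF \<alpha>(1)] fin q by (auto simp: Sub_def card_Diff_singleton)
        ultimately have "x (?B - {j}) = 0" by (intro top)
        moreover have "j < N" using j \<alpha>N by auto
        ultimately show ?thesis using prl_0[OF sub] by (simp add: theta_simps zero_power)
      qed
    qed
    finally have "prl ?l (\<theta> q (?y \<alpha>)) = 0" using sg_nz[of "{q}" \<alpha>] fin q(2) by auto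
    moreover have "\<theta> q (?y \<alpha>) = (-1) * \<theta> q (x \<alpha>)" using q(1) by (simp add: theta_simps(6) theta_pow0)
    moreover have "\<theta> j (-1) = 0" if "j < N" for j using that by (simp add: theta_simps(4,5))
    then have "prl ?l ((-1) * \<theta> q (x \<alpha>)) = (-1) * prl ?l (\<theta> q (x \<alpha>))" by (intro prl_const sub) auto
    \<comment> \<open>Only \<open>- x \<alpha>\<close> contributes, as \<open>\<theta> q\<close>
      kills the \<open>p\<close>-th power. So the component of \<open>x \<alpha>\<close> in
      \<open>G (Suc q)\<close> is constant for \<open>\<theta> q\<close> and unchanged by
      \<open>pj q\<close>.\<close>
    ultimately have "\<theta> q (prl ?l (x \<alpha>)) = 0" using prl_theta[OF sub q(1) xG, of "Suc q"] by simp
    then have "pj q (prl ?l (x \<alpha>)) = prl ?l (x \<alpha>)" by (rule pj_fixed[OF q(1)])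
    then show ?thesis using q(1) by (simp add: upt_conv_Cons)
  qed
  \<comment> \<open>Each coefficient of an exact form is a signed sum of derivatives
    \<open>\<theta> j\<close>, and the full projection kills all of them.\<close>
  have p0: "pr 0 N (?y \<alpha>) = 0"
  proof (cases "n = 0")
    case True
    then have "frm ?y n = 0" using ex by (simp add: Exf_def)
    then show ?thesis using frm_indep[OF _ \<alpha>(1), of ?y] prl_0[OF sub] by simp
  next
    case False
    then obtain z where z: "\<And>A. z A \<in> G N" "frm ?y n = d (frm z (n - 1))" using ex by (auto simp: Exf_def FG_def)
    then have "frm ?y n = frm (dco z) n" using d_frm[of z "n - 1"] False by simp
    then have "?y \<alpha> = dco z \<alpha>" by (rule frm_unique) (rule \<alpha>(1))
    then have "pr 0 N (?y \<alpha>) = (\<Sum>j\<in>\<alpha>. pr 0 N (\<theta> j (z (\<alpha> - {j}))) * sg {j} (\<alpha> - {j}))"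
      unfolding dco_def using fin by (simp add: prl_sum[OF sub] prl_sg[OF sub])
    also have "\<dots> = 0" using prl_kill[OF sub, of _ 0] z(1) \<alpha>N by (intro sum.neutral) auto
    finally show ?thesis .
  qed
  have "pr 0 N (x \<alpha> ^ p) = x \<alpha> ^ p * pr 0 N 1"
    using prl_const[OF sub, of 0 "x \<alpha> ^ p" 1] theta_pow0 by simp
  moreover have "pr 0 N 1 = 1"
  proof -
    have "prl l 1 = 1" if "set l \<subseteq> {..<N}" for l
      using that by (induction l) (auto simp: pj_fixed theta_simps(4))
    then show ?thesis using sub by blast
  qed
  moreover have "pr 0 N (x \<alpha> ^ p) = pr 0 N (?y \<alpha>) + pr 0 N (x \<alpha>)"
    using prl_add[OF sub, of 0 "?y \<alpha>" "x \<alpha>"] by simp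
  ultimately have "pr 0 N (x \<alpha>) = x \<alpha> ^ p" using p0 by simp
  then obtain u c where uc: "\<forall>i\<in>\<alpha>. i < N \<longrightarrow> c i \<in> G (Suc i) \<and> c i \<noteq> 0"
      "x \<alpha> = of_nat u * (\<Prod>i\<in>\<alpha> \<inter> {..<N}. inverse (c i) * \<theta> i (c i))"
    using chain_factor[OF pm1, of N "x \<alpha>" \<alpha>] xG \<alpha>(2) chain by blast
  moreover have "\<alpha> \<inter> {..<N} = \<alpha>" using \<alpha>N by blast
  ultimately show ?thesis using that[of c u] \<alpha>N by auto
qed

section \<open>Leading terms of logarithmic forms and the descent\<close>

definition LC :: "nat \<Rightarrow> nat \<Rightarrow> 'a ext set" where
  "LC n r = {frm x n | x. \<forall>A\<in>Sub n. r \<le> set_encode A \<longrightarrow> x A = 0}"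

lemma LC_I: "(\<And>A. A \<in> Sub n \<Longrightarrow> r \<le> set_encode A \<Longrightarrow> x A = 0) \<Longrightarrow> frm x n \<in> LC n r"
  unfolding LC_def by blast

lemma LC_add: "\<omega> \<in> LC n r \<Longrightarrow> \<eta> \<in> LC n r \<Longrightarrow> \<omega> + \<eta> \<in> LC n r"
proof -
  assume "\<omega> \<in> LC n r" "\<eta> \<in> LC n r"
  then obtain x y where xy: "\<omega> = frm x n" "\<forall>A\<in>Sub n. r \<le> set_encode A \<longrightarrow> x A = 0"
    "\<eta> = frm y n" "\<forall>A\<in>Sub n. r \<le> set_encode A \<longrightarrow> y A = 0" unfolding LC_def by blast
  then show ?thesis unfolding xy(1,3) frm_add[symmetric] by (intro LC_I) simp
qed

lemma LC_0: "0 \<in> LC n r"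
  using LC_I[of n r "\<lambda>_. 0"] by simp

lemma LC_sum: "(\<And>i. i \<in> I \<Longrightarrow> f i \<in> LC n r) \<Longrightarrow> sum f I \<in> LC n r"
  by (induction I rule: infinite_finite_induct) (auto intro: LC_add LC_0)

lemma LC_single: "A \<in> Sub n \<Longrightarrow> set_encode A < r \<Longrightarrow> sc c * w A \<in> LC n r"
  by (subst frm_single[symmetric], assumption, rule LC_I) auto

lemma LC_w_beta:
  assumes A: "A \<in> Sub n" and j: "j < N" and r: "j \<notin> A \<Longrightarrow> set_encode (insert j A) < r"
  shows "sc c * w A * (sc e * \<beta> j) \<in> LC (Suc n) r"
proof -
  have "sc c * w A * (sc e * \<beta> j) = sc (c * e * sg A {j}) * w (insert j A)"
    using SubD(1)[OF A] by (simp add: mult.assoc sc_left_commute[of "w A"] w_beta sc_mult)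
  then show ?thesis using LC_single[OF insert_Sub[OF A j]] r SubD(1)[OF A] LC_0
    by (cases "j \<in> A") (auto simp: sg(2))
qed

text \<open>As \<open>c i\<close> lies in \<open>G (Suc i)\<close>, the expansion of
  \<open>dlog (c i)\<close> stops at \<open>\<beta> i\<close>. The top term takes
  \<open>\<beta> i\<close> from every factor; any smaller choice lowers the code.\<close>

lemma leading_log:
  assumes "finite \<alpha>" "\<alpha> \<subseteq> {..<N}" "\<And>i. i \<in> \<alpha> \<Longrightarrow> c i \<in> G (Suc i)"
  shows "\<exists>\<Lambda>\<in>LC (card \<alpha>) (set_encode \<alpha>). L (map c (sorted_list_of_set \<alpha>))
      = sc (\<Prod>i\<in>\<alpha>. inverse (c i) * \<theta> i (c i)) * w \<alpha> + \<Lambda>"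
  using assms
\<comment> \<open>Adding the maximum appends its factor at the end of the sorted list.\<close>
proof (induction \<alpha> rule: finite_linorder_max_induct)
  case empty then show ?case using LC_0 by (intro bexI[of _ 0]) auto
next
  case (insert q A)
  let ?n = "card A" and ?g = "\<Prod>i\<in>A. inverse (c i) * \<theta> i (c i)"
  let ?r = "set_encode (insert q A)"
  have q: "q < N" "q \<notin> A" and AN: "A \<subseteq> {..<N}" and Aq: "A \<subseteq> {..<q}" using insert by auto
  have AS: "A \<in> Sub ?n" using AN by (simp add: Sub_def)
  obtain \<Lambda> where \<Lambda>: "\<Lambda> \<in> LC ?n (set_encode A)" "L (map c (sorted_list_of_set A)) = sc ?g * w A + \<Lambda>"
    using insert.IH insert.prems by auto
  then obtain x where x: "\<Lambda> = frm x ?n" "\<And>B. B \<in> Sub ?n \<Longrightarrow> set_encode A \<le> set_encode B \<Longrightarrow> x B = 0"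
    unfolding LC_def by auto
  have r: "?r = 2 ^ q + set_encode A" using insert.hyps(1) q by simp
  let ?f = "\<lambda>j. inverse (c q) * \<theta> j (c q)"
  have cq: "c q \<in> G (Suc q)" using insert.prems by auto
  have f0: "?f j = 0" if "q < j" "j < N" for j
    using theta_kill_G[OF that(2)] G_mono[of "Suc q" j] cq that(1) by auto
  have cqN: "c q \<in> G N" using cq G_mono[of "Suc q" N] q by auto
  have small: "insert j B \<subseteq> {..<q} \<Longrightarrow> set_encode (insert j B) < ?r" for j B
    using set_encode_less[of "insert j B" q] unfolding r by simp
  have t1: "sc ?g * w A * (sc (?f j) * \<beta> j) \<in> LC (Suc ?n) ?r" if "j \<in> {..<N} - {q}" for j
  proof (cases "q < j")
    case True
    then have fj: "?f j = 0" using f0[of j] that by simp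
    show ?thesis unfolding fj by (simp add: LC_0)
  next
    case False
    then have "insert j A \<subseteq> {..<q}" using Aq that by auto
    then show ?thesis using that small by (intro LC_w_beta AS) auto
  qed
  \<comment> \<open>An index set \<open>B\<close> occurring in \<open>\<Lambda>\<close> has a
    smaller code than \<open>A\<close>, hence lies below \<open>q\<close>. Adding \<open>q\<close>
    to both preserves the comparison, and adding some \<open>j < q\<close> keeps the code below
    \<open>2 ^ q\<close>.\<close>
  have t2: "\<Lambda> * (sc (?f j) * \<beta> j) \<in> LC (Suc ?n) ?r" if j: "j < N" for j
    unfolding x(1) frm_def sum_distrib_right
  proof (rule LC_sum)
    fix B assume B: "B \<in> Sub ?n"
    show "sc (x B) * w B * (sc (?f j) * \<beta> j) \<in> LC (Suc ?n) ?r"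
    proof (cases "x B = 0 \<or> q < j")
      case True
      then have "x B = 0 \<or> ?f j = 0" using f0[of j] j by blast
      then show ?thesis
      proof
        assume fj: "?f j = 0"
        show ?thesis unfolding fj by (simp add: LC_0)
      qed (simp add: LC_0)
    next
      case False
      then have BA: "set_encode B < set_encode A" using x(2)[OF B] by (meson not_le)
      then have Bq: "B \<subseteq> {..<q}"
        using set_encode_lessD[OF SubD(1)[OF B], of q] set_encode_less[OF Aq] by simp
      show ?thesis
      proof (cases "j = q")
        case True
        then show ?thesis using BA r SubD(1)[OF B] by (intro LC_w_beta B j) simp
      next
        case F: False
        then have "insert j B \<subseteq> {..<q}" using Bq False by auto
        then show ?thesis using small by (intro LC_w_beta B j)
      qed
    qed
  qed
  have sl: "sorted_list_of_set (insert q A) = sorted_list_of_set A @ [q]"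
    using insert.hyps by (intro sorted_list_of_set_insert_greater) auto
  have wq: "w (insert q A) = w A * \<beta> q" unfolding w_def sl by simp
  have "L (map c (sorted_list_of_set (insert q A))) = (sc ?g * w A + \<Lambda>) * dlog (c q)"
    unfolding sl by (simp add: \<Lambda>(2))
  also have "dlog (c q) = (\<Sum>j<N. sc (?f j) * \<beta> j)" by (rule dlog_expand[OF cqN])
  also have "(sc ?g * w A + \<Lambda>) * (\<Sum>j<N. sc (?f j) * \<beta> j)
    = (\<Sum>j<N. sc ?g * w A * (sc (?f j) * \<beta> j)) + (\<Sum>j<N. \<Lambda> * (sc (?f j) * \<beta> j))"
    by (simp only: distrib_right sum_distrib_left sum.distrib)
  also have "(\<Sum>j<N. sc ?g * w A * (sc (?f j) * \<beta> j))
    = sc ?g * w A * (sc (?f q) * \<beta> q) + (\<Sum>j\<in>{..<N} - {q}. sc ?g * w A * (sc (?f j) * \<beta> j))"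
    using q(1) by (intro sum.remove) auto
  also have "sc ?g * w A * (sc (?f q) * \<beta> q) = sc (?f q * ?g) * w (insert q A)"
  proof -
    have "sc ?g * w A * (sc (?f q) * \<beta> q) = sc ?g * (sc (?f q) * (w A * \<beta> q))"
      by (simp only: mult.assoc sc_left_commute[of "w A"])
    also have "\<dots> = sc (?g * ?f q) * (w A * \<beta> q)" by (simp only: sc_mult mult.assoc)
    also have "?g * ?f q = ?f q * ?g" by (rule mult.commute)
    finally show ?thesis unfolding wq .
  qed
  also have "?f q * ?g = (\<Prod>i\<in>insert q A. inverse (c i) * \<theta> i (c i))"
    using insert.hyps(1) q(2) by simp
  finally have "L (map c (sorted_list_of_set (insert q A)))
    = sc (\<Prod>i\<in>insert q A. inverse (c i) * \<theta> i (c i)) * w (insert q A)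
     + ((\<Sum>j\<in>{..<N} - {q}. sc ?g * w A * (sc (?f j) * \<beta> j)) + (\<Sum>j<N. \<Lambda> * (sc (?f j) * \<beta> j)))"
    by (simp only: add.assoc)
  moreover have "(\<Sum>j\<in>{..<N} - {q}. sc ?g * w A * (sc (?f j) * \<beta> j)) + (\<Sum>j<N. \<Lambda> * (sc (?f j) * \<beta> j)) \<in> LC (Suc ?n) ?r"
    by (intro LC_add LC_sum t1 t2) auto
  moreover have "card (insert q A) = Suc ?n" using insert.hyps(1) q(2) by simp
  ultimately show ?case by auto
qed

lemma NU_diff:
  assumes "NU n \<omega>" "NU n \<eta>" shows "NU n (\<omega> - \<eta>)"
proof -
  obtain x where x: "\<And>A. x A \<in> G N" "\<omega> = frm x n" "frm (\<lambda>A. x A ^ p - x A) n \<in> Exf n"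
    using assms(1) unfolding NU_def by blast
  obtain y where y: "\<And>A. y A \<in> G N" "\<eta> = frm y n" "frm (\<lambda>A. y A ^ p - y A) n \<in> Exf n"
    using assms(2) unfolding NU_def by blast
  have "frm (\<lambda>A. (x A - y A) ^ p - (x A - y A)) n
    = frm (\<lambda>A. x A ^ p - x A) n - frm (\<lambda>A. y A ^ p - y A) n"
    unfolding frm_diff[symmetric] by (intro frm_cong) (simp add: frob_diff)
  then have "frm (\<lambda>A. (x A - y A) ^ p - (x A - y A)) n \<in> Exf n" using x(3) y(3) by (simp add: Exf_diff)
  then show ?thesis unfolding NU_def using x(1,2) y(1,2) subfield_diff[OF subfield_G]
    by (intro exI[of _ "\<lambda>A. x A - y A"]) (simp add: frm_diff)
qed

text \<open>Modulo exact forms the inverse Cartier operator fixes logarithmic forms, and their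
  integer multiples too since \<open>u ^ p = u\<close> in the prime field.\<close>

lemma NU_log:
  assumes "set l \<subseteq> G N" "0 \<notin> set l" shows "NU (length l) (sc (of_nat u) * L l)"
proof -
  have u: "(of_nat u :: 'a) ^ p = of_nat u" by (rule of_nat_power_p)
  obtain \<omega>' where w': "(sc (of_nat u) * L l, \<omega>') \<in> CP (length l)" "sc (of_nat u ^ p) * L l - \<omega>' \<in> Exf (length l)"
    using log_cartier[OF G_closed(11) assms, of u] by blast
  obtain x where x: "\<And>A. x A \<in> G N" "sc (of_nat u) * L l = frm x (length l)" "\<omega>' = frm (\<lambda>A. x A ^ p) (length l)"
    using CP_E[OF w'(1)] by blast
  have "- (frm x (length l) - frm (\<lambda>A. x A ^ p) (length l)) \<in> Exf (length l)"
    using Exf_minus[OF w'(2)] unfolding u x(2,3) .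
  then have "frm (\<lambda>A. x A ^ p - x A) (length l) \<in> Exf (length l)" by (simp add: frm_diff)
  then show ?thesis unfolding NU_def using x by blast
qed

text \<open>Descent on a bound \<open>R\<close> for the codes of nonzero coefficients.
  \<open>P\<close> stands for the annihilator condition and \<open>H\<close> for the asserted group.
  The part subtracted lies in \<open>H\<close>, hence satisfies \<open>P\<close>, so the remainder
  keeps \<open>P\<close> while its leading term is gone.\<close>

lemma kato_induction:
  assumes pm1: "\<forall>y::'a. \<exists>x. y = x ^ (p - 1)"
    and H0: "0 \<in> H" and Hadd: "\<And>\<omega> \<eta>. \<omega> \<in> H \<Longrightarrow> \<eta> \<in> H \<Longrightarrow> \<omega> + \<eta> \<in> H"
    and HP: "\<And>\<omega>. \<omega> \<in> H \<Longrightarrow> P \<omega>" and Pdiff: "\<And>\<omega> \<eta>. P \<omega> \<Longrightarrow> P \<eta> \<Longrightarrow> P (\<omega> - \<eta>)"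
    and step: "\<And>x \<alpha> c. P (frm x n) \<Longrightarrow> \<alpha> \<in> Sub n \<Longrightarrow> x \<alpha> \<noteq> 0 \<Longrightarrow>
       (\<And>i. i \<in> \<alpha> \<Longrightarrow> c i \<in> G (Suc i) \<and> c i \<noteq> 0) \<Longrightarrow> L (map c (sorted_list_of_set \<alpha>)) \<in> H"
    and \<omega>: "NU n \<omega>" "P \<omega>"
  shows "\<omega> \<in> H"
proof -
  have "frm x n \<in> H" if "\<And>A. x A \<in> G N" "frm (\<lambda>A. x A ^ p - x A) n \<in> Exf n" "P (frm x n)"
    "\<And>A. A \<in> Sub n \<Longrightarrow> R \<le> set_encode A \<Longrightarrow> x A = 0" for R x
    using that
  proof (induction R arbitrary: x)
    case 0
    then have "frm x n = frm (\<lambda>_. 0) n" by (intro frm_cong) auto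
    then show ?case using H0 by simp
  next
    case (Suc R)
    show ?case
    proof (cases "\<exists>\<alpha>\<in>Sub n. set_encode \<alpha> = R \<and> x \<alpha> \<noteq> 0")
      case False
      then have "x A = 0" if "A \<in> Sub n" "R \<le> set_encode A" for A
        using Suc.prems(4)[OF that(1)] that by (cases "set_encode A = R") auto
      then show ?thesis using Suc.IH Suc.prems(1-3) by blast
    next
      case True
      then obtain \<alpha> where \<alpha>: "\<alpha> \<in> Sub n" "set_encode \<alpha> = R" "x \<alpha> \<noteq> 0" by blast
      have top: "x A = 0" if "A \<in> Sub n" "set_encode \<alpha> < set_encode A" for A
        using Suc.prems(4)[OF that(1)] that(2) \<alpha>(2) by simp
      obtain u c where uc: "\<And>i. i \<in> \<alpha> \<Longrightarrow> c i \<in> G (Suc i) \<and> c i \<noteq> 0"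
        "x \<alpha> = of_nat u * (\<Prod>i\<in>\<alpha>. inverse (c i) * \<theta> i (c i))"
        using kato_leading[OF pm1 Suc.prems(1,2) \<alpha>(1,3) top] by blast
      define l where "l = map c (sorted_list_of_set \<alpha>)"
      have fin: "finite \<alpha>" and \<alpha>N: "\<alpha> \<subseteq> {..<N}" and card: "card \<alpha> = n" using SubD[OF \<alpha>(1)] by auto
      have len: "length l = n" using card by (simp add: l_def)
      have cN: "c i \<in> G N \<and> c i \<noteq> 0" if "i \<in> \<alpha>" for i
      proof -
        have "Suc i \<le> N" using \<alpha>N that by auto
        then show ?thesis using uc(1)[OF that] G_mono[of "Suc i" N] by auto
      qed
      have lH: "L l \<in> H" unfolding l_def using step[OF Suc.prems(3) \<alpha>(1,3) uc(1)] by blast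
      \<comment> \<open>Closure of \<open>H\<close> under addition suffices, because the integer
        factor is represented by a natural number.\<close>
      have uH: "sc (of_nat m) * L l \<in> H" for m
        by (induction m) (simp_all add: H0 sc_add distrib_right Hadd lH)
      have "NU n (sc (of_nat u) * L l)"
      proof -
        have "set l \<subseteq> G N" "0 \<notin> set l" using cN fin by (auto simp: l_def)
        from NU_log[OF this, of u] show ?thesis unfolding len .
      qed
      moreover have "NU n (frm x n)" unfolding NU_def using Suc.prems(1,2) by blast
      ultimately have "NU n (frm x n - sc (of_nat u) * L l)" by (intro NU_diff)
      then obtain y where y: "\<And>A. y A \<in> G N" "frm x n - sc (of_nat u) * L l = frm y n"
        "frm (\<lambda>A. y A ^ p - y A) n \<in> Exf n" unfolding NU_def by blast
      obtain \<Lambda> where \<Lambda>: "\<Lambda> \<in> LC n R"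
        "L l = sc (\<Prod>i\<in>\<alpha>. inverse (c i) * \<theta> i (c i)) * w \<alpha> + \<Lambda>"
        using leading_log[OF fin \<alpha>N, of c] uc(1) card \<alpha>(2) unfolding l_def by auto
      obtain z where z: "\<Lambda> = frm z n" "\<And>A. A \<in> Sub n \<Longrightarrow> R \<le> set_encode A \<Longrightarrow> z A = 0"
        using \<Lambda>(1) unfolding LC_def by blast
      have "frm y n = frm (\<lambda>A. x A - ((if A = \<alpha> then x \<alpha> else 0) + of_nat u * z A)) n"
        unfolding y(2)[symmetric] \<Lambda>(2) z(1) frm_diff frm_add frm_sc frm_single[OF \<alpha>(1)] uc(2)
        by (simp add: sc_mult distrib_left mult.assoc)
      from frm_unique[OF this] have yv: "y A = x A - ((if A = \<alpha> then x \<alpha> else 0) + of_nat u * z A)"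
        if "A \<in> Sub n" for A using that .
      have "y A = 0" if A: "A \<in> Sub n" "R \<le> set_encode A" for A
      proof (cases "A = \<alpha>")
        case True then show ?thesis using yv[OF A(1)] z(2)[OF A] by simp
      next
        case False
        then have "set_encode A \<noteq> R"
          using set_encode_eq[OF SubD(1)[OF A(1)] fin] \<alpha>(2) by simp
        then show ?thesis using yv[OF A(1)] z(2)[OF A] False Suc.prems(4)[OF A(1)] A(2) by simp
      qed
      moreover have "P (frm y n)" unfolding y(2)[symmetric] using Suc.prems(3) HP[OF uH] by (rule Pdiff)
      ultimately have "frm y n \<in> H" using Suc.IH[OF y(1,3)] by blast
      then have "frm y n + sc (of_nat u) * L l \<in> H" using uH by (intro Hadd)
      then show ?thesis unfolding y(2)[symmetric] by simp
    qed
  qed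
  note main = this
  obtain x where x: "\<And>A. x A \<in> G N" "\<omega> = frm x n" "frm (\<lambda>A. x A ^ p - x A) n \<in> Exf n"
    using \<omega>(1) unfolding NU_def by blast
  define R where "R = Suc (\<Sum>A\<in>Sub n. set_encode A)"
  have "set_encode A < R" if "A \<in> Sub n" for A
    using member_le_sum[OF that, of set_encode] unfolding R_def by (simp add: less_Suc_eq_le)
  then have "x A = 0" if "A \<in> Sub n" "R \<le> set_encode A" for A using that by (meson not_le)
  then show ?thesis using main[OF x(1,3)] \<omega>(2) unfolding x(2) by blast
qed

end

lemma L_eq: "L l = sc (1 / prod_list l) * W l"
proof (induction l)
  case (Cons a l)
  have "L (a # l) = sc (inverse a) * (sc (1 / prod_list l) * (D a * W l))"
    by (simp only: L_simps Cons dlog_def mult.assoc sc_left_commute[of "D a"])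
  also have "\<dots> = sc (1 / prod_list (a # l)) * W (a # l)"
    by (simp add: mult.assoc[symmetric] sc_mult[symmetric] divide_inverse)
  finally show ?case .
qed simp

subsection \<open>Additive subgroups\<close>

inductive_set agen :: "'b::ab_group_add set \<Rightarrow> 'b set" for X where
  zero: "0 \<in> agen X"
| base: "x \<in> X \<Longrightarrow> x \<in> agen X"
| add: "x \<in> agen X \<Longrightarrow> y \<in> agen X \<Longrightarrow> x + y \<in> agen X"
| neg: "x \<in> agen X \<Longrightarrow> - x \<in> agen X"

lemma agen_mult:
  fixes A B :: "'b::ring_1 set"
  assumes "u \<in> agen A" "v \<in> agen B"
  shows "u * v \<in> agen {a * b | a b. a \<in> A \<and> b \<in> B}" (is "_ \<in> agen ?C")
  using assms(1)
proof induction
  case (base a)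
  from assms(2) show ?case
  proof induction
    case (base b) then show ?case using \<open>a \<in> A\<close> by (auto intro: agen.base)
  qed (auto simp: distrib_left intro: agen.intros)
qed (auto simp: distrib_right intro: agen.intros)

lemma agen_mono: "A \<subseteq> agen B \<Longrightarrow> agen A \<subseteq> agen B"
proof
  fix x assume "A \<subseteq> agen B" "x \<in> agen A"
  from this(2) show "x \<in> agen B"
    by induction (use \<open>A \<subseteq> agen B\<close> in \<open>auto intro: agen.intros\<close>)
qed

lemma agen_products:
  fixes A B :: "'b::ring_1 set"
  shows "agen {u * v | u v. u \<in> agen A \<and> v \<in> agen B} = agen {a * b | a b. a \<in> A \<and> b \<in> B}"
proof
  show "agen {u * v | u v. u \<in> agen A \<and> v \<in> agen B} \<subseteq> agen {a * b | a b. a \<in> A \<and> b \<in> B}"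
    using agen_mult by (intro agen_mono) blast
  show "agen {a * b | a b. a \<in> A \<and> b \<in> B} \<subseteq> agen {u * v | u v. u \<in> agen A \<and> v \<in> agen B}"
    by (intro agen_mono) (blast intro: agen.base)
qed

lemma agen_le:
  assumes "0 \<in> K" "\<And>x y. x \<in> K \<Longrightarrow> y \<in> K \<Longrightarrow> x + y \<in> K" "\<And>x. x \<in> K \<Longrightarrow> - x \<in> K" "X \<subseteq> K"
  shows "agen X \<subseteq> K"
proof
  fix x assume "x \<in> agen X"
  then show "x \<in> K" by induction (use assms in auto)
qed

subsection \<open>Classes as elements of the exterior algebra\<close>

lemma Rep_0: "Rep_ext 0 = zeroC"
  by (simp add: zero_ext_def Rep_mk FS_zero zeroC_def)

lemma Rep_add: "Rep_ext (x + y) = addC (Rep_ext x) (Rep_ext y)"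
proof -
  obtain c c' where "c \<in> FS" "x = mk c" "c' \<in> FS" "y = mk c'" by (metis ext_cases)
  then show ?thesis by (simp add: mk_add Rep_mk FS_add addC_cls)
qed

lemma Rep_neg: "Rep_ext (- x) = negC (Rep_ext x)"
proof -
  obtain c where "c \<in> FS" "x = mk c" by (metis ext_cases)
  then show ?thesis by (simp add: mk_uminus Rep_mk FS_neg negC_cls)
qed

lemma Rep_mult: "Rep_ext (x * y) = wedgeC (Rep_ext x) (Rep_ext y)"
proof -
  obtain c c' where "c \<in> FS" "x = mk c" "c' \<in> FS" "y = mk c'" by (metis ext_cases)
  then show ?thesis by (simp add: mk_mult Rep_mk FS_fmult wedgeC_cls)
qed

lemma Rep_W: "Rep_ext (W l) = cls (dl l)"
  by (metis FS_dl Rep_mk mk_dl)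

lemma Rep_L: "Rep_ext (L l) = dlogC l"
proof -
  have "L l = mk (\<lambda>m. 1 / prod_list l * dl l m)" by (simp only: L_eq mk_smult[OF FS_dl] mk_dl)
  then show ?thesis by (simp only: Rep_mk[OF FS_smult[OF FS_dl]] dlogC_def)
qed

lemma addgen_Rep: "addgen (Rep_ext ` X) = Rep_ext ` agen X"
proof
  show "addgen (Rep_ext ` X) \<subseteq> Rep_ext ` agen X"
  proof
    fix g assume "g \<in> addgen (Rep_ext ` X)"
    then show "g \<in> Rep_ext ` agen X"
    proof induction
      case zero then show ?case using agen.zero by (force simp: Rep_0[symmetric])
    next
      case (base g) then show ?case by (auto intro: agen.base)
    next
      case (add x y) then show ?case by (auto simp: Rep_add[symmetric] intro: agen.add)
    next
      case (neg x) then show ?case by (auto simp: Rep_neg[symmetric] intro: agen.neg)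
    qed
  qed
  show "Rep_ext ` agen X \<subseteq> addgen (Rep_ext ` X)"
  proof clarify
    fix x assume "x \<in> agen X"
    then show "Rep_ext x \<in> addgen (Rep_ext ` X)"
      by induction (auto simp: Rep_0 Rep_add Rep_neg intro: addgen.intros)
  qed
qed

lemma wedgeS_Rep: "wedgeS (Rep_ext ` X) (Rep_ext ` Y) = Rep_ext ` agen {x * y | x y. x \<in> X \<and> y \<in> Y}"
proof -
  have "{wedgeC x y | x y. x \<in> Rep_ext ` X \<and> y \<in> Rep_ext ` Y} = Rep_ext ` {x * y | x y. x \<in> X \<and> y \<in> Y}"
  proof (intro equalityI subsetI)
    fix z assume "z \<in> {wedgeC x y | x y. x \<in> Rep_ext ` X \<and> y \<in> Rep_ext ` Y}"
    then obtain x y where "z = Rep_ext (x * y)" "x \<in> X" "y \<in> Y" by (auto simp: Rep_mult)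
    then show "z \<in> Rep_ext ` {x * y | x y. x \<in> X \<and> y \<in> Y}" by blast
  next
    fix z assume "z \<in> Rep_ext ` {x * y | x y. x \<in> X \<and> y \<in> Y}"
    then obtain x y where "z = wedgeC (Rep_ext x) (Rep_ext y)" "x \<in> X" "y \<in> Y" by (auto simp: Rep_mult)
    then show "z \<in> {wedgeC x y | x y. x \<in> Rep_ext ` X \<and> y \<in> Rep_ext ` Y}" by blast
  qed
  then show ?thesis by (simp add: wedgeS_def addgen_Rep)
qed

lemma sumS_Rep: "sumS (Rep_ext ` X) (Rep_ext ` Y) = Rep_ext ` {x + y | x y. x \<in> X \<and> y \<in> Y}"
proof (intro equalityI subsetI)
  fix z assume "z \<in> sumS (Rep_ext ` X) (Rep_ext ` Y)"
  then obtain x y where "z = Rep_ext (x + y)" "x \<in> X" "y \<in> Y" by (auto simp: sumS_def Rep_add)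
  then show "z \<in> Rep_ext ` {x + y | x y. x \<in> X \<and> y \<in> Y}" by blast
next
  fix z assume "z \<in> Rep_ext ` {x + y | x y. x \<in> X \<and> y \<in> Y}"
  then obtain x y where "z = addC (Rep_ext x) (Rep_ext y)" "x \<in> X" "y \<in> Y" by (auto simp: Rep_add)
  then show "z \<in> sumS (Rep_ext ` X) (Rep_ext ` Y)" unfolding sumS_def by blast
qed

lemma dlogC_set: "{dlogC l | l. Q l} = Rep_ext ` {L l | l. Q l}"
  by (auto simp: Rep_L[symmetric])

text \<open>Different words \<open>l\<close> give different words \<open>c l # l\<close>, so the
  zero-one function \<open>dfs c\<close> is the sum of the \<open>dl (c l # l)\<close> over the
  support of \<open>c\<close>.\<close>

lemma dfs_eq:
  assumes "c \<in> FS"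
  shows "dfs c \<in> FS" "mk (dfs c) = (\<Sum>l | c l \<noteq> 0. D (c l) * W l)"
proof -
  have fin: "finite {l. c l \<noteq> 0}" using assms by (simp add: FS_def)
  have e: "dfs c = (\<lambda>m. \<Sum>l | c l \<noteq> 0. dl (c l # l) m)"
  proof
    fix m show "dfs c m = (\<Sum>l | c l \<noteq> 0. dl (c l # l) m)"
    proof (cases m)
      case (Cons a l)
      have "(\<Sum>k | c k \<noteq> 0. dl (c k # k) m) = (\<Sum>k | c k \<noteq> 0. if k = l then (if c l = a then 1 else 0) else 0)"
        unfolding Cons dl_def by (intro sum.cong) auto
      then show ?thesis using fin by (auto simp: dfs_def Cons)
    qed (simp add: dfs_def dl_def)
  qed
  have "(\<lambda>m. \<Sum>l\<in>A. dl (c l # l) m) \<in> FS \<and> mk (\<lambda>m. \<Sum>l\<in>A. dl (c l # l) m) = (\<Sum>l\<in>A. D (c l) * W l)"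
    if "finite A" for A
    using that
  proof (induction A)
    case empty then show ?case by (simp add: FS_zero zero_ext_def)
  next
    case (insert k A) then show ?case by (simp add: FS_add FS_dl mk_add[symmetric] mk_dl)
  qed
  from this[OF fin] show "dfs c \<in> FS" "mk (dfs c) = (\<Sum>l | c l \<noteq> 0. D (c l) * W l)"
    unfolding e by auto
qed

lemma lfs_eq: "lfs reps \<in> FS \<and> mk (lfs reps) = (\<Sum>(x, as)\<leftarrow>reps. sc x * L as)"
proof (induction reps)
  case Nil then show ?case by (simp add: lfs_def FS_zero zero_ext_def)
next
  case (Cons r reps)
  obtain x as where r: "r = (x, as)" by fastforce
  define q where "q = x / prod_list as"
  have e: "lfs (r # reps) = (\<lambda>m. q * dl as m + lfs reps m)" by (simp add: lfs_def r q_def)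
  have "mk (\<lambda>m. q * dl as m) = sc q * W as" by (simp only: mk_smult[OF FS_dl] mk_dl)
  also have "\<dots> = sc x * L as" unfolding L_eq mult.assoc[symmetric] sc_mult[symmetric] by (simp add: q_def)
  finally show ?case
    unfolding e using Cons FS_smult[OF FS_dl, of q as] by (simp add: r FS_add mk_add[symmetric])
qed

definition homog :: "nat \<Rightarrow> 'a::field fsum set" where
  "homog n = {c \<in> FS. \<forall>l. c l \<noteq> 0 \<longrightarrow> length l = n}"

lemma homog_lfs: "\<forall>(x, as)\<in>set reps. length as = n \<Longrightarrow> lfs reps \<in> homog n"
proof (induction reps)
  case Nil then show ?case by (simp add: homog_def lfs_def FS_zero)
next
  case (Cons r reps)
  then have IH: "lfs reps \<in> homog n" by simp
  have e: "lfs (r # reps) m = fst r / prod_list (snd r) * dl (snd r) m + lfs reps m" for m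
    by (simp add: lfs_def case_prod_beta)
  have "length m = n" if "lfs (r # reps) m \<noteq> 0" for m
    using that IH Cons.prems unfolding e by (cases "m = snd r") (auto simp: homog_def dl_def)
  then show ?case using lfs_eq by (auto simp: homog_def)
qed

text \<open>\<open>nu\<close> transported to the type \<open>ext\<close>: \<open>reps\<close> is the
  logarithmic representation and \<open>c\<close> a formal primitive of its image under wp.\<close>

definition nue :: "nat \<Rightarrow> nat \<Rightarrow> 'a::field ext set" where
  "nue p n = {\<omega>. \<exists>reps c. (\<forall>(x, as)\<in>set reps. length as = n \<and> 0 \<notin> set as)
     \<and> \<omega> = (\<Sum>(x, as)\<leftarrow>reps. sc x * L as) \<and> c \<in> FS \<and> (\<forall>l. c l \<noteq> 0 \<longrightarrow> Suc (length l) = n)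
     \<and> (\<Sum>(x, as)\<leftarrow>reps. sc (x ^ p - x) * L as) = (\<Sum>l | c l \<noteq> 0. D (c l) * W l)}"

lemma sum_list_map_reps:
  "(\<Sum>(x, as)\<leftarrow>map (\<lambda>(x, as). (f x, as)) reps. g x as) = (\<Sum>(x, as)\<leftarrow>reps. g (f x) as)"
  by (induction reps) auto

lemma nu_Rep: "(nu p n :: 'a::field fsum set set) = Rep_ext ` nue p n"
proof
  show "(nu p n :: 'a fsum set set) \<subseteq> Rep_ext ` nue p n"
  proof
    fix \<omega> :: "'a fsum set" assume "\<omega> \<in> nu p n"
    then obtain reps c where reps: "\<forall>(x, as)\<in>set reps. length as = n \<and> 0 \<notin> set as" "\<omega> = cls (lfs reps)"
      and c: "cls (lfs (map (\<lambda>(x, as). (x ^ p - x, as)) reps)) = cls (dfs c)" "c \<in> FS"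
        "\<forall>l. c l \<noteq> 0 \<longrightarrow> Suc (length l) = n"
      unfolding nu_def dOmega_def by blast
    have "mk (lfs (map (\<lambda>(x, as). (x ^ p - x, as)) reps)) = mk (dfs c)" using c(1) by (simp add: mk_def)
    then have "(\<Sum>(x, as)\<leftarrow>reps. sc (x ^ p - x) * L as) = (\<Sum>l | c l \<noteq> 0. D (c l) * W l)"
      using lfs_eq[of "map (\<lambda>(x, as). (x ^ p - x, as)) reps"] dfs_eq[OF c(2)] by (simp add: sum_list_map_reps del: map_map)
    then have "(\<Sum>(x, as)\<leftarrow>reps. sc x * L as) \<in> nue p n" unfolding nue_def using reps(1) c(2,3) by blast
    moreover have "\<omega> = Rep_ext (\<Sum>(x, as)\<leftarrow>reps. sc x * L as)"
      using Rep_mk[OF conjunct1[OF lfs_eq[of reps]]] lfs_eq[of reps] reps(2) by simp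
    ultimately show "\<omega> \<in> Rep_ext ` nue p n" by blast
  qed
  show "Rep_ext ` nue p n \<subseteq> (nu p n :: 'a fsum set set)"
  proof clarify
    fix \<omega> :: "'a ext" assume "\<omega> \<in> nue p n"
    then obtain reps c where r: "\<forall>(x, as)\<in>set reps. length as = n \<and> 0 \<notin> set as"
      "\<omega> = (\<Sum>(x, as)\<leftarrow>reps. sc x * L as)" and c: "c \<in> FS" "\<forall>l. c l \<noteq> 0 \<longrightarrow> Suc (length l) = n"
      "(\<Sum>(x, as)\<leftarrow>reps. sc (x ^ p - x) * L as) = (\<Sum>l | c l \<noteq> 0. D (c l) * W l)"
      unfolding nue_def by blast
    have 1: "Rep_ext \<omega> = cls (lfs reps)" using Rep_mk[OF conjunct1[OF lfs_eq[of reps]]] lfs_eq[of reps] r(2) by simp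
    have "lfs reps \<in> homog n" using r(1) by (intro homog_lfs) auto
    then have 2: "Rep_ext \<omega> \<in> Omega n" unfolding 1 Omega_def homog_def by blast
    let ?r = "map (\<lambda>(x, as). (x ^ p - x, as)) reps"
    have "mk (lfs ?r) = mk (dfs c)"
      using lfs_eq[of ?r] dfs_eq[OF c(1)] c(3) by (simp add: sum_list_map_reps del: map_map)
    then have "Rep_ext (mk (lfs ?r)) = Rep_ext (mk (dfs c))" by (rule arg_cong)
    then have "cls (lfs ?r) = cls (dfs c)"
      unfolding Rep_mk[OF conjunct1[OF lfs_eq]] Rep_mk[OF dfs_eq(1)[OF c(1)]] .
    then have "cls (lfs ?r) \<in> dOmega n" unfolding dOmega_def using c(1,2) by blast
    then show "Rep_ext \<omega> \<in> nu p n" unfolding nu_def using 1 2 r(1) by blast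
  qed
qed

lemma annnu_Rep:
  fixes S :: "nat \<Rightarrow> 'a::field set"
  shows "annnu p n (dwedge k S) = Rep_ext ` {\<omega> \<in> nue p n. \<forall>s. length s = k \<and> (\<forall>i<k. s ! i \<in> S (Suc i)) \<longrightarrow> \<omega> * W s = 0}"
proof -
  have z: "wedgeC (Rep_ext \<omega>) (cls (dl s)) = zeroC \<longleftrightarrow> \<omega> * W s = 0" for \<omega> :: "'a ext" and s
    unfolding Rep_W[symmetric] Rep_mult[symmetric] Rep_0[symmetric] by (rule Rep_ext_inject)
  have sub: "nu p n \<subseteq> (Omega n :: 'a fsum set set)" unfolding nu_def by blast
  have d: "(\<forall>u\<in>dwedge k S. wedgeC (Rep_ext \<omega>) u = zeroC)
      \<longleftrightarrow> (\<forall>s. length s = k \<and> (\<forall>i<k. s ! i \<in> S (Suc i)) \<longrightarrow> \<omega> * W s = 0)" for \<omega> :: "'a ext"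
    unfolding z[symmetric] dwedge_def by blast
  have "annnu p n (dwedge k S) = {\<eta> \<in> Rep_ext ` nue p n. \<forall>u\<in>dwedge k S. wedgeC \<eta> u = zeroC}"
    unfolding annnu_def nu_Rep[symmetric] using sub by (intro set_eqI) auto
  also have "\<dots> = Rep_ext ` {\<omega> \<in> nue p n. \<forall>u\<in>dwedge k S. wedgeC (Rep_ext \<omega>) u = zeroC}" by blast
  finally show ?thesis unfolding d .
qed

definition LOG :: "nat \<Rightarrow> 'a::field ext set" where
  "LOG n = {L l | l. length l = n \<and> 0 \<notin> set l}"

text \<open>Built from logarithmic generators, which the products in the theorem require;
  \<open>nu_int_Rep\<close> identifies it with \<open>nu_int\<close>.\<close>

definition nui :: "int \<Rightarrow> 'a::field ext set" where
  "nui m = (if m < 0 then {0} else agen (LOG (nat m)))"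

context char_p
begin

lemma nue_add:
  assumes "\<omega> \<in> nue p n" "\<eta> \<in> nue p n" shows "\<omega> + (\<eta>::'a ext) \<in> nue p n"
proof -
  obtain r c where r: "\<forall>(x, as)\<in>set r. length as = n \<and> 0 \<notin> set as"
    "\<omega> = (\<Sum>(x, as)\<leftarrow>r. sc x * L as)" "c \<in> FS" "\<forall>l. c l \<noteq> 0 \<longrightarrow> Suc (length l) = n"
    "(\<Sum>(x, as)\<leftarrow>r. sc (x ^ p - x) * L as) = ev (\<lambda>x l. D x * W l) c"
    using assms(1) unfolding nue_def ev_def by blast
  obtain r' c' where r': "\<forall>(x, as)\<in>set r'. length as = n \<and> 0 \<notin> set as"
    "\<eta> = (\<Sum>(x, as)\<leftarrow>r'. sc x * L as)" "c' \<in> FS" "\<forall>l. c' l \<noteq> 0 \<longrightarrow> Suc (length l) = n"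
    "(\<Sum>(x, as)\<leftarrow>r'. sc (x ^ p - x) * L as) = ev (\<lambda>x l. D x * W l) c'"
    using assms(2) unfolding nue_def ev_def by blast
  have "(\<Sum>(x, as)\<leftarrow>r @ r'. sc (x ^ p - x) * L as) = (\<Sum>l | c l + c' l \<noteq> 0. D (c l + c' l) * W l)"
    using r(5) r'(5) ev_add[OF additive1_d r(3) r'(3)] by (simp add: ev_def)
  moreover have "\<forall>l. c l + c' l \<noteq> 0 \<longrightarrow> Suc (length l) = n" using r(4) r'(4) by (metis add_0)
  ultimately show ?thesis unfolding nue_def using r(1,2,3) r'(1,2,3)
    by (auto intro!: exI[of _ "r @ r'"] exI[of _ "\<lambda>m. c m + c' m"] FS_add)
qed

lemma nue_log:
  assumes "length l = n" "0 \<notin> set (l::'a list)" shows "sc (of_nat u) * L l \<in> nue p n"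
  unfolding nue_def mem_Collect_eq
  using assms FS_zero by (intro exI[of _ "[(of_nat u, l)]"] exI[of _ "\<lambda>_. 0"]) (simp add: of_nat_power_p)

lemma nue_0: "(0::'a ext) \<in> nue p n"
  unfolding nue_def mem_Collect_eq using FS_zero
  by (intro exI[of _ "[]"] exI[of _ "\<lambda>_. 0"]) simp

lemma sc_of_nat_pred: "sc (of_nat (p - 1) :: 'a) = -1"
proof -
  have "(of_nat (p - 1) :: 'a) = - 1" using char_p p_gt_1 by (simp add: of_nat_diff)
  then show ?thesis by (simp add: sc_minus)
qed

text \<open>Negation is multiplication by \<open>p - 1\<close>, so \<open>nue_log\<close> covers
  negatives as well.\<close>

lemma agen_LOG_uminus: "\<omega> \<in> agen (LOG n) \<Longrightarrow> \<omega> \<in> nue p n \<and> - (\<omega>::'a ext) \<in> nue p n"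
proof (induction rule: agen.induct)
  case zero then show ?case using nue_0 by simp
next
  case (base x)
  then obtain l where "x = L l" "length l = n" "0 \<notin> set l" by (auto simp: LOG_def)
  then show ?case using nue_log[of l n 1] nue_log[of l n "p - 1"] sc_of_nat_pred by simp
next
  case (add x y)
  then have "- x + - y \<in> nue p n" using nue_add by blast
  then show ?case using add nue_add by (simp add: add.commute)
qed simp

text \<open>An element not yet generated is appended at the end, so the given ones keep the first
  places. By \<open>exchange\<close>, an old element generated with its help would force the new one
  into the old field.\<close>

lemma extend_p_independent:
  fixes b0 :: "nat \<Rightarrow> 'a"
  assumes "\<forall>j<k. b0 j \<notin> Fpadj p (b0 ` ({..<k} - {j}))" "finite Z"
  shows "\<exists>N b. k \<le> N \<and> (\<forall>j<k. b j = b0 j) \<and> (\<forall>j<N. b j \<notin> Fpadj p (b ` ({..<N} - {j})))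
     \<and> Z \<subseteq> Fpadj p (b ` {..<N})"
  using assms(2)
proof (induction Z)
  case empty then show ?case using assms(1) by (intro exI[of _ k] exI[of _ b0]) auto
next
  case (insert z Z)
  then obtain N b where N: "k \<le> N" "\<forall>j<k. b j = b0 j" "\<forall>j<N. b j \<notin> Fpadj p (b ` ({..<N} - {j}))"
    "Z \<subseteq> Fpadj p (b ` {..<N})" by blast
  show ?case
  proof (cases "z \<in> Fpadj p (b ` {..<N})")
    case True then show ?thesis using N by blast
  next
    case False
    let ?b = "b(N := z)"
    have im: "?b ` {..<Suc N} = insert z (b ` {..<N})" by (auto simp: lessThan_Suc)
    have "?b j \<notin> Fpadj p (?b ` ({..<Suc N} - {j}))" if j: "j < Suc N" for j
    proof (cases "j = N")
      case True
      then have "?b ` ({..<Suc N} - {j}) = b ` {..<N}" by (auto simp: lessThan_Suc)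
      then show ?thesis using False True by simp
    next
      case F: False
      then have jN: "j < N" using j by simp
      let ?M = "Fpadj p (b ` ({..<N} - {j}))"
      have e: "?b ` ({..<Suc N} - {j}) = insert z (b ` ({..<N} - {j}))" using F jN by (auto simp: lessThan_Suc)
      have f: "insert (b j) (b ` ({..<N} - {j})) = b ` {..<N}" using jN by auto
      show ?thesis
      proof
        assume "?b j \<in> Fpadj p (?b ` ({..<Suc N} - {j}))"
        then have "b j \<in> adj ?M z" unfolding e Fpadj_insert using F by simp
        moreover have "b j \<notin> ?M" using N(3) jN by blast
        ultimately have "z \<in> adj ?M (b j)"
          using exchange[OF subfield_Fpadj Fpow_subset_Fpadj] by blast
        then show False using False unfolding Fpadj_insert[symmetric] f by simp
      qed
    qed
    moreover have "insert z Z \<subseteq> Fpadj p (?b ` {..<Suc N})"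
      unfolding im using N(4) Fpadj_mono[of "b ` {..<N}" "insert z (b ` {..<N})" p]
        subset_Fpadj[of "insert z (b ` {..<N})" p] by auto
    ultimately show ?thesis using N(1,2) by (intro exI[of _ "Suc N"] exI[of _ ?b]) auto
  qed
qed

lemma exists_frame:
  fixes b :: "nat \<Rightarrow> 'a"
  assumes "\<forall>j<N. b j \<notin> Fpadj p (b ` ({..<N} - {j}))"
  obtains \<theta> where "pframe p N b \<theta>"
proof -
  define Q where "Q j th \<longleftrightarrow> derivation th \<and> (\<forall>x\<in>Fpadj p (b ` ({..<N} - {j})). th x = 0) \<and> th (b j) = b j"
    for j th
  define \<theta> where "\<theta> j = (SOME th. Q j th)" for j
  have Q: "Q j (\<theta> j)" if "j < N" for j
  proof -
    have "b j \<notin> Fpadj p (b ` ({..<N} - {j}))" using assms that by blast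
    from exists_derivation[OF subfield_Fpadj Fpow_subset_Fpadj this] obtain th where
      "derivation th" "\<And>x. x \<in> Fpadj p (b ` ({..<N} - {j})) \<Longrightarrow> th x = 0" "th (b j) = b j" by blast
    then have "\<exists>th. Q j th" unfolding Q_def by blast
    then show ?thesis unfolding \<theta>_def by (rule someI_ex)
  qed
  have "pframe p N b \<theta>"
    by unfold_locales (use assms Q in \<open>auto simp: Q_def\<close>)
  then show ?thesis by (rule that)
qed

end

context pframe
begin

text \<open>Passes from representations to coordinates: by \<open>log_cartier\<close> the two images
  under wp differ by an exact form, so exactness of one gives exactness of the other.\<close>

lemma NU_of_reps:
  assumes reps: "\<forall>(x, as)\<in>set reps. length as = n \<and> 0 \<notin> set as \<and> x \<in> G N \<and> set as \<subseteq> G N"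
    and ex: "(\<Sum>(x, as)\<leftarrow>reps. sc (x ^ p - x) * L as) \<in> Exf n"
  shows "NU n (\<Sum>(x, as)\<leftarrow>reps. sc x * L as)"
proof -
  have "\<exists>\<omega>'. ((\<Sum>(x, as)\<leftarrow>reps. sc x * L as), \<omega>') \<in> CP n \<and> (\<Sum>(x, as)\<leftarrow>reps. sc (x ^ p) * L as) - \<omega>' \<in> Exf n"
    using reps
  proof (induction reps)
    case Nil then show ?case using CP_0 by (intro exI[of _ 0]) simp
  next
    case (Cons r reps)
    obtain x as where r: "r = (x, as)" by fastforce
    obtain \<omega>' where 1: "((\<Sum>(x, as)\<leftarrow>reps. sc x * L as), \<omega>') \<in> CP n" "(\<Sum>(x, as)\<leftarrow>reps. sc (x ^ p) * L as) - \<omega>' \<in> Exf n"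
      using Cons by auto
    obtain \<eta>' where 2: "(sc x * L as, \<eta>') \<in> CP n" "sc (x ^ p) * L as - \<eta>' \<in> Exf n"
      using log_cartier[of x as] Cons.prems r by auto
    show ?case using CP_add[OF 2(1) 1(1)] Exf_add[OF 2(2) 1(2)]
      by (intro exI[of _ "\<eta>' + \<omega>'"]) (simp add: r algebra_simps)
  qed
  then obtain \<omega>' where w: "((\<Sum>(x, as)\<leftarrow>reps. sc x * L as), \<omega>') \<in> CP n" "(\<Sum>(x, as)\<leftarrow>reps. sc (x ^ p) * L as) - \<omega>' \<in> Exf n"
    by blast
  obtain x where x: "\<And>A. x A \<in> G N" "(\<Sum>(x, as)\<leftarrow>reps. sc x * L as) = frm x n" "\<omega>' = frm (\<lambda>A. x A ^ p) n"
    using CP_E[OF w(1)] by blast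
  have "(\<Sum>(x, as)\<leftarrow>reps. sc (x ^ p - x) * L as) = (\<Sum>(x, as)\<leftarrow>reps. sc (x ^ p) * L as) - (\<Sum>(x, as)\<leftarrow>reps. sc x * L as)"
    by (induction reps) (auto simp: sc_diff algebra_simps)
  then have "frm (\<lambda>A. x A ^ p - x A) n
      = (\<Sum>(x, as)\<leftarrow>reps. sc (x ^ p - x) * L as) - ((\<Sum>(x, as)\<leftarrow>reps. sc (x ^ p) * L as) - \<omega>')"
    using x(2,3) by (simp add: frm_diff)
  then have "frm (\<lambda>A. x A ^ p - x A) n \<in> Exf n" using Exf_diff[OF ex w(2)] by simp
  then show ?thesis unfolding NU_def x(2) using x(1) by blast
qed

end

text \<open>In increasing order the elements below \<open>q\<close> come first. This places the
  factors lying in a small subfield at the front of the logarithmic form.\<close>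

lemma split_sorted_list:
  assumes "finite \<alpha>" "t \<le> card (\<alpha> \<inter> {..<q})"
  obtains ys zs where "sorted_list_of_set \<alpha> = ys @ zs" "length ys = t" "\<forall>i\<in>set ys. i < (q::nat)"
proof -
  let ?l = "sorted_list_of_set \<alpha>"
  have len: "t \<le> length ?l" using assms card_mono[of \<alpha> "\<alpha> \<inter> {..<q}"] by simp
  have "?l ! i < q" if i: "i < t" for i
  proof (rule ccontr)
    assume ge: "\<not> ?l ! i < q"
    have "\<alpha> \<inter> {..<q} \<subseteq> set (take i ?l)"
    proof
      fix x assume x: "x \<in> \<alpha> \<inter> {..<q}"
      then have "x \<in> set ?l" using assms(1) by simp
      then obtain j where j: "j < length ?l" "?l ! j = x" by (auto simp: in_set_conv_nth)
      have "j < i"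
      proof (rule ccontr)
        assume "\<not> j < i"
        then have "?l ! i \<le> ?l ! j" using j(1) by (intro sorted_nth_mono) auto
        then show False using ge j(2) x by simp
      qed
      then have "take i ?l ! j \<in> set (take i ?l)" using j(1) by (intro nth_mem) auto
      then show "x \<in> set (take i ?l)" using j(2) \<open>j < i\<close> by simp
    qed
    then have "card (\<alpha> \<inter> {..<q}) \<le> card (set (take i ?l))" by (intro card_mono) auto
    also have "\<dots> \<le> length (take i ?l)" by (rule card_length)
    finally show False using assms(2) i by simp
  qed
  then have "\<forall>i\<in>set (take t ?l). i < q" using len by (auto simp: in_set_conv_nth)
  then show ?thesis using that[of "take t ?l" "drop t ?l"] len by simp
qed

context char_p
begin

text \<open>The annihilator condition enters only through products of differentials of the given
  \<open>p\<close>-independent elements: \<open>\<C>\<close> collects the corresponding index sets, and every leading index set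
  of an annihilated form has to meet each of them.\<close>

lemma annihilator_induction:
  fixes b0 :: "nat \<Rightarrow> 'a"
  assumes pm1: "\<forall>y::'a. \<exists>x. y = x ^ (p - 1)"
    and b0: "\<forall>j<k. b0 j \<notin> Fpadj p (b0 ` ({..<k} - {j}))"
    and H0: "0 \<in> H" and Hadd: "\<And>\<omega> \<eta>. \<omega> \<in> H \<Longrightarrow> \<eta> \<in> H \<Longrightarrow> \<omega> + \<eta> \<in> H"
    and HP: "\<And>\<omega>. \<omega> \<in> H \<Longrightarrow> P \<omega>" and Pdiff: "\<And>\<omega> \<eta>. P \<omega> \<Longrightarrow> P \<eta> \<Longrightarrow> P (\<omega> - \<eta>)"
    and obs: "\<And>\<omega> C. P \<omega> \<Longrightarrow> C \<in> \<C> \<Longrightarrow> \<omega> * W (map b0 (sorted_list_of_set C)) = 0"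
    and \<C>: "\<And>C. C \<in> \<C> \<Longrightarrow> C \<subseteq> {..<k}"
    and comb: "\<And>\<alpha>. finite \<alpha> \<Longrightarrow> \<forall>C\<in>\<C>. \<alpha> \<inter> C \<noteq> {} \<Longrightarrow> \<exists>t q. q \<le> k \<and> t \<le> card (\<alpha> \<inter> {..<q}) \<and>
       (\<forall>ys zs. length ys = t \<longrightarrow> t + length zs = n \<longrightarrow> set ys \<subseteq> Fpadj p (b0 ` {..<q}) \<longrightarrow> 0 \<notin> set ys
          \<longrightarrow> 0 \<notin> set zs \<longrightarrow> L ys * L zs \<in> H)"
    and \<omega>: "\<omega> \<in> nue p n" "P \<omega>"
  shows "\<omega> \<in> H"
proof -
  obtain reps c where reps: "\<forall>(x, as)\<in>set reps. length as = n \<and> 0 \<notin> set as"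
    "\<omega> = (\<Sum>(x, as)\<leftarrow>reps. sc x * L as)" and c: "c \<in> FS" "\<forall>l. c l \<noteq> 0 \<longrightarrow> Suc (length l) = n"
    "(\<Sum>(x, as)\<leftarrow>reps. sc (x ^ p - x) * L as) = (\<Sum>l | c l \<noteq> 0. D (c l) * W l)"
    using \<omega>(1) unfolding nue_def by blast
  define Z where "Z = (\<Union>(x, as)\<in>set reps. insert x (set as)) \<union> (\<Union>l\<in>{l. c l \<noteq> 0}. insert (c l) (set l))"
  have "finite Z" using c(1) by (auto simp: Z_def FS_def)
  from extend_p_independent[OF b0 this] obtain N b where N: "k \<le> N" "\<forall>j<k. b j = b0 j"
    "\<forall>j<N. b j \<notin> Fpadj p (b ` ({..<N} - {j}))" "Z \<subseteq> Fpadj p (b ` {..<N})" by blast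
  obtain \<theta> where "pframe p N b \<theta>" using exists_frame[OF N(3)] by blast
  then interpret pframe p ty N b \<theta> .
  have ZG: "Z \<subseteq> G N" using N(4) by (simp add: G_def)
  have "(\<Sum>l | c l \<noteq> 0. D (c l) * W l) \<in> Exf n"
  proof (rule Exf_sum)
    fix l assume "l \<in> {l. c l \<noteq> 0}"
    then have "insert (c l) (set l) \<subseteq> Z" "Suc (length l) = n" using c(2) unfolding Z_def by auto
    then show "D (c l) * W l \<in> Exf n" using Exf_D_W[of "c l" l] ZG by auto
  qed
  moreover have "\<forall>(x, as)\<in>set reps. length as = n \<and> 0 \<notin> set as \<and> x \<in> G N \<and> set as \<subseteq> G N"
  proof clarify
    fix x as assume m: "(x, as) \<in> set reps"
    then have "insert x (set as) \<subseteq> Z" unfolding Z_def by blast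
    then show "length as = n \<and> 0 \<notin> set as \<and> x \<in> G N \<and> set as \<subseteq> G N" using ZG reps(1) m by auto
  qed
  ultimately have NU: "NU n \<omega>" unfolding reps(2) using c(3) by (intro NU_of_reps) simp_all
  show ?thesis
  proof (rule kato_induction[OF pm1 H0 Hadd HP Pdiff _ NU \<omega>(2)])
    fix x \<alpha> cc assume Px: "P (frm x n)" and \<alpha>: "\<alpha> \<in> Sub n" "x \<alpha> \<noteq> 0"
      and cc: "\<And>i. i \<in> \<alpha> \<Longrightarrow> cc i \<in> G (Suc i) \<and> cc i \<noteq> 0"
    have fin: "finite \<alpha>" and card: "card \<alpha> = n" using SubD(1,3)[OF \<alpha>(1)] by auto
    \<comment> \<open>Up to a scalar \<open>w C\<close> is the product of the given differentials
      indexed by \<open>C\<close>, so it annihilates the form; if \<open>\<alpha>\<close> missed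
      \<open>C\<close>, its coefficient would vanish.\<close>
    have "\<forall>C\<in>\<C>. \<alpha> \<inter> C \<noteq> {}"
    proof (intro ballI notI)
      fix C assume C: "C \<in> \<C>" "\<alpha> \<inter> C = {}"
      have Ck: "C \<subseteq> {..<k}" using \<C>[OF C(1)] .
      then have finC: "finite C" using finite_subset by blast
      have "map b (sorted_list_of_set C) = map b0 (sorted_list_of_set C)"
        using Ck finC N(2) by (intro map_cong refl) auto
      moreover obtain s where "wl (sorted_list_of_set C) = sc s * W (map b (sorted_list_of_set C))"
        using wl_W by blast
      ultimately have "frm x n * w C = sc s * (frm x n * W (map b0 (sorted_list_of_set C)))"
        unfolding w_def by (simp only: sc_left_commute[of "frm x n"])
      then have "frm x n * w C = 0" using obs[OF Px C(1)] by simp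
      then have "x \<alpha> = 0" using Ck N(1) C(2) by (intro frm_mult_w_0[OF _ _ \<alpha>(1)]) auto
      then show False using \<alpha>(2) by simp
    qed
    from comb[OF fin this] obtain t q where tq: "q \<le> k" "t \<le> card (\<alpha> \<inter> {..<q})"
      "\<And>ys zs. length ys = t \<Longrightarrow> t + length zs = n \<Longrightarrow> set ys \<subseteq> Fpadj p (b0 ` {..<q}) \<Longrightarrow> 0 \<notin> set ys
          \<Longrightarrow> 0 \<notin> set zs \<Longrightarrow> L ys * L zs \<in> H" by blast
    obtain ys zs where yz: "sorted_list_of_set \<alpha> = ys @ zs" "length ys = t" "\<forall>i\<in>set ys. i < q"
      using split_sorted_list[OF fin tq(2)] by blast
    have set: "set ys \<union> set zs = \<alpha>" using fin yz(1) by (metis set_append set_sorted_list_of_set)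
    have "b0 ` {..<q} = b ` {..<q}" using N(2) tq(1) by (intro image_cong) auto
    then have Gq: "Fpadj p (b0 ` {..<q}) = G q" by (simp add: G_def)
    have "cc i \<in> G q" if "i \<in> set ys" for i
      using cc[of i] that set yz(3) G_mono[of "Suc i" q] by (auto simp: Suc_le_eq)
    moreover have "t + length zs = n" using yz(1,2) card by (metis length_append length_sorted_list_of_set)
    moreover have "0 \<notin> cc ` set ys" "0 \<notin> cc ` set zs" using cc set by force+
    ultimately have "L (map cc ys) * L (map cc zs) \<in> H" using yz(2) by (intro tq(3)) (auto simp: Gq)
    then show "L (map cc (sorted_list_of_set \<alpha>)) \<in> H" unfolding yz(1) by simp
  qed
qed

text \<open>The descent without annihilator condition: no sets \<open>C\<close>, and
  \<open>t = 0\<close>. It allows the factors \<open>nu\<close> on the right of the theorem to be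
  replaced by logarithmic generators.\<close>

lemma nue_generated:
  assumes pm1: "\<forall>y::'a. \<exists>x. y = x ^ (p - 1)"
  shows "(nue p n :: 'a ext set) = agen (LOG n)"
proof
  show "agen (LOG n) \<subseteq> (nue p n :: 'a ext set)" using agen_LOG_uminus by blast
  show "(nue p n :: 'a ext set) \<subseteq> agen (LOG n)"
  proof
    fix \<omega> :: "'a ext" assume \<omega>: "\<omega> \<in> nue p n"
    show "\<omega> \<in> agen (LOG n)"
    proof (rule annihilator_induction[OF pm1, where k = 0 and P = "\<lambda>_. True" and \<C> = "{}"])
      fix \<alpha> :: "nat set"
      have "L zs \<in> agen (LOG n)" if "length zs = n" "0 \<notin> set zs" for zs :: "'a list"
        unfolding LOG_def using that by (intro agen.base) blast
      then show "\<exists>t q. q \<le> 0 \<and> t \<le> card (\<alpha> \<inter> {..<q}) \<and>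
       (\<forall>ys zs. length ys = t \<longrightarrow> t + length zs = n \<longrightarrow> set ys \<subseteq> Fpadj p ((\<lambda>_. 0) ` {..<q}) \<longrightarrow> 0 \<notin> set ys
          \<longrightarrow> 0 \<notin> set zs \<longrightarrow> (L ys * L zs :: 'a ext) \<in> agen (LOG n))"
        by (intro exI[of _ 0]) auto
    qed (use \<omega> in \<open>auto intro: agen.intros\<close>)
  qed
qed

end

subsection \<open>Annihilators\<close>

definition LK :: "nat \<Rightarrow> 'a::field set \<Rightarrow> 'a ext set" where
  "LK t K = {L ys | ys. length ys = t \<and> (\<forall>y\<in>set ys. y \<in> K \<and> y \<noteq> 0)}"

definition GEN :: "nat \<Rightarrow> 'a::field set \<Rightarrow> nat \<Rightarrow> 'a ext set" where
  "GEN t K n = agen {x * y | x y. x \<in> agen (LK t K) \<and> y \<in> nui (int n - int t)}"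

lemma GEN_0: "0 \<in> GEN t K n" and GEN_add: "\<omega> \<in> GEN t K n \<Longrightarrow> \<eta> \<in> GEN t K n \<Longrightarrow> \<omega> + \<eta> \<in> GEN t K n"
  unfolding GEN_def by (auto intro: agen.intros)

lemma GEN_log:
  assumes "length ys = t" "t + length zs = n" "set ys \<subseteq> K" "0 \<notin> set ys" "0 \<notin> set zs"
  shows "L ys * L zs \<in> GEN t K n"
proof -
  have "L ys \<in> agen (LK t K)" unfolding LK_def using assms by (intro agen.base) blast
  moreover have "L zs \<in> agen (LOG (length zs))" unfolding LOG_def using assms(5) by (intro agen.base) blast
  then have "L zs \<in> nui (int n - int t)" using assms(2) by (auto simp: nui_def)
  ultimately show ?thesis unfolding GEN_def by (intro agen.base) blast
qed

text \<open>For \<open>t \<le> n\<close> bilinearity reduces the group to products of logarithmic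
  forms; for \<open>t > n\<close> the right factor is zero.\<close>

lemma GEN_le:
  fixes K :: "'a::field set"
  assumes X: "0 \<in> X" "\<And>x y. x \<in> X \<Longrightarrow> y \<in> X \<Longrightarrow> x + y \<in> X" "\<And>x. x \<in> X \<Longrightarrow> - x \<in> X"
    and log: "\<And>ys zs. length ys = t \<Longrightarrow> t + length zs = n \<Longrightarrow> set ys \<subseteq> K \<Longrightarrow> 0 \<notin> set ys \<Longrightarrow> 0 \<notin> set zs
      \<Longrightarrow> L ys * L zs \<in> X"
  shows "GEN t K n \<subseteq> X"
proof (cases "t \<le> n")
  case True
  then have "(nui (int n - int t) :: 'a ext set) = agen (LOG (n - t))" by (simp add: nui_def nat_diff_distrib)
  then have "GEN t K n = agen {x * y | x y. x \<in> LK t K \<and> y \<in> LOG (n - t)}"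
    unfolding GEN_def by (simp add: agen_products)
  moreover have "{x * y | x y. x \<in> LK t K \<and> y \<in> LOG (n - t)} \<subseteq> X"
  proof
    fix z assume "z \<in> {x * y | x y. x \<in> LK t K \<and> y \<in> LOG (n - t)}"
    then obtain ys zs where "z = L ys * L zs" "length ys = t" "\<forall>y\<in>set ys. y \<in> K \<and> y \<noteq> 0"
      "length zs = n - t" "0 \<notin> set zs" unfolding LK_def LOG_def by blast
    then show "z \<in> X" using True by (auto intro!: log)
  qed
  ultimately show ?thesis using agen_le[OF X] by simp
next
  case False
  then have "{x * y | x y. x \<in> agen (LK t K) \<and> y \<in> nui (int n - int t)} \<subseteq> X"
    using X(1) by (auto simp: nui_def)
  then show ?thesis unfolding GEN_def using agen_le[OF X] by simp
qed

lemma LK_set: "{dlogC ys | ys. length ys = t \<and> (\<forall>y\<in>set ys. y \<in> K \<and> y \<noteq> 0)} = Rep_ext ` LK t K"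
  unfolding LK_def by (rule dlogC_set)

lemma LK_1: "{dlogC [x] | x. x \<in> K \<and> x \<noteq> 0} = Rep_ext ` LK 1 K"
proof -
  have "{dlogC [x] | x. x \<in> K \<and> x \<noteq> 0} = {dlogC ys | ys. length ys = 1 \<and> (\<forall>y\<in>set ys. y \<in> K \<and> y \<noteq> 0)}"
    (is "?A = ?B")
  proof (intro equalityI subsetI)
    fix z assume "z \<in> ?A"
    then obtain x where "z = dlogC [x]" "x \<in> K" "x \<noteq> 0" by blast
    then show "z \<in> ?B" by (intro CollectI exI[of _ "[x]"]) simp
  next
    fix z assume "z \<in> ?B"
    then obtain ys where ys: "z = dlogC ys" "length ys = 1" "\<forall>y\<in>set ys. y \<in> K \<and> y \<noteq> 0" by blast
    then obtain x where "ys = [x]" by (auto simp: length_Suc_conv)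
    then show "z \<in> ?A" using ys by auto
  qed
  then show ?thesis unfolding LK_set .
qed

context char_p
begin

lemma nu_int_Rep:
  assumes "\<forall>y::'a. \<exists>x. y = x ^ (p - 1)"
  shows "(nu_int p m :: 'a fsum set set) = Rep_ext ` nui m"
  unfolding nu_int_def nui_def nu_Rep nue_generated[OF assms] by (simp add: Rep_0)

text \<open>Logarithmic forms are scalar multiples of words, and by \<open>W_skip\<close> the factor
  from \<open>zs\<close> does not matter once \<open>W (ys @ s)\<close> vanishes.\<close>

lemma GEN_annihilates:
  assumes pm1: "\<forall>y::'a. \<exists>x. y = x ^ (p - 1)"
    and K: "\<And>ys s. length ys = t \<Longrightarrow> set ys \<subseteq> K \<Longrightarrow> Q s \<Longrightarrow> W (ys @ s) = 0"
  shows "GEN t K n \<subseteq> {\<omega>::'a ext. \<omega> \<in> nue p n \<and> (\<forall>s. Q s \<longrightarrow> \<omega> * W s = 0)}"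
proof (rule GEN_le)
  let ?X = "{\<omega>::'a ext. \<omega> \<in> nue p n \<and> (\<forall>s. Q s \<longrightarrow> \<omega> * W s = 0)}"
  show "0 \<in> ?X" using nue_0 by simp
  show "x + y \<in> ?X" if "x \<in> ?X" "y \<in> ?X" for x y using that nue_add by (simp add: distrib_right)
  show "- x \<in> ?X" if "x \<in> ?X" for x using that agen.neg[of x] by (simp add: nue_generated[OF pm1])
  fix ys zs :: "'a list" assume l: "length ys = t" "t + length zs = n" "set ys \<subseteq> K" "0 \<notin> set ys" "0 \<notin> set zs"
  have "L ys * L zs = sc (of_nat 1) * L (ys @ zs)" by simp
  also have "\<dots> \<in> nue p n" using l by (intro nue_log) auto
  finally have "L ys * L zs \<in> nue p n" .
  moreover have "L ys * L zs * W s = 0" if "Q s" for s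
  proof -
    have "W ys * W s = 0" using K[OF l(1,3) that] by (simp add: W_append)
    then have "W ys * (W zs * W s) = 0" by (rule W_skip)
    then show ?thesis unfolding L_eq by (simp add: mult.assoc sc_left_commute[of "W ys"])
  qed
  ultimately show "L ys * L zs \<in> ?X" by simp
qed

lemma p_indep_notin_image:
  fixes b0 :: "nat \<Rightarrow> 'a"
  assumes "p_indep p (b0 ` {..<k})" "card (b0 ` {..<k}) = k"
  shows "\<forall>j<k. b0 j \<notin> Fpadj p (b0 ` ({..<k} - {j}))"
proof (intro allI impI)
  fix j assume j: "j < k"
  have "inj_on b0 {..<k}" using assms(2) by (intro eq_card_imp_inj_on) auto
  then have "b0 ` ({..<k} - {j}) = b0 ` {..<k} - {b0 j}" using j by (auto simp: inj_on_def)
  then show "b0 j \<notin> Fpadj p (b0 ` ({..<k} - {j}))" using p_indep_notin[OF assms(1), of "b0 j"] j by auto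
qed

text \<open>An index set that meets every \<open>r\<close>-subset of the first \<open>k\<close>
  indices misses at most \<open>r - 1\<close> of them, so it contains at least
  \<open>k - r + 1\<close>. Conversely \<open>k - r + 1\<close> differentials and \<open>r\<close>
  further ones exceed the number \<open>k\<close> of generators.\<close>

lemma annihilator_power:
  fixes S :: "'a set" and a :: "nat \<Rightarrow> 'a"
  assumes pm1: "\<forall>y::'a. \<exists>x. y = x ^ (p - 1)"
    and S: "pdeg p S = enat k" "p_basis p (Fpadj p S) (a ` {1..k})" and r: "r \<in> {1..k}"
  shows "{\<omega> \<in> nue p n. \<forall>s. length s = r \<and> (\<forall>i<r. s ! i \<in> S) \<longrightarrow> \<omega> * W s = 0}
    = GEN (k - r + 1) (Fpadj p (a ` {1..k})) n"
proof
  let ?K = "Fpadj p (a ` {1..k})" and ?t = "k - r + 1"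
  let ?P = "\<lambda>\<omega>::'a ext. \<forall>s. length s = r \<and> (\<forall>i<r. s ! i \<in> S) \<longrightarrow> \<omega> * W s = 0"
  have ind: "p_indep p (a ` {1..k})" and KS: "?K = Fpadj p S" using S(2) by (auto simp: p_basis_def)
  \<comment> \<open>The enumeration \<open>a\<close> might repeat elements; comparing degrees shows
    that it does not.\<close>
  have "p ^ card (a ` {1..k}) = p ^ k"
    using has_degree_dim[OF p_indep_degree[OF ind]] has_degree_dim[OF pdeg_enatD[OF S(1)]] KS by simp
  then have card: "card (a ` {1..k}) = k" using p_gt_1 by simp
  have SK: "S \<subseteq> ?K" unfolding KS by (rule subset_Fpadj)
  define b0 where "b0 j = a (Suc j)" for j
  have im: "b0 ` {..<k} = a ` {1..k}"
    using image_image[of a Suc "{..<k}"] by (simp add: b0_def image_Suc_lessThan)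
  have sub: "GEN ?t ?K n \<subseteq> {\<omega>::'a ext. \<omega> \<in> nue p n \<and> ?P \<omega>}"
  proof (rule GEN_annihilates[OF pm1])
    fix ys s assume s: "length ys = ?t" "set ys \<subseteq> ?K" "length s = r \<and> (\<forall>i<r. s ! i \<in> S)"
    show "W (ys @ s) = 0"
    proof (rule W_too_long)
      show "card (a ` {1..k}) < length (ys @ s)" using s r card by simp
      have "set s \<subseteq> S" using s(3) by (auto simp: in_set_conv_nth)
      then show "set (ys @ s) \<subseteq> ?K" unfolding set_append using s(2) SK by blast
    qed simp
  qed
  then show "GEN ?t ?K n \<subseteq> {\<omega> \<in> nue p n. ?P \<omega>}" .
  show "{\<omega> \<in> nue p n. ?P \<omega>} \<subseteq> GEN ?t ?K n"
  proof clarify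
    fix \<omega> :: "'a ext" assume \<omega>: "\<omega> \<in> nue p n" "?P \<omega>"
    show "\<omega> \<in> GEN ?t ?K n"
    proof (rule annihilator_induction[OF pm1, where ?b0.0 = b0 and k = k and P = ?P and n = n
          and \<C> = "{C. C \<subseteq> {..<k} \<and> card C = r}"])
      show "\<forall>j<k. b0 j \<notin> Fpadj p (b0 ` ({..<k} - {j}))"
        using ind card by (intro p_indep_notin_image) (simp_all add: im)
      show "?P \<omega>" if "\<omega> \<in> GEN ?t ?K n" for \<omega> using that sub by blast
      fix \<omega> C assume P: "?P \<omega>" and C: "C \<in> {C. C \<subseteq> {..<k} \<and> card C = r}"
      let ?l = "map b0 (sorted_list_of_set C)"
      have fin: "finite C" using C finite_subset[of C "{..<k}"] by auto
      show "\<omega> * W ?l = 0"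
      proof (rule W_slots[where S = "\<lambda>_. S"])
        fix i assume "i < length ?l"
        then have "?l ! i \<in> b0 ` C" using fin nth_mem[of i ?l] by (simp del: nth_mem length_map)
        then have "?l ! i \<in> a ` {1..k}" using C im by blast
        then show "?l ! i \<in> Fpadj p S" unfolding KS[symmetric] using subset_Fpadj by blast
      qed (use P C in auto)
    next
      fix \<alpha> :: "nat set" assume \<alpha>: "finite \<alpha>" "\<forall>C\<in>{C. C \<subseteq> {..<k} \<and> card C = r}. \<alpha> \<inter> C \<noteq> {}"
      have "?t \<le> card (\<alpha> \<inter> {..<k})"
      proof (rule ccontr)
        assume "\<not> ?t \<le> card (\<alpha> \<inter> {..<k})"
        moreover have "card ({..<k} - \<alpha>) = k - card (\<alpha> \<inter> {..<k})"
          using card_Diff_subset_Int[of "{..<k}" \<alpha>] by (simp add: Int_commute)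
        ultimately have "r \<le> card ({..<k} - \<alpha>)" using r by (simp only: atLeastAtMost_iff) arith
        then obtain C where "C \<subseteq> {..<k} - \<alpha>" "card C = r" by (rule obtain_subset_with_card_n)
        then show False using \<alpha>(2) by blast
      qed
      moreover have "L ys * L zs \<in> GEN ?t ?K n" if "length ys = ?t" "?t + length zs = n"
        "set ys \<subseteq> Fpadj p (b0 ` {..<k})" "0 \<notin> set ys" "0 \<notin> set zs" for ys zs
        using that by (intro GEN_log) (simp_all add: im)
      ultimately show "\<exists>t q. q \<le> k \<and> t \<le> card (\<alpha> \<inter> {..<q}) \<and>
         (\<forall>ys zs. length ys = t \<longrightarrow> t + length zs = n \<longrightarrow> set ys \<subseteq> Fpadj p (b0 ` {..<q}) \<longrightarrow> 0 \<notin> set ys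
          \<longrightarrow> 0 \<notin> set zs \<longrightarrow> L ys * L zs \<in> GEN ?t ?K n)"
        by (intro exI[of _ ?t] exI[of _ k]) auto
    qed (use \<omega> GEN_0 GEN_add in \<open>auto simp: left_diff_distrib\<close>)
  qed
qed

lemma annihilator_power_large:
  fixes S :: "'a set" and a :: "nat \<Rightarrow> 'a"
  assumes S: "p_basis p (Fpadj p S) (a ` {1..k})" and s: "length s = r" "\<forall>i<r. s ! i \<in> S" "k < r"
  shows "W s = 0"
proof (rule W_too_long)
  have "card (a ` {1..k}) \<le> k" using card_image_le[of "{1..k}" a] by simp
  then show "card (a ` {1..k}) < length s" using s by simp
  have SK: "S \<subseteq> Fpadj p (a ` {1..k})" using S subset_Fpadj[of S p] by (simp add: p_basis_def)
  have "set s \<subseteq> S" using s by (auto simp: in_set_conv_nth)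
  then show "set s \<subseteq> Fpadj p (a ` {1..k})" using SK by blast
qed simp

lemma nonzero_wedge_bound:
  fixes S :: "nat \<Rightarrow> 'a set"
  assumes S: "\<forall>i\<in>{1..r+1}. S i \<noteq> {}" "dwedge (r+1) S \<noteq> {zeroC}"
    and m: "pdeg p (\<Union>i\<in>{1..r+1}. S i) = enat m"
  shows "r + 1 \<le> m"
proof -
  \<comment> \<open>The assumption \<open>dwedge (r+1) S \<noteq> {zeroC}\<close> also holds for an
    empty set. One choice of a tuple rules this out, so a nonzero product exists.\<close>
  define s0 where "s0 = map (\<lambda>i. SOME x. x \<in> S (Suc i)) [0..<r+1]"
  have "s0 ! i \<in> S (Suc i)" if "i < r + 1" for i
    using that S(1) by (auto simp: s0_def some_in_eq simp del: upt_Suc)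
  then have "cls (dl s0) \<in> dwedge (r+1) S" unfolding dwedge_def by (auto simp: s0_def)
  then obtain s where s: "length s = r + 1" "\<forall>i<r+1. s ! i \<in> S (Suc i)" "cls (dl s) \<noteq> zeroC"
    using S(2) unfolding dwedge_def by blast
  have "W s \<noteq> 0" using s(3) unfolding Rep_W[symmetric] Rep_0[symmetric] by auto
  moreover have "set s \<subseteq> (\<Union>i\<in>{1..r+1}. S i)"
  proof
    fix x assume "x \<in> set s"
    then obtain i where "i < r + 1" "x = s ! i" using s(1) by (auto simp: in_set_conv_nth)
    then have "Suc i \<in> {1..r+1}" "x \<in> S (Suc i)" using s(2) by auto
    then show "x \<in> (\<Union>i\<in>{1..r+1}. S i)" by blast
  qed
  then have "set s \<subseteq> Fpadj p (\<Union>i\<in>{1..r+1}. S i)" using subset_Fpadj by blast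
  ultimately have "length s \<le> m" using length_le_degree pdeg_enatD[OF m] by blast
  then show ?thesis using s(1) by simp
qed

text \<open>The sets \<open>C\<close> consist of the first \<open>r\<close> indices and one
  \<open>j\<close> with \<open>r \<le> j < m\<close>. To meet all of them, an index set contains an
  index below \<open>r\<close> or all of \<open>r, ..., m - 1\<close>; the two cases give the two
  summands.\<close>

lemma annihilator_product:
  fixes S :: "nat \<Rightarrow> 'a set" and a e :: "nat \<Rightarrow> 'a"
  assumes pm1: "\<forall>y::'a. \<exists>x. y = x ^ (p - 1)"
    and r: "r \<ge> 1" "r + 1 \<le> m"
    and ind: "p_indep p (a ` {1..r} \<union> e ` {1..m-r})" "card (a ` {1..r} \<union> e ` {1..m-r}) = m"
    and Sa: "\<forall>i\<in>{1..r}. Fpadj p (S i) = Fpadj p {a i}"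
    and Se: "Fpadj p (a ` {1..r} \<union> S (r+1)) = Fpadj p (a ` {1..r} \<union> e ` {1..m-r})"
  shows "{\<omega> \<in> nue p n. \<forall>s. length s = r + 1 \<and> (\<forall>i<r+1. s ! i \<in> S (Suc i)) \<longrightarrow> \<omega> * W s = 0}
    = {x + y | x y. x \<in> GEN 1 (Fpadj p (a ` {1..r})) n \<and> y \<in> GEN (m - r) (Fpadj p (a ` {1..r} \<union> e ` {1..m-r})) n}"
    (is "?A = ?H")
proof
  let ?K = "Fpadj p (a ` {1..r})" and ?M = "Fpadj p (a ` {1..r} \<union> e ` {1..m-r})"
  let ?Q = "\<lambda>s. length s = r + 1 \<and> (\<forall>i<r+1. s ! i \<in> S (Suc i))"
  let ?P = "\<lambda>\<omega>::'a ext. \<forall>s. ?Q s \<longrightarrow> \<omega> * W s = 0"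
  \<comment> \<open>The \<open>a i\<close> come before the \<open>e i\<close>, so that a factor with
    index below \<open>r\<close> lies in the field generated by the \<open>a i\<close>.\<close>
  define b0 where "b0 j = (if j < r then a (Suc j) else e (Suc j - r))" for j
  have im_r: "b0 ` {..<r} = a ` {1..r}"
  proof -
    have "b0 ` {..<r} = (\<lambda>j. a (Suc j)) ` {..<r}" by (intro image_cong) (auto simp: b0_def)
    also have "\<dots> = a ` Suc ` {..<r}" by (simp only: image_image)
    finally show ?thesis by (simp only: image_Suc_lessThan)
  qed
  have im_e: "b0 ` {r..<m} = e ` {1..m-r}"
  proof (intro equalityI subsetI)
    fix x assume "x \<in> b0 ` {r..<m}"
    then obtain j where "x = e (Suc j - r)" "r \<le> j" "j < m" by (auto simp: b0_def)
    then show "x \<in> e ` {1..m-r}" by (intro image_eqI[of _ _ "Suc j - r"]) auto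
  next
    fix x assume "x \<in> e ` {1..m-r}"
    then obtain i where "x = e i" "1 \<le> i" "i \<le> m - r" by auto
    then show "x \<in> b0 ` {r..<m}" using r by (intro image_eqI[of _ _ "r + i - 1"]) (auto simp: b0_def)
  qed
  have im: "b0 ` {..<m} = a ` {1..r} \<union> e ` {1..m-r}"
  proof -
    have "{..<m} = {..<r} \<union> {r..<m}" using r by auto
    then show ?thesis by (simp only: image_Un im_r im_e)
  qed
  have KM: "?K \<subseteq> ?M" by (intro Fpadj_mono) auto
  have SK: "S (Suc i) \<subseteq> ?K" if "i < r" for i
  proof -
    have "S (Suc i) \<subseteq> Fpadj p {a (Suc i)}" using Sa that subset_Fpadj[of "S (Suc i)" p] by auto
    also have "\<dots> \<subseteq> ?K" using that by (intro Fpadj_mono) auto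
    finally show ?thesis .
  qed
  have SM: "S (Suc i) \<subseteq> ?M" if "i < r + 1" for i
  proof (cases "i < r")
    case True then show ?thesis using SK KM by blast
  next
    case False
    then have "i = r" using that by simp
    then show ?thesis unfolding Se[symmetric] using subset_Fpadj[of "a ` {1..r} \<union> S (r+1)" p] by auto
  qed
  have sub1: "GEN 1 ?K n \<subseteq> {\<omega>::'a ext. \<omega> \<in> nue p n \<and> ?P \<omega>}"
  proof (rule GEN_annihilates[OF pm1])
    fix ys s assume s: "length ys = 1" "set ys \<subseteq> ?K" "?Q s"
    have "W (ys @ take r s) = 0"
    proof (rule W_too_long)
      have "card (a ` {1..r}) \<le> r" using card_image_le[of "{1..r}" a] by simp
      then show "card (a ` {1..r}) < length (ys @ take r s)" using s by simp
      have "set (take r s) \<subseteq> ?K" using s(3) SK by (force simp: in_set_conv_nth)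
      then show "set (ys @ take r s) \<subseteq> ?K" using s(2) by simp
    qed simp
    then have "W ((ys @ take r s) @ drop r s) = 0" unfolding W_append[of "ys @ take r s"] by simp
    then show "W (ys @ s) = 0" by simp
  qed
  have sub2: "GEN (m - r) ?M n \<subseteq> {\<omega>::'a ext. \<omega> \<in> nue p n \<and> ?P \<omega>}"
  proof (rule GEN_annihilates[OF pm1])
    fix ys s assume s: "length ys = m - r" "set ys \<subseteq> ?M" "?Q s"
    show "W (ys @ s) = 0"
    proof (rule W_too_long)
      show "card (a ` {1..r} \<union> e ` {1..m-r}) < length (ys @ s)" using s r ind(2) by simp
      have "set s \<subseteq> ?M" using s(3) SM by (force simp: in_set_conv_nth)
      then show "set (ys @ s) \<subseteq> ?M" using s(2) by simp
    qed simp
  qed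
  have HA: "\<omega> \<in> nue p n \<and> ?P \<omega>" if wH: "\<omega> \<in> ?H" for \<omega>
  proof -
    obtain x y where xy: "\<omega> = x + y" "x \<in> GEN 1 ?K n" "y \<in> GEN (m - r) ?M n" using wH by blast
    then have "x \<in> nue p n" "?P x" "y \<in> nue p n" "?P y" using sub1 sub2 by blast+
    then show ?thesis unfolding xy(1) using nue_add by (simp add: distrib_right)
  qed
  then show "?H \<subseteq> ?A" by blast
  show "?A \<subseteq> ?H"
  proof
    fix \<omega> assume "\<omega> \<in> ?A"
    then have \<omega>: "\<omega> \<in> nue p n" "?P \<omega>" by auto
    show "\<omega> \<in> ?H"
    proof (rule annihilator_induction[OF pm1, where ?b0.0 = b0 and k = m and P = ?P and n = n
          and \<C> = "(\<lambda>j. insert j {..<r}) ` {r..<m}"])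
      show "\<forall>j<m. b0 j \<notin> Fpadj p (b0 ` ({..<m} - {j}))"
        using ind by (intro p_indep_notin_image) (simp_all add: im)
      show "0 \<in> ?H" using GEN_0 by (metis (mono_tags, lifting) add_0 mem_Collect_eq)
      show "\<omega> + \<eta> \<in> ?H" if wH: "\<omega> \<in> ?H" "\<eta> \<in> ?H" for \<omega> \<eta>
      proof -
        obtain x y x' y' where "\<omega> = x + y" "x \<in> GEN 1 ?K n" "y \<in> GEN (m - r) ?M n"
          "\<eta> = x' + y'" "x' \<in> GEN 1 ?K n" "y' \<in> GEN (m - r) ?M n" using wH by blast
        then have "\<omega> + \<eta> = (x + x') + (y + y')" "x + x' \<in> GEN 1 ?K n" "y + y' \<in> GEN (m - r) ?M n"
          using GEN_add by auto
        then show ?thesis by blast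
      qed
      show "?P \<omega>" if "\<omega> \<in> ?H" for \<omega> using HA[OF that] by blast
      show "?P (\<omega> - \<eta>)" if "?P \<omega>" "?P \<eta>" for \<omega> \<eta> using that by (simp add: left_diff_distrib)
      show "C \<subseteq> {..<m}" if "C \<in> (\<lambda>j. insert j {..<r}) ` {r..<m}" for C using that r by auto
      fix \<omega> C assume P: "?P \<omega>" and "C \<in> (\<lambda>j. insert j {..<r}) ` {r..<m}"
      then obtain j where j: "r \<le> j" "j < m" "C = insert j {..<r}" by auto
      let ?as = "map b0 [0..<r]"
      have sl: "sorted_list_of_set C = [0..<r] @ [j]"
        unfolding j(3) using j(1) sorted_list_of_set_insert_greater[of "{..<r}" j] by (simp add: lessThan_atLeast0)
      \<comment> \<open>The last slot is freed from \<open>S (r+1)\<close>: an \<open>a i\<close>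
        repeats an earlier factor, and elements of \<open>S (r+1)\<close> are covered by the
        annihilator condition. \<open>D_slot\<close> then reaches the whole field, which contains
        \<open>b0 j\<close>.\<close>
      have "\<omega> * W ?as * D c * 1 = 0" if c: "c \<in> a ` {1..r} \<union> S (r+1)" for c
      proof (cases "c \<in> a ` {1..r}")
        case True
        then have "c \<in> set ?as" using im_r by (simp add: lessThan_atLeast0)
        then show ?thesis using W_mem_D[of c ?as] by (simp add: mult.assoc)
      next
        case False
        have "\<omega> * W (?as @ [c]) = 0"
        proof (rule W_slots[where S = "\<lambda>i. S (Suc i)"])
          fix i assume i: "i < length (?as @ [c])"
          show "(?as @ [c]) ! i \<in> Fpadj p (S (Suc i))"
          proof (cases "i < r")
            case True
            then have "Fpadj p (S (Suc i)) = Fpadj p {a (Suc i)}" using Sa by auto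
            moreover have "(?as @ [c]) ! i = a (Suc i)" using True by (simp add: nth_append b0_def)
            ultimately show ?thesis using subset_Fpadj[of "{a (Suc i)}" p] by simp
          next
            case F: False
            then have "i = r" using i by simp
            then show ?thesis using False c subset_Fpadj[of "S (r+1)" p] by (auto simp: nth_append)
          qed
        qed (use P in auto)
        then show ?thesis by (simp add: W_append mult.assoc)
      qed
      moreover have "b0 j \<in> Fpadj p (a ` {1..r} \<union> S (r+1))"
        unfolding Se im[symmetric] using j(2) by (intro subsetD[OF subset_Fpadj]) auto
      ultimately have "\<omega> * W ?as * D (b0 j) * 1 = 0" by (rule D_slot)
      then show "\<omega> * W (map b0 (sorted_list_of_set C)) = 0" unfolding sl by (simp add: W_append mult.assoc)
    next
      fix \<alpha> :: "nat set"
      assume \<alpha>: "finite \<alpha>" "\<forall>C\<in>(\<lambda>j. insert j {..<r}) ` {r..<m}. \<alpha> \<inter> C \<noteq> {}"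
      have H1: "x \<in> ?H" if "x \<in> GEN 1 ?K n" for x using that GEN_0[of "m - r" ?M n] by force
      have H2: "x \<in> ?H" if "x \<in> GEN (m - r) ?M n" for x using that GEN_0[of 1 ?K n] by force
      show "\<exists>t q. q \<le> m \<and> t \<le> card (\<alpha> \<inter> {..<q}) \<and>
         (\<forall>ys zs. length ys = t \<longrightarrow> t + length zs = n \<longrightarrow> set ys \<subseteq> Fpadj p (b0 ` {..<q}) \<longrightarrow> 0 \<notin> set ys
          \<longrightarrow> 0 \<notin> set zs \<longrightarrow> L ys * L zs \<in> ?H)"
      proof (cases "\<alpha> \<inter> {..<r} = {}")
        case False
        then have "1 \<le> card (\<alpha> \<inter> {..<r})" using \<alpha>(1) by (simp add: Suc_le_eq card_gt_0_iff)
        moreover have "L ys * L zs \<in> ?H" if "length ys = 1" "1 + length zs = n" "set ys \<subseteq> Fpadj p (b0 ` {..<r})"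
          "0 \<notin> set ys" "0 \<notin> set zs" for ys zs
          using that by (intro H1 GEN_log) (simp_all add: im_r)
        ultimately show ?thesis using r by (intro exI[of _ 1] exI[of _ r]) auto
      next
        case True
        have "{r..<m} \<subseteq> \<alpha>"
        proof
          fix j assume "j \<in> {r..<m}"
          then have "\<alpha> \<inter> insert j {..<r} \<noteq> {}" using \<alpha>(2) by blast
          then show "j \<in> \<alpha>" using True by blast
        qed
        then have "card {r..<m} \<le> card (\<alpha> \<inter> {..<m})" using \<alpha>(1) by (intro card_mono) auto
        then have "m - r \<le> card (\<alpha> \<inter> {..<m})" by simp
        moreover have "L ys * L zs \<in> ?H" if "length ys = m - r" "m - r + length zs = n" "set ys \<subseteq> Fpadj p (b0 ` {..<m})"
          "0 \<notin> set ys" "0 \<notin> set zs" for ys zs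
          using that by (intro H2 GEN_log) (simp_all add: im)
        ultimately show ?thesis by (intro exI[of _ "m - r"] exI[of _ m]) auto
      qed
    qed (use \<omega> in blast)+
  qed
qed

end

theorem theorem4p3:
  fixes p :: nat
  assumes char: "prime (p::nat)" "of_nat p = (0::'a::field)"
    and pm1: "\<forall>y::'a. \<exists>x. y = x ^ (p - 1)"
  shows
  "(\<forall>(r::nat) (S::nat \<Rightarrow> 'a set) (m::nat) (n::nat).
      r \<ge> 1 \<and> (\<forall>i\<in>{1..r+1}. S i \<noteq> {}) \<and> (\<forall>i\<in>{1..r}. pdeg p (S i) = 1)
      \<and> dwedge (r+1) S \<noteq> {zeroC}
      \<and> pdeg p (\<Union>i\<in>{1..r+1}. S i) = enat m
      \<longrightarrow> int m - int r \<ge> 1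
        \<and> (\<forall>(a::nat \<Rightarrow> 'a) (e::nat \<Rightarrow> 'a).
             p_indep p (a ` {1..r} \<union> e ` {1..m-r}) \<and> card (a ` {1..r} \<union> e ` {1..m-r}) = m
             \<and> (\<forall>i\<in>{1..r}. Fpadj p (S i) = Fpadj p {a i})
             \<and> Fpadj p (a ` {1..r} \<union> S (r+1)) = Fpadj p (a ` {1..r} \<union> e ` {1..m-r})
             \<longrightarrow> annnu p n (dwedge (r+1) S) =
                 sumS
                   (wedgeS (addgen {dlogC [x] | x. x \<in> Fpadj p (a ` {1..r}) \<and> x \<noteq> 0})
                           (nu_int p (int n - 1)))
                   (wedgeS (addgen {dlogC ys | ys. length ys = m - r
                                     \<and> (\<forall>y\<in>set ys. y \<in> Fpadj p (a ` {1..r} \<union> e ` {1..m-r}) \<and> y \<noteq> 0)})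
                           (nu_int p (int n - int (m - r))))))
   \<and> (\<forall>(S::'a set) (k::nat) (a::nat \<Rightarrow> 'a) (n::nat).
      S \<noteq> {} \<and> pdeg p S = enat k \<and> p_basis p (Fpadj p S) (a ` {1..k})
      \<longrightarrow> (\<forall>r\<in>{1..k}.
             annnu p n (dwedge r (\<lambda>_. S)) =
               wedgeS (addgen {dlogC ys | ys. length ys = k - r + 1
                                 \<and> (\<forall>y\<in>set ys. y \<in> Fpadj p (a ` {1..k}) \<and> y \<noteq> 0)})
                      (nu_int p (int n - int (k - r + 1))))
        \<and> (\<forall>r. r > k \<longrightarrow> annnu p n (dwedge r (\<lambda>_. S)) = nu p n))"
proof -
  have "char_p TYPE('a) p" using char by unfold_locales
  then interpret char_p p "TYPE('a)" .
  \<comment> \<open>Identifies a summand of the statement with a group in \<open>ext\<close>; here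
    generation of \<open>nu\<close> by logarithmic forms enters through
    \<open>nu_int_Rep\<close>.\<close>
  have GEN: "wedgeS (Rep_ext ` agen (LK t K)) (nu_int p (int n - int t)) = Rep_ext ` GEN t K n"
    for t n and K :: "'a set"
    unfolding nu_int_Rep[OF pm1] wedgeS_Rep GEN_def ..
  have a: "int m - int r \<ge> 1
        \<and> (\<forall>(a::nat \<Rightarrow> 'a) (e::nat \<Rightarrow> 'a).
             p_indep p (a ` {1..r} \<union> e ` {1..m-r}) \<and> card (a ` {1..r} \<union> e ` {1..m-r}) = m
             \<and> (\<forall>i\<in>{1..r}. Fpadj p (S i) = Fpadj p {a i})
             \<and> Fpadj p (a ` {1..r} \<union> S (r+1)) = Fpadj p (a ` {1..r} \<union> e ` {1..m-r})
             \<longrightarrow> annnu p n (dwedge (r+1) S) =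
                 sumS
                   (wedgeS (addgen {dlogC [x] | x. x \<in> Fpadj p (a ` {1..r}) \<and> x \<noteq> 0})
                           (nu_int p (int n - 1)))
                   (wedgeS (addgen {dlogC ys | ys. length ys = m - r
                                     \<and> (\<forall>y\<in>set ys. y \<in> Fpadj p (a ` {1..r} \<union> e ` {1..m-r}) \<and> y \<noteq> 0)})
                           (nu_int p (int n - int (m - r)))))"
    if h: "r \<ge> 1 \<and> (\<forall>i\<in>{1..r+1}. S i \<noteq> {}) \<and> (\<forall>i\<in>{1..r}. pdeg p (S i) = 1)
      \<and> dwedge (r+1) S \<noteq> {zeroC} \<and> pdeg p (\<Union>i\<in>{1..r+1}. S i) = enat m"
    for r m n and S :: "nat \<Rightarrow> 'a set"
  proof (intro conjI allI impI)
    have rm: "r + 1 \<le> m" using h by (intro nonzero_wedge_bound[of r S m]) auto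
    then show "int m - int r \<ge> 1" by simp
    fix a e :: "nat \<Rightarrow> 'a"
    assume ae: "p_indep p (a ` {1..r} \<union> e ` {1..m-r}) \<and> card (a ` {1..r} \<union> e ` {1..m-r}) = m
             \<and> (\<forall>i\<in>{1..r}. Fpadj p (S i) = Fpadj p {a i})
             \<and> Fpadj p (a ` {1..r} \<union> S (r+1)) = Fpadj p (a ` {1..r} \<union> e ` {1..m-r})"
    have "annnu p n (dwedge (r+1) S) = Rep_ext ` {x + y | x y. x \<in> GEN 1 (Fpadj p (a ` {1..r})) n
        \<and> y \<in> GEN (m - r) (Fpadj p (a ` {1..r} \<union> e ` {1..m-r})) n}"
      unfolding annnu_Rep using h rm ae by (subst annihilator_product[OF pm1, of r m a e S n]) auto
    also have "\<dots> = sumS (Rep_ext ` GEN 1 (Fpadj p (a ` {1..r})) n)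
        (Rep_ext ` GEN (m - r) (Fpadj p (a ` {1..r} \<union> e ` {1..m-r})) n)"
      by (rule sumS_Rep[symmetric])
    finally show "annnu p n (dwedge (r+1) S) =
                 sumS
                   (wedgeS (addgen {dlogC [x] | x. x \<in> Fpadj p (a ` {1..r}) \<and> x \<noteq> 0})
                           (nu_int p (int n - 1)))
                   (wedgeS (addgen {dlogC ys | ys. length ys = m - r
                                     \<and> (\<forall>y\<in>set ys. y \<in> Fpadj p (a ` {1..r} \<union> e ` {1..m-r}) \<and> y \<noteq> 0)})
                           (nu_int p (int n - int (m - r))))"
      unfolding LK_1 LK_set addgen_Rep using GEN[of 1] by (simp add: GEN)
  qed
  have b1: "annnu p n (dwedge r (\<lambda>_. S)) =
               wedgeS (addgen {dlogC ys | ys. length ys = k - r + 1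
                                 \<and> (\<forall>y\<in>set ys. y \<in> Fpadj p (a ` {1..k}) \<and> y \<noteq> 0)})
                      (nu_int p (int n - int (k - r + 1)))"
    if "pdeg p S = enat k" "p_basis p (Fpadj p S) (a ` {1..k})" "r \<in> {1..k}"
    for k n r and S :: "'a set" and a :: "nat \<Rightarrow> 'a"
    unfolding annnu_Rep annihilator_power[OF pm1 that] LK_set addgen_Rep GEN ..
  have b2: "annnu p n (dwedge r (\<lambda>_. S)) = nu p n" if "p_basis p (Fpadj p S) (a ` {1..k})" "k < r"
    for k n r and S :: "'a set" and a :: "nat \<Rightarrow> 'a"
    unfolding annnu_Rep nu_Rep using annihilator_power_large[OF that(1) _ _ that(2)] by auto
  show ?thesis
  proof (rule conjI, goal_cases)
    case 1 show ?case by (intro allI impI) (rule a)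
  next
    case 2 show ?case
      by (intro allI impI, elim conjE, intro conjI ballI allI impI) (rule b1 b2; assumption)+
  qed
qed

end
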